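(* Let $G$ be a compact connected Lie group with Lie algebra $\mathfrak g$, let $\rho:G\to \mathrm{GL}(V)$ be a finite-dimensional representation, and let $G_\rho=G\times_\rho V$ be the semi-direct product, acting on $\mathfrak g\times V=\mathfrak g\oplus V$ by its coadjoint representation $\mathrm{Ad}_\rho^*$ (after identifying $(\mathfrak g\times V)^*$ with $\mathfrak g\times V$ through invariant inner products). Let $x\in V$. Then the coadjoint orbit $\mathrm{Ad}_\rho^*(G_\rho)\cdot x$ is diffeomorphic to the cotangent bundle $T^*(\rho(G)x)$ of the orbit $\rho(G)x\subset V$, by a diffeomorphism $$\phi:\mathrm{Ad}_\rho^*(G_\rho)\cdot x\to T^*(\rho(G)x)$$ satisfying $$\phi\big(w+\mu_w(V)\big)=T_w^*(\rho(G)x),\qquad w\in\rho(G)x,$$ and such that the restriction of $\phi$ to each fiber $w+\mu_w(V)$ is given by a linear isomorphism $\mu_w(V)\to T_w^*(\rho(G)x)$.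
   Context: $V$ is regarded as a real vector space with a $G$-invariant real inner product $\langle\cdot,\cdot\rangle$ (if $V$ is complex, take the real part of an invariant Hermitian product), and $\mathfrak g$ carries an $\mathrm{Ad}(G)$-invariant inner product. $\rho$ also denotes the infinitesimal representation of $\mathfrak g$ on $V$. $G_\rho=G\times_\rho V$ is the semi-direct product with $V$ viewed as an abelian Lie group; its Lie algebra is $\mathfrak g_\rho=\mathfrak g\times V$ with bracket $[(X,v),(Y,w)]=([X,Y],\rho(X)w-\rho(Y)v)$. The inner products identify $\mathfrak g_\rho^*$ with $\mathfrak g_\rho$, so that the coadjoint representation $\mathrm{Ad}_\rho^*$ of $G_\rho$ acts on $\mathfrak g\times V$. The moment map $\mu:V\wedge V\to\mathfrak g^*\cong\mathfrak g$ of $\rho$ is defined by $\mu(v\wedge w)(X)=\langle\rho(X)v,w\rangle$ for $X\in\mathfrak g$. For $w\in V$, $\mu_w:V\to\mathfrak g$ is the linear map $v\mapsto\mu(v\wedge w)$ (up to sign), whose image is the subspace $\mu_w(V)\subset\mathfrak g$. An element $x\in V$ is regarded as the element $(0,x)\in\mathfrak g\times V$. The orbit $\mathrm{Ad}_\rho^*(G_\rho)\cdot x$ is the disjoint union of the affine subspaces $w+\mu_w(V)$, $w\in\rho(G)x$. *)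

theory Defs
  imports "HOL-Analysis.Analysis" "HOL-Algebra.Group"
begin

section \<open>Smooth maps between subsets of Euclidean spaces\<close>

primrec Ck_on :: "nat \<Rightarrow> 'a::real_normed_vector set \<Rightarrow> ('a \<Rightarrow> 'b::real_normed_vector) \<Rightarrow> bool" where
  "Ck_on 0 U f \<longleftrightarrow> continuous_on U f"
| "Ck_on (Suc k) U f \<longleftrightarrow>
     (\<forall>x\<in>U. f differentiable (at x)) \<and> (\<forall>v. Ck_on k U (\<lambda>x. frechet_derivative f (at x) v))"

text \<open>On an arbitrary set, smooth means: locally the restriction of a smooth map defined on an open
  subset of the ambient space. On a relatively open subset of a linear subspace this is the usual
  smoothness in linear coordinates of that subspace.\<close>

definition smooth_on :: "'a::euclidean_space set \<Rightarrow> ('a \<Rightarrow> 'b::euclidean_space) \<Rightarrow> bool" where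
  "smooth_on S f \<longleftrightarrow>
     (\<forall>x\<in>S. \<exists>U F. open U \<and> x \<in> U \<and> (\<forall>k. Ck_on k U F) \<and> (\<forall>y\<in>U \<inter> S. F y = f y))"

section \<open>Smooth manifolds\<close>

text \<open>A chart is a pair of a domain and a coordinate map. Coordinates live in an \<open>n\<close>-dimensional linear
  subspace of a Euclidean space (a copy of \<open>n\<close>-dimensional Euclidean space), so that the dimension
  of a manifold is not tied to a type and may be any natural number, including 0. If \<open>(U, \<phi>)\<close>
  is a chart with \<open>U\<close> nonempty, its coordinate space is \<open>span (\<phi> ` U)\<close>.\<close>

record ('a, 'e) manifold =
  mtop :: "'a topology"
  atlas :: "('a set \<times> ('a \<Rightarrow> 'e)) set"

definition smooth_manifold :: "('a, 'e::euclidean_space) manifold \<Rightarrow> bool" where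
  "smooth_manifold M \<longleftrightarrow>
     Hausdorff_space (mtop M) \<and> second_countable (mtop M) \<and>
     \<Union> (fst ` atlas M) = topspace (mtop M) \<and>
     (\<exists>n. \<forall>(U, \<phi>)\<in>atlas M.
        openin (mtop M) U \<and>
        (\<exists>E. subspace E \<and> dim E = n \<and> openin (top_of_set E) (\<phi> ` U)) \<and>
        homeomorphic_map (subtopology (mtop M) U) (top_of_set (\<phi> ` U)) \<phi>) \<and>
     (\<forall>(U, \<phi>)\<in>atlas M. \<forall>(W, \<psi>)\<in>atlas M. smooth_on (\<phi> ` (U \<inter> W)) (\<psi> \<circ> inv_into U \<phi>))"

definition smooth_map ::
    "('a, 'e::euclidean_space) manifold \<Rightarrow> ('b, 'f::euclidean_space) manifold \<Rightarrow> ('a \<Rightarrow> 'b) \<Rightarrow> bool" where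
  "smooth_map M N f \<longleftrightarrow>
     continuous_map (mtop M) (mtop N) f \<and>
     (\<forall>(U, \<phi>)\<in>atlas M. \<forall>(W, \<psi>)\<in>atlas N.
        smooth_on (\<phi> ` {p \<in> U. f p \<in> W}) (\<psi> \<circ> f \<circ> inv_into U \<phi>))"

definition diffeomorphism ::
    "('a, 'e::euclidean_space) manifold \<Rightarrow> ('b, 'f::euclidean_space) manifold \<Rightarrow> ('a \<Rightarrow> 'b) \<Rightarrow> bool" where
  "diffeomorphism M N f \<longleftrightarrow>
     smooth_map M N f \<and>
     (\<exists>g. smooth_map N M g \<and>
        (\<forall>p\<in>topspace (mtop M). g (f p) = p) \<and> (\<forall>q\<in>topspace (mtop N). f (g q) = q))"

definition prod_manifold ::
    "('a, 'e) manifold \<Rightarrow> ('b, 'f) manifold \<Rightarrow> ('a \<times> 'b, 'e \<times> 'f) manifold" where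
  "prod_manifold M N =
     \<lparr>mtop = prod_topology (mtop M) (mtop N),
      atlas = {(U \<times> W, map_prod \<phi> \<psi>) | U \<phi> W \<psi>. (U, \<phi>) \<in> atlas M \<and> (W, \<psi>) \<in> atlas N}\<rparr>"

text \<open>A subset \<open>S\<close> of a Euclidean space with its subspace topology and all charts that are
  diffeomorphisms from relatively open subsets of \<open>S\<close> onto open subsets of linear subspaces. The
  charts cover \<open>S\<close>, i.e. \<open>smooth_manifold (submanifold S)\<close> holds, exactly if \<open>S\<close> is an
  embedded submanifold, and then this is its submanifold structure.\<close>

definition submanifold :: "'a::euclidean_space set \<Rightarrow> ('a, 'a) manifold" where
  "submanifold S =
     \<lparr>mtop = top_of_set S,
      atlas = {(U, \<phi>). openin (top_of_set S) U \<and>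
                 (\<exists>E. subspace E \<and> openin (top_of_set E) (\<phi> ` U)) \<and>
                 inj_on \<phi> U \<and> smooth_on U \<phi> \<and> smooth_on (\<phi> ` U) (inv_into U \<phi>)}\<rparr>"

section \<open>Tangent spaces and the cotangent bundle\<close>

definition smooth_near :: "('a, 'e::euclidean_space) manifold \<Rightarrow> 'a \<Rightarrow> ('a \<Rightarrow> real) \<Rightarrow> bool" where
  "smooth_near M p f \<longleftrightarrow>
     (\<exists>W. openin (mtop M) W \<and> p \<in> W \<and>
        (\<forall>(U, \<phi>)\<in>atlas M. smooth_on (\<phi> ` (U \<inter> W)) (f \<circ> inv_into U \<phi>)))"

text \<open>Tangent vectors at \<open>p\<close> are the velocities of smooth curves through \<open>p\<close>, acting as
  directional derivatives on the functions that are smooth near \<open>p\<close>; on all other functions they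
  are 0 by convention. The vector space operations are pointwise.\<close>

definition velocity :: "('a, 'e::euclidean_space) manifold \<Rightarrow> (real \<Rightarrow> 'a) \<Rightarrow> ('a \<Rightarrow> real) \<Rightarrow> real" where
  "velocity M \<gamma> = (\<lambda>f. if smooth_near M (\<gamma> 0) f then deriv (\<lambda>t. f (\<gamma> t)) 0 else 0)"

definition tangent_space :: "('a, 'e::euclidean_space) manifold \<Rightarrow> 'a \<Rightarrow> (('a \<Rightarrow> real) \<Rightarrow> real) set" where
  "tangent_space M p =
     {velocity M \<gamma> | \<gamma> e. e > 0 \<and> smooth_map (submanifold {-e<..<e}) M \<gamma> \<and> \<gamma> 0 = p}"

definition pushforward ::
    "('a, 'e::euclidean_space) manifold \<Rightarrow> ('b, 'f::euclidean_space) manifold \<Rightarrow> 'a \<Rightarrow> ('a \<Rightarrow> 'b)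
      \<Rightarrow> (('a \<Rightarrow> real) \<Rightarrow> real) \<Rightarrow> (('b \<Rightarrow> real) \<Rightarrow> real)" where
  "pushforward M N p F X = (\<lambda>f. if smooth_near N (F p) f then X (f \<circ> F) else 0)"

text \<open>Linear functionals on the tangent space, extended by 0.\<close>

definition cotangent_space ::
    "('a, 'e::euclidean_space) manifold \<Rightarrow> 'a \<Rightarrow> ((('a \<Rightarrow> real) \<Rightarrow> real) \<Rightarrow> real) set" where
  "cotangent_space M p =
     {\<alpha>. (\<forall>X\<in>tangent_space M p. \<forall>Y\<in>tangent_space M p. \<alpha> (\<lambda>f. X f + Y f) = \<alpha> X + \<alpha> Y) \<and>
          (\<forall>c. \<forall>X\<in>tangent_space M p. \<alpha> (\<lambda>f. c * X f) = c * \<alpha> X) \<and>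
          (\<forall>X. X \<notin> tangent_space M p \<longrightarrow> \<alpha> X = 0)}"

text \<open>The tangent vector at \<open>p\<close> with coordinates \<open>v\<close> in the chart \<open>(U, \<phi>)\<close>, and the coordinates
  of a covector at \<open>p\<close>: in orthonormal coordinates of \<open>span (\<phi> ` U)\<close> the latter are
  the values of the covector on the coordinate vector fields.\<close>

definition coord_vector ::
    "('a, 'e::euclidean_space) manifold \<Rightarrow> 'a set \<times> ('a \<Rightarrow> 'e) \<Rightarrow> 'a \<Rightarrow> 'e \<Rightarrow> ('a \<Rightarrow> real) \<Rightarrow> real" where
  "coord_vector M = (\<lambda>(U, \<phi>) p v. velocity M (\<lambda>t. inv_into U \<phi> (\<phi> p + t *\<^sub>R v)))"

definition covector_coords ::
    "('a, 'e::euclidean_space) manifold \<Rightarrow> 'a set \<times> ('a \<Rightarrow> 'e) \<Rightarrow> 'a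
      \<Rightarrow> ((('a \<Rightarrow> real) \<Rightarrow> real) \<Rightarrow> real) \<Rightarrow> 'e" where
  "covector_coords M = (\<lambda>(U, \<phi>) p \<alpha>.
     THE q. q \<in> span (\<phi> ` U) \<and> (\<forall>v\<in>span (\<phi> ` U). q \<bullet> v = \<alpha> (coord_vector M (U, \<phi>) p v)))"

definition cotangent_chart ::
    "('a, 'e::euclidean_space) manifold \<Rightarrow> 'a set \<times> ('a \<Rightarrow> 'e)
      \<Rightarrow> ('a \<times> ((('a \<Rightarrow> real) \<Rightarrow> real) \<Rightarrow> real)) set
         \<times> ('a \<times> ((('a \<Rightarrow> real) \<Rightarrow> real) \<Rightarrow> real) \<Rightarrow> 'e \<times> 'e)" where
  "cotangent_chart M = (\<lambda>(U, \<phi>).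
     (Sigma U (cotangent_space M), \<lambda>(p, \<alpha>). (\<phi> p, covector_coords M (U, \<phi>) p \<alpha>)))"

definition cotangent_bundle ::
    "('a, 'e::euclidean_space) manifold
      \<Rightarrow> ('a \<times> ((('a \<Rightarrow> real) \<Rightarrow> real) \<Rightarrow> real), 'e \<times> 'e) manifold" where
  "cotangent_bundle M =
     \<lparr>mtop = topology_generated_by
               {{z \<in> D. \<Phi> z \<in> Q} | D \<Phi> Q. (D, \<Phi>) \<in> cotangent_chart M ` atlas M \<and> open Q},
      atlas = cotangent_chart M ` atlas M\<rparr>"

section \<open>Lie groups, their adjoint and coadjoint representations\<close>

definition lie_group :: "'g monoid \<Rightarrow> ('g, 'e::euclidean_space) manifold \<Rightarrow> bool" where
  "lie_group G M \<longleftrightarrow>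
     group G \<and> smooth_manifold M \<and> topspace (mtop M) = carrier G \<and>
     smooth_map (prod_manifold M M) M (\<lambda>(g, h). g \<otimes>\<^bsub>G\<^esub> h) \<and>
     smooth_map M M (\<lambda>g. inv\<^bsub>G\<^esub> g)"

text \<open>Linearity of a map from a subspace into a space of real functions with pointwise operations
  (such as tangent and cotangent spaces).\<close>

definition pointwise_linear_on :: "'l::real_vector set \<Rightarrow> ('l \<Rightarrow> 'z \<Rightarrow> real) \<Rightarrow> bool" where
  "pointwise_linear_on L T \<longleftrightarrow>
     (\<forall>X\<in>L. \<forall>Y\<in>L. T (X + Y) = (\<lambda>z. T X z + T Y z)) \<and>
     (\<forall>c. \<forall>X\<in>L. T (c *\<^sub>R X) = (\<lambda>z. c * T X z))"

text \<open>The Lie algebra, as a vector space with inner product: a subspace \<open>L\<close> of a Euclidean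
  space together with a linear isomorphism \<open>\<iota>\<close> onto the tangent space at the identity. Every inner
  product on the tangent space arises from such a pair \<open>(L, \<iota>)\<close>.\<close>

definition lie_algebra_of ::
    "'g monoid \<Rightarrow> ('g, 'e::euclidean_space) manifold
      \<Rightarrow> 'l::euclidean_space set \<Rightarrow> ('l \<Rightarrow> ('g \<Rightarrow> real) \<Rightarrow> real) \<Rightarrow> bool" where
  "lie_algebra_of G M L \<iota> \<longleftrightarrow>
     subspace L \<and> pointwise_linear_on L \<iota> \<and> bij_betw \<iota> L (tangent_space M \<one>\<^bsub>G\<^esub>)"

definition Ad ::
    "'g monoid \<Rightarrow> ('g, 'e::euclidean_space) manifold
      \<Rightarrow> 'l::euclidean_space set \<Rightarrow> ('l \<Rightarrow> ('g \<Rightarrow> real) \<Rightarrow> real) \<Rightarrow> 'g \<Rightarrow> 'l \<Rightarrow> 'l" where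
  "Ad G M L \<iota> g X =
     inv_into L \<iota> (pushforward M M \<one>\<^bsub>G\<^esub> (\<lambda>h. g \<otimes>\<^bsub>G\<^esub> h \<otimes>\<^bsub>G\<^esub> inv\<^bsub>G\<^esub> g) (\<iota> X))"

text \<open>The coadjoint representation, the dual of \<open>L\<close> being identified with \<open>L\<close> by the inner product.\<close>

definition coAd ::
    "'g monoid \<Rightarrow> ('g, 'e::euclidean_space) manifold
      \<Rightarrow> 'l::euclidean_space set \<Rightarrow> ('l \<Rightarrow> ('g \<Rightarrow> real) \<Rightarrow> real) \<Rightarrow> 'g \<Rightarrow> 'l \<Rightarrow> 'l" where
  "coAd G M L \<iota> g \<xi> =
     (THE \<zeta>. \<zeta> \<in> L \<and> (\<forall>\<eta>\<in>L. \<zeta> \<bullet> \<eta> = \<xi> \<bullet> Ad G M L \<iota> (inv\<^bsub>G\<^esub> g) \<eta>))"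

definition coadjoint_orbit ::
    "'g monoid \<Rightarrow> ('g, 'e::euclidean_space) manifold
      \<Rightarrow> 'l::euclidean_space set \<Rightarrow> ('l \<Rightarrow> ('g \<Rightarrow> real) \<Rightarrow> real) \<Rightarrow> 'l \<Rightarrow> 'l set" where
  "coadjoint_orbit G M L \<iota> \<xi> = (\<lambda>g. coAd G M L \<iota> g \<xi>) ` carrier G"

section \<open>Representations, semi-direct products and moment maps\<close>

text \<open>The representation space is a linear subspace \<open>V\<close> of a Euclidean space, of any dimension
  including 0. Smoothness of \<open>\<rho>\<close> as a map into the general linear group of \<open>V\<close> is smoothness
  of \<open>g \<mapsto> \<rho> g v\<close> for every \<open>v\<close>.\<close>

definition smooth_representation ::
    "'g monoid \<Rightarrow> ('g, 'e::euclidean_space) manifold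
      \<Rightarrow> 'v::euclidean_space set \<Rightarrow> ('g \<Rightarrow> 'v \<Rightarrow> 'v) \<Rightarrow> bool" where
  "smooth_representation G M V \<rho> \<longleftrightarrow>
     subspace V \<and>
     (\<forall>g\<in>carrier G. \<rho> g ` V \<subseteq> V) \<and>
     (\<forall>g\<in>carrier G. \<forall>u\<in>V. \<forall>v\<in>V. \<rho> g (u + v) = \<rho> g u + \<rho> g v) \<and>
     (\<forall>g\<in>carrier G. \<forall>c. \<forall>v\<in>V. \<rho> g (c *\<^sub>R v) = c *\<^sub>R \<rho> g v) \<and>
     (\<forall>v\<in>V. \<rho> \<one>\<^bsub>G\<^esub> v = v) \<and>
     (\<forall>g\<in>carrier G. \<forall>h\<in>carrier G. \<forall>v\<in>V. \<rho> (g \<otimes>\<^bsub>G\<^esub> h) v = \<rho> g (\<rho> h v)) \<and>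
     (\<forall>v\<in>V. smooth_map M (submanifold V) (\<lambda>g. \<rho> g v))"

definition rep_orbit :: "'g monoid \<Rightarrow> ('g \<Rightarrow> 'v \<Rightarrow> 'v) \<Rightarrow> 'v \<Rightarrow> 'v set" where
  "rep_orbit G \<rho> x = (\<lambda>g. \<rho> g x) ` carrier G"

text \<open>The tangent vector \<open>\<iota> X\<close> differentiates \<open>g \<mapsto> \<rho> g v\<close> componentwise.\<close>

definition infinitesimal_rep ::
    "('l \<Rightarrow> ('g \<Rightarrow> real) \<Rightarrow> real) \<Rightarrow> ('g \<Rightarrow> 'v \<Rightarrow> 'v) \<Rightarrow> 'l \<Rightarrow> 'v \<Rightarrow> 'v::euclidean_space" where
  "infinitesimal_rep \<iota> \<rho> X v = (\<Sum>b\<in>Basis. \<iota> X (\<lambda>g. \<rho> g v \<bullet> b) *\<^sub>R b)"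

definition semidirect ::
    "'g monoid \<Rightarrow> 'v::euclidean_space set \<Rightarrow> ('g \<Rightarrow> 'v \<Rightarrow> 'v) \<Rightarrow> ('g \<times> 'v) monoid" where
  "semidirect G V \<rho> =
     \<lparr>carrier = carrier G \<times> V,
      mult = (\<lambda>(g, v) (h, w). (g \<otimes>\<^bsub>G\<^esub> h, v + \<rho> g w)),
      one = (\<one>\<^bsub>G\<^esub>, 0)\<rparr>"

definition semidirect_manifold ::
    "('g, 'e::euclidean_space) manifold \<Rightarrow> 'v::euclidean_space set \<Rightarrow> ('g \<times> 'v, 'e \<times> 'v) manifold" where
  "semidirect_manifold M V = prod_manifold M (submanifold V)"

text \<open>The identification of \<open>L \<times> V\<close> with the tangent space of the semi-direct product at the
  identity.\<close>

definition semidirect_iso ::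
    "'g monoid \<Rightarrow> ('g, 'e::euclidean_space) manifold \<Rightarrow> ('l \<Rightarrow> ('g \<Rightarrow> real) \<Rightarrow> real)
      \<Rightarrow> 'v::euclidean_space set \<Rightarrow> 'l \<times> 'v \<Rightarrow> ('g \<times> 'v \<Rightarrow> real) \<Rightarrow> real" where
  "semidirect_iso G M \<iota> V = (\<lambda>(X, v) f.
     if smooth_near (semidirect_manifold M V) (\<one>\<^bsub>G\<^esub>, 0) f
     then \<iota> X (\<lambda>g. f (g, 0)) + deriv (\<lambda>t. f (\<one>\<^bsub>G\<^esub>, t *\<^sub>R v)) 0
     else 0)"

definition semidirect_coadjoint_orbit ::
    "'g monoid \<Rightarrow> ('g, 'e::euclidean_space) manifold
      \<Rightarrow> 'l::euclidean_space set \<Rightarrow> ('l \<Rightarrow> ('g \<Rightarrow> real) \<Rightarrow> real)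
      \<Rightarrow> 'v::euclidean_space set \<Rightarrow> ('g \<Rightarrow> 'v \<Rightarrow> 'v) \<Rightarrow> 'l \<times> 'v \<Rightarrow> ('l \<times> 'v) set" where
  "semidirect_coadjoint_orbit G M L \<iota> V \<rho> \<xi> =
     coadjoint_orbit (semidirect G V \<rho>) (semidirect_manifold M V) (L \<times> V)
       (semidirect_iso G M \<iota> V) \<xi>"

text \<open>\<open>moment_map L \<iota> \<rho> v w\<close> is the value of the moment map at the bivector
  \<open>v \<and> w\<close>, as an element of \<open>L\<close>.\<close>

definition moment_map ::
    "'l::euclidean_space set \<Rightarrow> ('l \<Rightarrow> ('g \<Rightarrow> real) \<Rightarrow> real) \<Rightarrow> ('g \<Rightarrow> 'v \<Rightarrow> 'v)
      \<Rightarrow> 'v::euclidean_space \<Rightarrow> 'v \<Rightarrow> 'l" where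
  "moment_map L \<iota> \<rho> v w = (THE Z. Z \<in> L \<and> (\<forall>X\<in>L. Z \<bullet> X = infinitesimal_rep \<iota> \<rho> X v \<bullet> w))"

definition moment_image ::
    "'l::euclidean_space set \<Rightarrow> ('l \<Rightarrow> ('g \<Rightarrow> real) \<Rightarrow> real)
      \<Rightarrow> 'v::euclidean_space set \<Rightarrow> ('g \<Rightarrow> 'v \<Rightarrow> 'v) \<Rightarrow> 'v \<Rightarrow> 'l set" where
  "moment_image L \<iota> V \<rho> w = (\<lambda>v. moment_map L \<iota> \<rho> v w) ` V"

end

theory Submission
  imports Defs
begin

text \<open>The derivative of the orbit map \<open>g \<mapsto> \<rho> g x\<close> has constant rank by equivariance, so its
  local images are embedded submanifolds by the constant rank theorem; since \<open>G\<close> is compact, the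
  orbit map is open onto the orbit, which is therefore embedded, with tangent space
  \<open>{\<rho>(X)w | X}\<close> at \<open>w\<close>. Invariance of the inner product gives
  \<open>Ad\<^sup>*(g, v) (0, x) = (\<mu>(v \<and> w), w)\<close> with \<open>w = \<rho> g x\<close>, and the elements \<open>Z\<close> of \<open>\<mu>\<^sub>w(V)\<close> are
  those for which \<open>Z \<bullet> X\<close> depends only on \<open>\<rho>(X)w\<close>. So \<open>(Z, w)\<close> is the same as the covector
  \<open>\<rho>(X)w \<mapsto> Z \<bullet> X\<close> at \<open>w\<close>. This correspondence is smooth in both directions because the tangent
  vectors of the orbit lift locally to elements \<open>X\<close> that depend smoothly on \<open>w\<close>.\<close>

section \<open>Functions of class \<open>C\<^sup>k\<close>\<close>

text \<open>The difficulty lies on the abstract side. Tangent vectors are functionals on functions,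
  covectors are functionals on those, and the topology of the cotangent bundle is merely generated
  by its charts, so that neither the Hausdorff property nor countability nor smooth transition maps
  are immediate. All of them are carried over from the concrete set \<open>C\<close> of pairs
  \<open>(Z, w)\<close> in a Euclidean space: explicit mutually inverse maps \<open>f\<close> and
  \<open>g\<close> between \<open>C\<close> and the bundle are smooth in every chart, and charts and
  transition maps factor through \<open>C\<close>. Until the very end \<open>C\<close> depends only
  on the orbit and on a bilinear map that spans its tangent spaces.

  Coordinates lie in linear subspaces, and smoothness on a set refers to extensions to open sets.
  Orthogonal projections turn maps given on a subspace into maps of the ambient space, where Frechet
  derivatives make sense. Since \<open>Ck_on\<close> controls derivatives in fixed directions, a
  direction that moves with the point is expanded in the standard basis.\<close>

lemma frechet_derivative_cong_open:
  assumes "open U" "x \<in> U" "\<And>y. y \<in> U \<Longrightarrow> f y = g y" "f differentiable (at x)"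
  shows "(g has_derivative frechet_derivative f (at x)) (at x)"
  using assms by (metis frechet_derivative_works has_derivative_transform_within_open)

text \<open>Quantifying over every \<open>g\<close> that agrees with the derivative on
  \<open>U\<close> builds a congruence into the rule, because \<open>Ck_on_cong\<close> is itself
  proved with it.\<close>

lemma Ck_on_SucI:
  assumes "\<And>x. x \<in> U \<Longrightarrow> (f has_derivative f' x) (at x)"
    and "\<And>v. \<forall>g. (\<forall>x\<in>U. g x = f' x v) \<longrightarrow> Ck_on k U g"
  shows "Ck_on (Suc k) U f"
proof -
  have "f differentiable (at x)" if "x \<in> U" for x
    using assms(1)[OF that] by (auto simp: differentiable_def)
  moreover have "\<forall>x\<in>U. frechet_derivative f (at x) v = f' x v" for v
    using assms(1) frechet_derivative_at by metis
  then have "Ck_on k U (\<lambda>x. frechet_derivative f (at x) v)" for v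
    using assms(2)[rule_format, of "\<lambda>x. frechet_derivative f (at x) v" v] by simp
  ultimately show ?thesis unfolding Ck_on.simps(2) by blast
qed

lemma Ck_on_cong:
  assumes "open U" "\<And>x. x \<in> U \<Longrightarrow> f x = g x" "Ck_on k U f"
  shows "Ck_on k U g"
  using assms(2,3)
proof (induction k arbitrary: f g)
  case 0
  then show ?case by (simp cong: continuous_on_cong)
next
  case (Suc k)
  have d: "(g has_derivative frechet_derivative f (at x)) (at x)" if "x \<in> U" for x
    using frechet_derivative_cong_open[OF assms(1) that Suc.prems(1)] Suc.prems(2) that by auto
  show ?case
  proof (rule Ck_on_SucI[OF d])
    fix v show "\<forall>g. (\<forall>x\<in>U. g x = frechet_derivative f (at x) v) \<longrightarrow> Ck_on k U g"
      using Suc.prems Suc.IH[of "\<lambda>x. frechet_derivative f (at x) v"] by auto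
  qed
qed

text \<open>Lets derivative rules supply \<open>f'\<close>. Openness of \<open>U\<close> makes the
  class independent of the values that \<open>frechet_derivative\<close> takes off
  \<open>U\<close>.\<close>

lemma Ck_on_Suc_iff:
  assumes "open U" "\<And>x. x \<in> U \<Longrightarrow> (f has_derivative f' x) (at x)"
  shows "Ck_on (Suc k) U f \<longleftrightarrow> (\<forall>v. Ck_on k U (\<lambda>x. f' x v))"
proof -
  have "f' x = frechet_derivative f (at x)" if "x \<in> U" for x
    using assms(2)[OF that] by (rule frechet_derivative_at)
  moreover have "f differentiable (at x)" if "x \<in> U" for x
    using assms(2)[OF that] by (auto simp: differentiable_def)
  ultimately show ?thesis
    using Ck_on_cong[OF assms(1), of "\<lambda>x. f' x v" "\<lambda>x. frechet_derivative f (at x) v" for v]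
      Ck_on_cong[OF assms(1), of "\<lambda>x. frechet_derivative f (at x) v" "\<lambda>x. f' x v" for v]
    unfolding Ck_on.simps(2) by (metis (no_types, lifting))
qed

lemma Ck_on_has_derivative:
  "Ck_on (Suc k) U f \<Longrightarrow> x \<in> U \<Longrightarrow> (f has_derivative frechet_derivative f (at x)) (at x)"
  by (simp add: frechet_derivative_works)

lemma Ck_on_Suc_lower:
  assumes "open U" shows "Ck_on (Suc k) U f \<Longrightarrow> Ck_on k U f"
proof (induction k arbitrary: f)
  case 0
  then show ?case
    by (auto simp: assms continuous_on_eq_continuous_at differentiable_imp_continuous_within)
next
  case (Suc k)
  have "f differentiable (at x)" if "x \<in> U" for x
    using Suc.prems that unfolding Ck_on.simps(2)[of "Suc k"] by blast
  moreover have "Ck_on k U (\<lambda>x. frechet_derivative f (at x) v)" for v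
    using Suc.prems unfolding Ck_on.simps(2)[of "Suc k"] by (intro Suc.IH) blast
  ultimately show ?case unfolding Ck_on.simps(2) by blast
qed

lemma Ck_on_le:
  assumes "open U" "j \<le> k" shows "Ck_on k U f \<Longrightarrow> Ck_on j U f"
  using assms(2) by (induction rule: dec_induct) (blast intro: Ck_on_Suc_lower[OF assms(1)])+

lemma Ck_on_subset: "W \<subseteq> U \<Longrightarrow> Ck_on k U f \<Longrightarrow> Ck_on k W f"
  by (induction k arbitrary: f) (auto intro: continuous_on_subset)

lemma Ck_on_local:
  assumes "open U" "\<And>x. x \<in> U \<Longrightarrow> \<exists>W. open W \<and> x \<in> W \<and> Ck_on k W f"
  shows "Ck_on k U f"
  using assms(2)
proof (induction k arbitrary: f)
  case 0
  then show ?case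
    by (simp add: assms(1) continuous_on_eq_continuous_at) (metis continuous_on_eq_continuous_at)
next
  case (Suc k)
  have "f differentiable (at x)" if "x \<in> U" for x
    using Suc.prems[OF that] by auto
  moreover have "Ck_on k U (\<lambda>x. frechet_derivative f (at x) v)" for v
    using Suc.prems by (intro Suc.IH) fastforce
  ultimately show ?case by simp
qed

lemma Ck_on_const: "Ck_on k U (\<lambda>x. c)"
  by (induction k arbitrary: c) auto

lemma Ck_on_linear:
  assumes "bounded_linear L" "open U"
  shows "Ck_on k U f \<Longrightarrow> Ck_on k U (\<lambda>x. L (f x))"
proof (induction k arbitrary: f)
  case 0
  then show ?case using assms by (simp add: bounded_linear.continuous_on)
next
  case (Suc k)
  show ?case
  proof (subst Ck_on_Suc_iff[OF assms(2)])
    show "((\<lambda>x. L (f x)) has_derivative (\<lambda>v. L (frechet_derivative f (at x) v))) (at x)"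
      if "x \<in> U" for x
      using bounded_linear.has_derivative[OF assms(1) Ck_on_has_derivative[OF Suc.prems that]] .
    show "\<forall>v. Ck_on k U (\<lambda>x. L (frechet_derivative f (at x) v))"
      using Suc.prems Suc.IH by auto
  qed
qed

lemma Ck_on_add:
  assumes "open U"
  shows "Ck_on k U f \<Longrightarrow> Ck_on k U g \<Longrightarrow> Ck_on k U (\<lambda>x. f x + g x)"
proof (induction k arbitrary: f g)
  case 0
  then show ?case by (simp add: continuous_on_add)
next
  case (Suc k)
  show ?case
  proof (subst Ck_on_Suc_iff[OF assms])
    show "((\<lambda>x. f x + g x) has_derivative
       (\<lambda>v. frechet_derivative f (at x) v + frechet_derivative g (at x) v)) (at x)"
      if "x \<in> U" for x
      by (rule has_derivative_add[OF Ck_on_has_derivative[OF Suc.prems(1) that]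
            Ck_on_has_derivative[OF Suc.prems(2) that]])
    show "\<forall>v. Ck_on k U (\<lambda>x. frechet_derivative f (at x) v + frechet_derivative g (at x) v)"
      using Suc.prems Suc.IH by auto
  qed
qed

lemma Ck_on_sum:
  assumes "open U" "\<And>i. i \<in> I \<Longrightarrow> Ck_on k U (f i)"
  shows "Ck_on k U (\<lambda>x. \<Sum>i\<in>I. f i x)"
  using assms(2)
  by (induction I rule: infinite_finite_induct) (auto intro: Ck_on_const Ck_on_add[OF assms(1)])

lemma Ck_on_bilinear:
  assumes "bounded_bilinear op" "open U"
  shows "Ck_on k U f \<Longrightarrow> Ck_on k U g \<Longrightarrow> Ck_on k U (\<lambda>x. op (f x) (g x))"
proof (induction k arbitrary: f g)
  case 0
  then show ?case using bounded_bilinear.continuous_on[OF assms(1)] by auto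
next
  case (Suc k)
  show ?case
  proof (subst Ck_on_Suc_iff[OF assms(2)])
    show "((\<lambda>x. op (f x) (g x)) has_derivative
       (\<lambda>v. op (f x) (frechet_derivative g (at x) v) + op (frechet_derivative f (at x) v) (g x))) (at x)"
      if "x \<in> U" for x
      by (rule bounded_bilinear.FDERIV[OF assms(1) Ck_on_has_derivative[OF Suc.prems(1) that]
            Ck_on_has_derivative[OF Suc.prems(2) that]])
    have "Ck_on k U f" "Ck_on k U g"
      using Suc.prems Ck_on_Suc_lower[OF assms(2)] by blast+
    moreover have "Ck_on k U (\<lambda>x. frechet_derivative f (at x) v)"
      "Ck_on k U (\<lambda>x. frechet_derivative g (at x) v)" for v
      using Suc.prems by auto
    ultimately show "\<forall>v. Ck_on k U (\<lambda>x. op (f x) (frechet_derivative g (at x) v) + op (frechet_derivative f (at x) v) (g x))"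
      by (intro allI Ck_on_add[OF assms(2)] Suc.IH)
  qed
qed

lemma linear_sum_Basis:
  fixes L :: "'a::euclidean_space \<Rightarrow> 'b::real_vector"
  assumes "linear L" shows "L v = (\<Sum>b\<in>Basis. (v \<bullet> b) *\<^sub>R L b)"
proof -
  have "L v = L (\<Sum>b\<in>Basis. (v \<bullet> b) *\<^sub>R b)" by (simp add: euclidean_representation)
  then show ?thesis using assms by (simp add: linear_sum linear_cmul)
qed

lemma Ck_on_Pair:
  assumes "open U"
  shows "Ck_on k U f \<Longrightarrow> Ck_on k U g \<Longrightarrow> Ck_on k U (\<lambda>x. (f x, g x))"
proof (induction k arbitrary: f g)
  case 0
  then show ?case by (simp add: continuous_on_Pair)
next
  case (Suc k)
  show ?case
  proof (subst Ck_on_Suc_iff[OF assms])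
    show "((\<lambda>x. (f x, g x)) has_derivative
       (\<lambda>v. (frechet_derivative f (at x) v, frechet_derivative g (at x) v))) (at x)"
      if "x \<in> U" for x
      by (rule has_derivative_Pair[OF Ck_on_has_derivative[OF Suc.prems(1) that]
            Ck_on_has_derivative[OF Suc.prems(2) that]])
    show "\<forall>v. Ck_on k U (\<lambda>x. (frechet_derivative f (at x) v, frechet_derivative g (at x) v))"
      using Suc.prems Suc.IH by auto
  qed
qed

text \<open>The chain rule evaluates the derivative of \<open>g\<close> in a direction that varies
  with \<open>x\<close>, whereas the induction hypothesis handles fixed directions. Expanding the
  direction in the basis leaves sums of products of functions already known to be of class
  \<open>k\<close>.\<close>

lemma Ck_on_compose:
  fixes f :: "'a::real_normed_vector \<Rightarrow> 'b::euclidean_space" and g :: "'b \<Rightarrow> 'c::real_normed_vector"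
  assumes "open U" "open W" "f ` U \<subseteq> W" "Ck_on k U f"
  shows "Ck_on k W g \<Longrightarrow> Ck_on k U (\<lambda>x. g (f x))"
  using assms(4)
proof (induction k arbitrary: g)
  case 0
  then show ?case using assms(3) by simp (metis continuous_on_compose2)
next
  case (Suc k)
  have fk: "Ck_on k U f" using Ck_on_Suc_lower[OF assms(1) Suc.prems(2)] .
  show ?case
  proof (subst Ck_on_Suc_iff[OF assms(1)])
    fix x assume x: "x \<in> U"
    then have fx: "f x \<in> W" using assms(3) by auto
    have l: "linear (frechet_derivative g (at (f x)))"
      using Ck_on_has_derivative[OF Suc.prems(1) fx] has_derivative_linear by blast
    have "((\<lambda>x. g (f x)) has_derivative
       (\<lambda>v. frechet_derivative g (at (f x)) (frechet_derivative f (at x) v))) (at x)"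
      by (rule has_derivative_compose[OF Ck_on_has_derivative[OF Suc.prems(2) x]
            Ck_on_has_derivative[OF Suc.prems(1) fx]])
    then show "((\<lambda>x. g (f x)) has_derivative
       (\<lambda>v. \<Sum>b\<in>Basis. (frechet_derivative f (at x) v \<bullet> b) *\<^sub>R frechet_derivative g (at (f x)) b)) (at x)"
      by (subst (asm) linear_sum_Basis[OF l])
  next
    show "\<forall>v. Ck_on k U (\<lambda>x. \<Sum>b\<in>Basis. (frechet_derivative f (at x) v \<bullet> b) *\<^sub>R
        frechet_derivative g (at (f x)) b)"
    proof (intro allI Ck_on_sum[OF assms(1)] Ck_on_bilinear[OF bounded_bilinear_scaleR assms(1)]
          Ck_on_linear[OF bounded_linear_inner_left assms(1)])
      show "Ck_on k U (\<lambda>x. frechet_derivative f (at x) v)" for v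
        using Suc.prems(2) unfolding Ck_on.simps(2) by blast
      show "Ck_on k U (\<lambda>x. frechet_derivative g (at (f x)) b)" for b
        using Suc.prems(1) unfolding Ck_on.simps(2) by (intro Suc.IH[OF _ fk]) blast
    qed
  qed
qed

section \<open>Inverses of families of linear maps and the inverse function theorem\<close>

text \<open>A product rule whose factor \<open>B\<close> is only continuous: at a zero of
  \<open>r\<close> the term with the derivative of \<open>B\<close> would vanish anyway. It serves
  to differentiate an inverse family that is so far known to be continuous only.\<close>

lemma has_derivative_scaleR_null:
  fixes r :: "'p::real_normed_vector \<Rightarrow> real" and B :: "'p \<Rightarrow> 'b::real_normed_vector"
  assumes r: "(r has_derivative r') (at y)" and "r y = 0" and B: "isCont B y"
  shows "((\<lambda>z. r z *\<^sub>R B z) has_derivative (\<lambda>h. r' h *\<^sub>R B y)) (at y)"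
proof -
  have bl: "bounded_linear r'" using r has_derivative_bounded_linear by blast
  then obtain K where K: "\<And>h. norm (r' h) \<le> norm h * K" using bounded_linear.bounded by blast
  have lim: "((\<lambda>z. norm (r z - r y - r' (z - y)) / norm (z - y)) \<longlongrightarrow> 0) (at y)"
    using r by (simp add: has_derivative_iff_norm)
  have "((\<lambda>z. norm (r z - r y - r' (z - y)) / norm (z - y) * norm (B z) + \<bar>K\<bar> * norm (B z - B y)) \<longlongrightarrow>
      0 * norm (B y) + \<bar>K\<bar> * norm (B y - B y)) (at y)"
    using B by (intro tendsto_intros lim) (auto simp: isCont_def)
  then have lim2: "((\<lambda>z. norm (r z - r y - r' (z - y)) / norm (z - y) * norm (B z) + \<bar>K\<bar> * norm (B z - B y)) \<longlongrightarrow> 0) (at y)"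
    by simp
  have bound: "norm (norm (r z *\<^sub>R B z - r y *\<^sub>R B y - r' (z - y) *\<^sub>R B y) / norm (z - y))
     \<le> norm (r z - r y - r' (z - y)) / norm (z - y) * norm (B z) + \<bar>K\<bar> * norm (B z - B y)" if "z \<noteq> y" for z
  proof -
    \<comment> \<open>The second summand is negligible relative to \<open>z - y\<close> because
      \<open>r'\<close> is bounded and \<open>B\<close> is continuous at \<open>y\<close>.\<close>
    have eq: "r z *\<^sub>R B z - r y *\<^sub>R B y - r' (z - y) *\<^sub>R B y
      = (r z - r y - r' (z - y)) *\<^sub>R B z + r' (z - y) *\<^sub>R (B z - B y)"
      using assms(2) by (simp add: algebra_simps)
    have "norm (r' (z - y)) \<le> norm (z - y) * \<bar>K\<bar>"
      using K[of "z - y"] by (smt (verit) mult_left_mono norm_ge_zero)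
    then have "norm (r' (z - y) *\<^sub>R (B z - B y)) \<le> norm (z - y) * \<bar>K\<bar> * norm (B z - B y)"
      by (simp add: mult_right_mono)
    then have "norm (r z *\<^sub>R B z - r y *\<^sub>R B y - r' (z - y) *\<^sub>R B y)
      \<le> norm (r z - r y - r' (z - y)) * norm (B z) + norm (z - y) * \<bar>K\<bar> * norm (B z - B y)"
      unfolding eq by (intro norm_triangle_le) simp
    then have "norm (r z *\<^sub>R B z - r y *\<^sub>R B y - r' (z - y) *\<^sub>R B y) / norm (z - y)
      \<le> (norm (r z - r y - r' (z - y)) * norm (B z) + norm (z - y) * \<bar>K\<bar> * norm (B z - B y)) / norm (z - y)"
      by (rule divide_right_mono) simp
    also have "\<dots> = norm (r z - r y - r' (z - y)) / norm (z - y) * norm (B z) + \<bar>K\<bar> * norm (B z - B y)"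
      using that by (simp add: add_divide_distrib)
    finally show ?thesis by simp
  qed
  have "((\<lambda>z. norm (r z *\<^sub>R B z - r y *\<^sub>R B y - r' (z - y) *\<^sub>R B y) / norm (z - y)) \<longlongrightarrow> 0) (at y)"
    by (rule Lim_null_comparison[OF _ lim2]) (use bound in \<open>auto simp: eventually_at_filter\<close>)
  moreover have "bounded_linear (\<lambda>h. r' h *\<^sub>R B y)"
    using bl by (rule bounded_linear_scaleR_const)
  ultimately show ?thesis by (simp add: has_derivative_iff_norm)
qed

text \<open>The lower bound of the injective map \<open>A y\<close> survives with half the constant
  at nearby points, uniformly in \<open>u\<close>, because closeness on the finitely many basis
  vectors controls the whole linear map.\<close>

lemma linear_family_bounded_below:
  fixes A :: "'p::real_normed_vector \<Rightarrow> 'b::euclidean_space \<Rightarrow> 'b"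
  assumes U: "open U" and lin: "\<And>y. y \<in> U \<Longrightarrow> linear (A y)"
    and cont: "\<And>v. continuous_on U (\<lambda>y. A y v)" and y: "y \<in> U" "inj (A y)"
  obtains c where "c > 0" "\<forall>\<^sub>F z in nhds y. z \<in> U \<and> (\<forall>u. c * norm u \<le> norm (A z u))"
proof -
  obtain c where c: "c > 0" "\<And>u. norm (A y u) \<ge> c * norm u"
    using linear_inj_bounded_below_pos[OF lin[OF y(1)] y(2)] by metis
  \<comment> \<open>Summed over the \<open>DIM('b)\<close> basis vectors, errors below
    \<open>\<epsilon>\<close> move \<open>A z u\<close> by at most
    \<open>c / 2 * norm u\<close>.\<close>
  define \<epsilon> where "\<epsilon> = c / (2 * DIM('b))"
  have \<epsilon>: "\<epsilon> > 0" using c by (simp add: \<epsilon>_def)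
  have cA: "isCont (\<lambda>y. A y v) y" for v
    using cont U y by (simp add: continuous_on_eq_continuous_at)
  have "\<forall>\<^sub>F z in nhds y. \<forall>b\<in>Basis. dist (A z b) (A y b) < \<epsilon>"
  proof (intro eventually_ball_finite ballI)
    fix b :: 'b
    have "((\<lambda>z. A z b) \<longlongrightarrow> A y b) (nhds y)"
      using cA[of b] tendsto_at_iff_tendsto_nhds[of "\<lambda>z. A z b" y] by (simp add: isCont_def)
    then show "\<forall>\<^sub>F z in nhds y. dist (A z b) (A y b) < \<epsilon>" using \<epsilon> by (rule tendstoD)
  qed simp
  moreover have "\<forall>\<^sub>F z in nhds y. z \<in> U"
    using U y eventually_nhds_in_open by blast
  ultimately have "\<forall>\<^sub>F z in nhds y. z \<in> U \<and> (\<forall>u. c / 2 * norm u \<le> norm (A z u))"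
  proof eventually_elim
    case (elim z)
    have lz: "linear (A z)" and ly: "linear (A y)" using elim y lin by auto
    have dl: "norm (A z u - A y u) \<le> c / 2 * norm u" for u
    proof -
      have "A z u - A y u = (\<Sum>b\<in>Basis. (u \<bullet> b) *\<^sub>R (A z b - A y b))"
        by (subst linear_sum_Basis[OF lz], subst linear_sum_Basis[OF ly])
          (simp add: sum_subtractf scaleR_diff_right)
      also have "norm \<dots> \<le> (\<Sum>b\<in>(Basis::'b set). norm u * \<epsilon>)"
      proof (rule sum_norm_le)
        fix b :: 'b assume b: "b \<in> Basis"
        then have "\<bar>u \<bullet> b\<bar> \<le> norm u" "norm (A z b - A y b) \<le> \<epsilon>"
          using elim(1) by (auto simp: Basis_le_norm dist_norm less_imp_le)
        then show "norm ((u \<bullet> b) *\<^sub>R (A z b - A y b)) \<le> norm u * \<epsilon>"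
          by (simp add: mult_mono)
      qed
      also have "\<dots> = c / 2 * norm u" by (simp add: \<epsilon>_def)
      finally show ?thesis .
    qed
    have "c / 2 * norm u \<le> norm (A z u)" for u
    proof -
      have "c * norm u - c / 2 * norm u \<le> norm (A z u)"
        using c(2)[of u] norm_triangle_ineq2[of "A y u" "A z u"] dl[of u]
        by (simp add: norm_minus_commute)
      then show ?thesis by (simp add: field_simps)
    qed
    then show ?case using elim(2) by blast
  qed
  then show ?thesis using that[of "c / 2"] c(1) by simp
qed

lemma linear_family_bij_near:
  fixes A :: "'p::real_normed_vector \<Rightarrow> 'b::euclidean_space \<Rightarrow> 'b"
  assumes U: "open U" and lin: "\<And>y. y \<in> U \<Longrightarrow> linear (A y)"
    and cont: "\<And>v. continuous_on U (\<lambda>y. A y v)" and y: "y \<in> U" "inj (A y)"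
  obtains W where "open W" "y \<in> W" "W \<subseteq> U" "\<And>z. z \<in> W \<Longrightarrow> bij (A z)"
proof -
  obtain c where c: "c > 0" "\<forall>\<^sub>F z in nhds y. z \<in> U \<and> (\<forall>u. c * norm u \<le> norm (A z u))"
    using linear_family_bounded_below[OF assms] by blast
  then obtain W where W: "open W" "y \<in> W" "\<And>z. z \<in> W \<Longrightarrow> z \<in> U \<and> (\<forall>u. c * norm u \<le> norm (A z u))"
    unfolding eventually_nhds by blast
  have "bij (A z)" if "z \<in> W" for z
  proof -
    have l: "linear (A z)" using W lin that by blast
    have "u = 0" if "A z u = 0" for u
    proof -
      have "c * norm u \<le> 0" using W(3)[OF \<open>z \<in> W\<close>] that by (metis norm_zero)
      then show ?thesis using c(1) by (simp add: mult_le_0_iff)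
    qed
    then have "inj (A z)" using l by (simp add: linear_injective_0)
    then show ?thesis using l by (simp add: bij_def linear_injective_imp_surjective)
  qed
  then show ?thesis using W that by blast
qed

context
  fixes A :: "'p::real_normed_vector \<Rightarrow> 'b::euclidean_space \<Rightarrow> 'b" and U :: "'p set"
  assumes U: "open U" and lin: "\<And>y. y \<in> U \<Longrightarrow> linear (A y)" and bij: "\<And>y. y \<in> U \<Longrightarrow> bij (A y)"
begin

lemma linear_inv_family: "y \<in> U \<Longrightarrow> linear (inv_into UNIV (A y))"
  by (simp add: lin bij bij_is_inj inj_linear_imp_inv_linear)

text \<open>With the fixed vector \<open>p = inv_into UNIV (A y) w\<close>, the difference
  \<open>u\<close> of the two inverses at \<open>w\<close> satisfies
  \<open>A z u = A y p - A z p\<close>. The uniform lower bound for \<open>A z\<close> then turns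
  continuity of \<open>A\<close> at the single vector \<open>p\<close> into continuity of the
  inverse.\<close>

lemma inv_family_isCont:
  assumes cont: "\<And>v. continuous_on U (\<lambda>y. A y v)" and y: "y \<in> U"
  shows "isCont (\<lambda>y. inv_into UNIV (A y) w) y"
proof -
  obtain c where c: "c > 0" "\<forall>\<^sub>F z in nhds y. z \<in> U \<and> (\<forall>u. c * norm u \<le> norm (A z u))"
    using linear_family_bounded_below[OF U lin cont y bij_is_inj[OF bij[OF y]]] by blast
  have cA: "isCont (\<lambda>y. A y v) y" for v
    using cont U y by (simp add: continuous_on_eq_continuous_at)
  have "\<forall>\<^sub>F z in at y. z \<in> U \<and> (\<forall>u. c * norm u \<le> norm (A z u))"
    using c(2) by (simp add: eventually_at_filter eventually_mono)
  then have ev: "\<forall>\<^sub>F z in at y. norm (inv_into UNIV (A z) w - inv_into UNIV (A y) w)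
      \<le> (1 / c) * norm (A y (inv_into UNIV (A y) w) - A z (inv_into UNIV (A y) w))"
  proof eventually_elim
    case (elim z)
    have lz: "linear (A z)" using elim lin by auto
    define u where "u = inv_into UNIV (A z) w - inv_into UNIV (A y) w"
    have Au: "A z u = A y (inv_into UNIV (A y) w) - A z (inv_into UNIV (A y) w)"
      using bij elim y by (simp add: u_def linear_diff[OF lz] bij_is_surj surj_f_inv_f)
    have "c * norm u \<le> norm (A y (inv_into UNIV (A y) w) - A z (inv_into UNIV (A y) w))"
      using elim[THEN conjunct2, rule_format, of u] by (simp only: Au)
    then have "norm u \<le> (1 / c) * norm (A y (inv_into UNIV (A y) w) - A z (inv_into UNIV (A y) w))"
      using c(1) by (simp add: pos_le_divide_eq mult.commute)
    then show ?case by (simp only: u_def)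
  qed
  have "((\<lambda>z. (1 / c) * norm (A y (inv_into UNIV (A y) w) - A z (inv_into UNIV (A y) w))) \<longlongrightarrow>
      (1 / c) * norm (A y (inv_into UNIV (A y) w) - A y (inv_into UNIV (A y) w))) (at y)"
    using cA[of "inv_into UNIV (A y) w"] by (intro tendsto_intros) (auto simp: isCont_def)
  then have "((\<lambda>z. inv_into UNIV (A z) w - inv_into UNIV (A y) w) \<longlongrightarrow> 0) (at y)"
    by (intro Lim_null_comparison[OF ev]) simp
  then show ?thesis by (simp add: isCont_def LIM_zero_cancel)
qed

text \<open>The inverse at \<open>x\<close> equals the fixed vector \<open>?z\<close> minus a
  combination of the vectors \<open>inv_into UNIV (A x) b\<close> whose coefficients vanish at
  \<open>x = y\<close>. Continuity of these vectors is therefore enough to differentiate, by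
  \<open>has_derivative_scaleR_null\<close>.\<close>

lemma inv_family_has_derivative:
  assumes cont: "\<And>v. continuous_on U (\<lambda>y. A y v)" and y: "y \<in> U"
    and d: "((\<lambda>z. A z (inv_into UNIV (A y) w)) has_derivative D) (at y)"
  shows "((\<lambda>y. inv_into UNIV (A y) w) has_derivative (\<lambda>h. - inv_into UNIV (A y) (D h))) (at y)"
proof -
  let ?z = "inv_into UNIV (A y) w"
  have "((\<lambda>x. A x ?z - w) has_derivative D) (at y)"
    using has_derivative_diff[OF d has_derivative_const[of w]] by simp
  then have "((\<lambda>x. (A x ?z - w) \<bullet> b) has_derivative (\<lambda>h. D h \<bullet> b)) (at y)" for b
    by (rule has_derivative_inner_left)
  moreover have "A y ?z - w = 0" using bij[OF y] by (simp add: bij_is_surj surj_f_inv_f)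
  ultimately have "((\<lambda>x. ?z - (\<Sum>b\<in>Basis. ((A x ?z - w) \<bullet> b) *\<^sub>R inv_into UNIV (A x) b)) has_derivative
      (\<lambda>h. 0 - (\<Sum>b\<in>Basis. (D h \<bullet> b) *\<^sub>R inv_into UNIV (A y) b))) (at y)"
    by (intro has_derivative_diff has_derivative_sum has_derivative_const has_derivative_scaleR_null
         inv_family_isCont[OF cont y]) auto
  then have "((\<lambda>x. ?z - (\<Sum>b\<in>Basis. ((A x ?z - w) \<bullet> b) *\<^sub>R inv_into UNIV (A x) b)) has_derivative
      (\<lambda>h. - inv_into UNIV (A y) (D h))) (at y)"
    by (simp only: linear_sum_Basis[OF linear_inv_family[OF y], symmetric] diff_0)
  then show ?thesis
  proof (rule has_derivative_transform_within_open[OF _ U y])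
    fix x assume x: "x \<in> U"
    have "(\<Sum>b\<in>Basis. ((A x ?z - w) \<bullet> b) *\<^sub>R inv_into UNIV (A x) b) = inv_into UNIV (A x) (A x ?z - w)"
      by (rule linear_sum_Basis[OF linear_inv_family[OF x], symmetric])
    also have "\<dots> = ?z - inv_into UNIV (A x) w"
      using linear_inv_family[OF x] bij[OF x] by (simp add: linear_diff bij_is_inj)
    finally show "?z - (\<Sum>b\<in>Basis. ((A x ?z - w) \<bullet> b) *\<^sub>R inv_into UNIV (A x) b) = inv_into UNIV (A x) w" by simp
  qed
qed

text \<open>The derivative of the inverse is an expression in the inverse itself, of class
  \<open>k\<close> by induction, and in derivatives of \<open>A\<close>.\<close>

lemma Ck_on_inv_family:
  assumes "\<And>v. Ck_on k U (\<lambda>y. A y v)" shows "Ck_on k U (\<lambda>y. inv_into UNIV (A y) w)"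
  using assms
proof (induction k arbitrary: w)
  case 0
  then show ?case using inv_family_isCont by (simp add: U continuous_on_eq_continuous_at)
next
  case (Suc k)
  have Ak: "Ck_on k U (\<lambda>y. A y v)" for v using Ck_on_Suc_lower[OF U Suc.prems] .
  have Bk: "Ck_on k U (\<lambda>y. inv_into UNIV (A y) v)" for v by (rule Suc.IH[OF Ak])
  have cont: "continuous_on U (\<lambda>y. A y v)" for v
    using Ck_on_le[OF U, of 0] Suc.prems by (metis Ck_on.simps(1) le0)
  let ?D = "\<lambda>v y. frechet_derivative (\<lambda>y. A y v) (at y)"
  have Dv: "((\<lambda>y. A y v) has_derivative ?D v y) (at y)" if "y \<in> U" for v y
    by (rule Ck_on_has_derivative[OF Suc.prems that])
  \<comment> \<open>The derivative of the inverse involves \<open>?D\<close> at the vector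
    \<open>inv_into UNIV (A y) w\<close>, which moves with \<open>y\<close>; this reduces it to
    fixed basis vectors.\<close>
  have Dsum: "?D v y h = (\<Sum>b\<in>Basis. (v \<bullet> b) *\<^sub>R ?D b y h)" if "y \<in> U" for v y h
  proof -
    have "((\<lambda>y. \<Sum>b\<in>Basis. (v \<bullet> b) *\<^sub>R A y b) has_derivative (\<lambda>h. \<Sum>b\<in>Basis. (v \<bullet> b) *\<^sub>R ?D b y h)) (at y)"
      by (intro has_derivative_sum has_derivative_scaleR_right Dv that)
    then have "((\<lambda>y. A y v) has_derivative (\<lambda>h. \<Sum>b\<in>Basis. (v \<bullet> b) *\<^sub>R ?D b y h)) (at y)"
      by (rule has_derivative_transform_within_open[OF _ U that]) (metis lin linear_sum_Basis)
    then show ?thesis using has_derivative_unique[OF Dv[OF that]] by metis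
  qed
  show ?case
  proof (subst Ck_on_Suc_iff[OF U])
    fix y assume y: "y \<in> U"
    have "((\<lambda>y. inv_into UNIV (A y) w) has_derivative (\<lambda>h. - inv_into UNIV (A y) (?D (inv_into UNIV (A y) w) y h))) (at y)"
      by (rule inv_family_has_derivative[OF cont y Dv[OF y]])
    also have "(\<lambda>h. - inv_into UNIV (A y) (?D (inv_into UNIV (A y) w) y h)) =
      (\<lambda>h. - (\<Sum>c\<in>Basis. ((\<Sum>b\<in>Basis. (inv_into UNIV (A y) w \<bullet> b) *\<^sub>R ?D b y h) \<bullet> c) *\<^sub>R inv_into UNIV (A y) c))"
      by (simp only: Dsum[OF y, symmetric] linear_sum_Basis[OF linear_inv_family[OF y], symmetric])
    finally show "((\<lambda>y. inv_into UNIV (A y) w) has_derivative \<dots>) (at y)" .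
  next
    have *: "Ck_on k U (\<lambda>y. ?D b y h)" for b h using Suc.prems[of b] by simp
    show "\<forall>h. Ck_on k U (\<lambda>y. - (\<Sum>c\<in>Basis. ((\<Sum>b\<in>Basis. (inv_into UNIV (A y) w \<bullet> b) *\<^sub>R ?D b y h) \<bullet> c) *\<^sub>R inv_into UNIV (A y) c))"
      by (intro allI Ck_on_linear[OF bounded_linear_minus[OF bounded_linear_ident] U] Ck_on_sum[OF U]
          Ck_on_bilinear[OF bounded_bilinear_scaleR U] Ck_on_linear[OF bounded_linear_inner_left U] Bk *)
  qed
qed

end

text \<open>With the identity as derivative at \<open>a\<close>, \<open>id_blinfun\<close> is the
  inverse that \<open>inverse_function_theorem\<close> asks for. The derivative of \<open>g\<close>
  at \<open>y\<close> is the inverse of the derivative of \<open>f\<close> at \<open>g y\<close>, so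
  class \<open>k\<close> of \<open>g\<close> yields class \<open>Suc k\<close>.\<close>

lemma smooth_inverse_function:
  fixes f :: "'a::euclidean_space \<Rightarrow> 'a"
  assumes U: "open U" "\<And>k. Ck_on k U f" "a \<in> U" and id: "frechet_derivative f (at a) = (\<lambda>v. v)"
  obtains U' V g where "open U'" "U' \<subseteq> U" "a \<in> U'" "open V" "f a \<in> V" "homeomorphism U' V f g"
    "\<And>k. Ck_on k V g"
proof -
  let ?D = "\<lambda>x. frechet_derivative f (at x)"
  define f' where "f' x = Blinfun (?D x)" for x
  have der: "(f has_derivative ?D x) (at x)" if "x \<in> U" for x
    using Ck_on_has_derivative[OF U(2) that] .
  then have f': "blinfun_apply (f' x) = ?D x" if "x \<in> U" for x
    unfolding f'_def using that by (metis bounded_linear_Blinfun_apply has_derivative_bounded_linear)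
  have DC: "Ck_on k U (\<lambda>x. ?D x v)" for k v using U(2)[of "Suc k"] by simp
  have cont: "continuous_on U f'"
  proof (rule continuous_on_blinfun_componentwise)
    fix i :: 'a
    show "continuous_on U (\<lambda>x. blinfun_apply (f' x) i)"
      using DC[of 0 i] by (subst continuous_on_cong[OF refl, of _ _ "\<lambda>x. ?D x i"]) (auto simp: f')
  qed
  have idf: "id_blinfun o\<^sub>L f' a = id_blinfun"
    by (rule blinfun_eqI) (simp add: f'[OF U(3)] id)
  obtain U' V g g' where *: "open U'" "U' \<subseteq> U" "a \<in> U'" "open V" "f a \<in> V" "homeomorphism U' V f g"
    and g: "\<And>y. y \<in> V \<Longrightarrow> (g has_derivative (g' y)) (at y)"
    "\<And>y. y \<in> V \<Longrightarrow> g' y = inv_into UNIV (blinfun_apply (f' (g y)))"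
    "\<And>y. y \<in> V \<Longrightarrow> bij (blinfun_apply (f' (g y)))"
    using inverse_function_theorem[OF U(1) _ cont U(3) idf] f' der by metis
  have gU: "g y \<in> U" if "y \<in> V" for y using * that by (auto simp: homeomorphism_def)
  have "Ck_on k V g" for k
  proof (induction k)
    case 0
    then show ?case using *(6) by (simp add: homeomorphism_def)
  next
    case (Suc k)
    have "Ck_on k V (\<lambda>y. inv_into UNIV (\<lambda>w. ?D (g y) w) v)" for v
    proof (rule Ck_on_inv_family[OF *(4)])
      fix y assume y: "y \<in> V"
      show "linear (?D (g y))" using der[OF gU[OF y]] has_derivative_linear by blast
      show "bij (?D (g y))" using g(3)[OF y] f'[OF gU[OF y]] by simp
    next
      fix v show "Ck_on k V (\<lambda>y. ?D (g y) v)"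
        by (rule Ck_on_compose[OF *(4) U(1) _ Suc DC]) (use gU in auto)
    qed
    then show ?case
      by (subst Ck_on_Suc_iff[OF *(4), of _ "\<lambda>y. inv_into UNIV (?D (g y))"]) (use g(1,2) f' gU in auto)
  qed
  then show ?thesis using that * by blast
qed

section \<open>Smooth maps on arbitrary sets\<close>

lemma smooth_on_open:
  assumes "open U" shows "smooth_on U f \<longleftrightarrow> (\<forall>k. Ck_on k U f)"
proof
  assume s: "smooth_on U f"
  show "\<forall>k. Ck_on k U f"
  proof (intro allI Ck_on_local[OF assms])
    fix k x assume "x \<in> U"
    then obtain W F where W: "open W" "x \<in> W" "\<forall>k. Ck_on k W F" "\<forall>y\<in>W \<inter> U. F y = f y"
      using s unfolding smooth_on_def by blast
    have "Ck_on k (W \<inter> U) f"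
      by (rule Ck_on_cong[of _ F]) (use W assms Ck_on_subset[of "W \<inter> U" W] in auto)
    then show "\<exists>W. open W \<and> x \<in> W \<and> Ck_on k W f" using W assms \<open>x \<in> U\<close> by (intro exI[of _ "W \<inter> U"]) auto
  qed
next
  assume "\<forall>k. Ck_on k U f"
  then show "smooth_on U f" using assms unfolding smooth_on_def by blast
qed

lemma smooth_on_extension:
  assumes "smooth_on S f" "x \<in> S"
  obtains U F where "open U" "x \<in> U" "smooth_on U F" "\<And>y. y \<in> U \<Longrightarrow> y \<in> S \<Longrightarrow> F y = f y"
  using assms unfolding smooth_on_def[of S] by (metis IntI smooth_on_open)

lemma smooth_onI_extension:
  assumes "\<And>x. x \<in> S \<Longrightarrow> \<exists>U F. open U \<and> x \<in> U \<and> smooth_on U F \<and> (\<forall>y\<in>U \<inter> S. F y = f y)"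
  shows "smooth_on S f"
  unfolding smooth_on_def
proof
  fix x assume "x \<in> S"
  then obtain U F where "open U" "x \<in> U" "smooth_on U F" "\<forall>y\<in>U \<inter> S. F y = f y" using assms by meson
  then show "\<exists>U F. open U \<and> x \<in> U \<and> (\<forall>k. Ck_on k U F) \<and> (\<forall>y\<in>U \<inter> S. F y = f y)"
    by (auto simp: smooth_on_open)
qed

lemma smooth_on_subset: "smooth_on S f \<Longrightarrow> T \<subseteq> S \<Longrightarrow> smooth_on T f"
  unfolding smooth_on_def by (meson Int_mono subset_iff subset_refl)

lemma smooth_on_cong: "(\<And>x. x \<in> S \<Longrightarrow> f x = g x) \<Longrightarrow> smooth_on S f \<Longrightarrow> smooth_on S g"
  by (simp add: smooth_on_def cong: conj_cong)

lemma smooth_on_local: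
  assumes "\<And>x. x \<in> S \<Longrightarrow> \<exists>W. openin (top_of_set S) W \<and> x \<in> W \<and> smooth_on W f"
  shows "smooth_on S f"
proof (rule smooth_onI_extension)
  fix x assume x: "x \<in> S"
  then obtain W where W: "openin (top_of_set S) W" "x \<in> W" "smooth_on W f" using assms by blast
  then obtain Q where Q: "open Q" "W = S \<inter> Q" by (auto simp: openin_open)
  obtain U F where U: "open U" "x \<in> U" "smooth_on U F" "\<And>y. y \<in> U \<Longrightarrow> y \<in> W \<Longrightarrow> F y = f y"
    using smooth_on_extension[OF W(3,2)] by blast
  then show "\<exists>U F. open U \<and> x \<in> U \<and> smooth_on U F \<and> (\<forall>y\<in>U \<inter> S. F y = f y)"
    using Q W by (intro exI[of _ "U \<inter> Q"] exI[of _ F]) (auto intro: smooth_on_subset)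
qed

lemma smooth_on_imp_continuous_on: "smooth_on S f \<Longrightarrow> continuous_on S f"
proof (subst continuous_on_eq_continuous_within, rule ballI)
  fix x assume s: "smooth_on S f" and x: "x \<in> S"
  obtain U F where U: "open U" "x \<in> U" "smooth_on U F" "\<And>y. y \<in> U \<Longrightarrow> y \<in> S \<Longrightarrow> F y = f y"
    using smooth_on_extension[OF s x] by blast
  have "Ck_on 0 U F" using U(1,3) smooth_on_open by blast
  then have "isCont F x" using U(1,2) by (simp add: continuous_on_eq_continuous_at)
  then have "continuous (at x within S) F" by (rule continuous_at_imp_continuous_at_within)
  then show "continuous (at x within S) f"
    by (rule continuous_transform_within_openin[where S = "U \<inter> S"])
      (use U x in \<open>auto simp: openin_open\<close>)
qed

lemma smooth_on_compose:
  assumes f: "smooth_on S f" and g: "smooth_on T g" and sub: "\<And>x. x \<in> S \<Longrightarrow> f x \<in> T"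
  shows "smooth_on S (\<lambda>x. g (f x))"
proof (rule smooth_onI_extension)
  fix x assume x: "x \<in> S"
  obtain U F where U: "open U" "x \<in> U" "smooth_on U F" "\<And>y. y \<in> U \<Longrightarrow> y \<in> S \<Longrightarrow> F y = f y"
    using smooth_on_extension[OF f x] by blast
  obtain W G where W: "open W" "f x \<in> W" "smooth_on W G" "\<And>y. y \<in> W \<Longrightarrow> y \<in> T \<Longrightarrow> G y = g y"
    using smooth_on_extension[OF g sub[OF x]] by blast
  define N where "N = U \<inter> F -` W"
  have N: "open N" unfolding N_def
    using continuous_open_preimage[OF smooth_on_imp_continuous_on[OF U(3)] U(1) W(1)] .
  have F: "Ck_on k N F" for k
    using U(3) unfolding smooth_on_open[OF U(1)] N_def by (blast intro: Ck_on_subset[OF Int_lower1])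
  have G: "Ck_on k W G" for k using W(3) unfolding smooth_on_open[OF W(1)] by blast
  have "F ` N \<subseteq> W" by (auto simp: N_def)
  then have "Ck_on k N (\<lambda>x. G (F x))" for k
    by (rule Ck_on_compose[OF N W(1) _ F G])
  then have "smooth_on N (\<lambda>x. G (F x))" using smooth_on_open[OF N] by blast
  then show "\<exists>U F. open U \<and> x \<in> U \<and> smooth_on U F \<and> (\<forall>y\<in>U \<inter> S. F y = g (f y))"
    using N U W x sub by (intro exI[of _ N] exI[of _ "\<lambda>x. G (F x)"]) (auto simp: N_def)
qed

lemma smooth_on_compose': "smooth_on S f \<Longrightarrow> smooth_on T g \<Longrightarrow> f ` S \<subseteq> T \<Longrightarrow> smooth_on S (g \<circ> f)"
  unfolding comp_def by (rule smooth_on_compose) auto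

lemma smooth_on_binary:
  fixes f :: "'a::euclidean_space \<Rightarrow> 'b::euclidean_space" and g :: "'a \<Rightarrow> 'c::euclidean_space"
    and op :: "'b \<Rightarrow> 'c \<Rightarrow> 'd::euclidean_space"
  assumes f: "smooth_on S f" and g: "smooth_on S g"
    and op: "\<And>(U :: 'a set) k F G. open U \<Longrightarrow> Ck_on k U F \<Longrightarrow> Ck_on k U G \<Longrightarrow> Ck_on k U (\<lambda>x. op (F x) (G x))"
  shows "smooth_on S (\<lambda>x. op (f x) (g x))"
proof (rule smooth_onI_extension)
  fix x assume x: "x \<in> S"
  obtain U F where U: "open U" "x \<in> U" "smooth_on U F" "\<And>y. y \<in> U \<Longrightarrow> y \<in> S \<Longrightarrow> F y = f y"
    using smooth_on_extension[OF f x] by blast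
  obtain W G where W: "open W" "x \<in> W" "smooth_on W G" "\<And>y. y \<in> W \<Longrightarrow> y \<in> S \<Longrightarrow> G y = g y"
    using smooth_on_extension[OF g x] by blast
  have o: "open (U \<inter> W)" using U W by auto
  have "smooth_on (U \<inter> W) F" "smooth_on (U \<inter> W) G"
    using U(3) W(3) by (auto intro: smooth_on_subset)
  then have "smooth_on (U \<inter> W) (\<lambda>x. op (F x) (G x))"
    using op[OF o] unfolding smooth_on_open[OF o] by blast
  then show "\<exists>U' F'. open U' \<and> x \<in> U' \<and> smooth_on U' F' \<and> (\<forall>y\<in>U' \<inter> S. F' y = op (f y) (g y))"
    using o U W by (intro exI[of _ "U \<inter> W"] exI[of _ "\<lambda>x. op (F x) (G x)"]) auto
qed

lemma smooth_on_Pair: "smooth_on S f \<Longrightarrow> smooth_on S g \<Longrightarrow> smooth_on S (\<lambda>x. (f x, g x))"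
  by (rule smooth_on_binary[where op = Pair]; blast intro: Ck_on_Pair)

lemma smooth_on_add: "smooth_on S f \<Longrightarrow> smooth_on S g \<Longrightarrow> smooth_on S (\<lambda>x. f x + g x)"
  by (rule smooth_on_binary[where op = "(+)"]; blast intro: Ck_on_add)

lemma smooth_on_bilinear:
  "bounded_bilinear op \<Longrightarrow> smooth_on S f \<Longrightarrow> smooth_on S g \<Longrightarrow> smooth_on S (\<lambda>x. op (f x) (g x))"
  by (rule smooth_on_binary[where op = op]; blast intro: Ck_on_bilinear)

lemmas smooth_on_scaleR = smooth_on_bilinear[OF bounded_bilinear_scaleR]
lemmas smooth_on_inner = smooth_on_bilinear[OF bounded_bilinear_inner]

lemma smooth_on_const: "smooth_on S (\<lambda>x. c)"
  unfolding smooth_on_def using Ck_on_const open_UNIV by blast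

lemma smooth_on_sum:
  "(\<And>i. i \<in> I \<Longrightarrow> smooth_on S (f i)) \<Longrightarrow> smooth_on S (\<lambda>x. \<Sum>i\<in>I. f i x)"
  by (induction I rule: infinite_finite_induct) (auto intro: smooth_on_const smooth_on_add)

lemma Ck_on_ident: "Ck_on k U (\<lambda>x. x)"
proof (cases k)
  case (Suc j)
  have "Ck_on (Suc j) UNIV (\<lambda>x::'a. x)"
    by (subst Ck_on_Suc_iff[of _ _ "\<lambda>x v. v"]) (auto intro: Ck_on_const)
  then show ?thesis using Ck_on_subset[of U UNIV] Suc by blast
qed simp

lemma smooth_on_ident: "smooth_on S (\<lambda>x. x)"
  unfolding smooth_on_def using Ck_on_ident open_UNIV by blast

lemma smooth_on_linear:
  assumes "linear L" shows "smooth_on S L"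
proof -
  have "Ck_on k UNIV L" for k
    using Ck_on_linear[OF _ open_UNIV Ck_on_ident] assms unfolding linear_conv_bounded_linear by blast
  then show ?thesis unfolding smooth_on_def by blast
qed

lemma smooth_on_linear_compose: "linear L \<Longrightarrow> smooth_on S f \<Longrightarrow> smooth_on S (\<lambda>x. L (f x))"
  by (rule smooth_on_compose[OF _ smooth_on_linear[of L UNIV]]) auto

lemma smooth_on_minus: "smooth_on S f \<Longrightarrow> smooth_on S (\<lambda>x. - f x)"
  by (rule smooth_on_linear_compose[of uminus]) (auto simp: linear_iff)

lemma smooth_on_diff: "smooth_on S f \<Longrightarrow> smooth_on S g \<Longrightarrow> smooth_on S (\<lambda>x. f x - g x)"
  using smooth_on_add[OF _ smooth_on_minus, of S f g] by simp

lemma smooth_on_fst: "smooth_on S f \<Longrightarrow> smooth_on S (\<lambda>x. fst (f x))"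
  by (rule smooth_on_linear_compose[of fst]) (auto simp: linear_iff)

lemma smooth_on_snd: "smooth_on S f \<Longrightarrow> smooth_on S (\<lambda>x. snd (f x))"
  by (rule smooth_on_linear_compose[of snd]) (auto simp: linear_iff)

lemma smooth_on_has_derivative:
  "open U \<Longrightarrow> smooth_on U f \<Longrightarrow> x \<in> U \<Longrightarrow> (f has_derivative frechet_derivative f (at x)) (at x)"
  using Ck_on_has_derivative[of 0 U f x] unfolding smooth_on_open by blast

lemma smooth_on_frechet_derivative:
  assumes "open U" "smooth_on U f" shows "smooth_on U (\<lambda>x. frechet_derivative f (at x) v)"
proof -
  have "Ck_on (Suc k) U f" for k using assms smooth_on_open by blast
  then show ?thesis unfolding smooth_on_open[OF assms(1)] Ck_on.simps(2) by blast
qed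

lemma smooth_on_linear_family:
  fixes v :: "'c::euclidean_space \<Rightarrow> 'b::euclidean_space"
  assumes "\<And>y. y \<in> S \<Longrightarrow> linear (A y)" "\<And>v. smooth_on S (\<lambda>y. A y v)" "smooth_on S v"
  shows "smooth_on S (\<lambda>y. A y (v y))"
proof (rule smooth_on_cong)
  show "smooth_on S (\<lambda>y. \<Sum>b\<in>Basis. (v y \<bullet> b) *\<^sub>R A y b)"
    by (intro smooth_on_sum smooth_on_scaleR smooth_on_inner assms smooth_on_const)
qed (use linear_sum_Basis[OF assms(1)] in metis)

lemma smooth_on_frechet_derivative':
  assumes "open U" "smooth_on U f" "smooth_on S a" "a ` S \<subseteq> U" "smooth_on S v"
  shows "smooth_on S (\<lambda>x. frechet_derivative f (at (a x)) (v x))"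
proof (rule smooth_on_linear_family[OF _ _ assms(5)])
  show "linear (frechet_derivative f (at (a y)))" if "y \<in> S" for y
    using smooth_on_has_derivative[OF assms(1,2)] assms(4) that has_derivative_linear by blast
  show "smooth_on S (\<lambda>y. frechet_derivative f (at (a y)) v)" for v
    using assms(4) by (intro smooth_on_compose[OF assms(3) smooth_on_frechet_derivative[OF assms(1,2)]]) auto
qed

lemma smooth_on_inv_family:
  fixes A :: "'p::euclidean_space \<Rightarrow> 'b::euclidean_space \<Rightarrow> 'b"
  assumes "open U" "\<And>y. y \<in> U \<Longrightarrow> linear (A y)" "\<And>y. y \<in> U \<Longrightarrow> bij (A y)" "\<And>v. smooth_on U (\<lambda>y. A y v)"
  shows "smooth_on U (\<lambda>y. inv_into UNIV (A y) w)"
  using assms(4) unfolding smooth_on_open[OF assms(1)]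
  by (intro allI Ck_on_inv_family[OF assms(1,2,3)]) blast+

section \<open>Orthogonal projections onto subspaces\<close>

lemma orthogonal_projection_exists:
  fixes T :: "'a::euclidean_space set"
  assumes "subspace T"
  obtains P where "linear P" "\<And>x. P x \<in> T" "\<And>t. t \<in> T \<Longrightarrow> P t = t"
    "\<And>x t. t \<in> T \<Longrightarrow> P x \<bullet> t = x \<bullet> t"
proof -
  have "\<exists>y. y \<in> T \<and> (\<forall>t\<in>T. y \<bullet> t = x \<bullet> t)" for x
  proof -
    obtain y z where "y \<in> span T" "\<And>w. w \<in> span T \<Longrightarrow> orthogonal z w" "x = y + z"
      using orthogonal_subspace_decomp_exists[of T x] by blast
    then show ?thesis using assms
      by (intro exI[of _ y]) (auto simp: span_eq_iff[THEN iffD2] inner_add_left orthogonal_def)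
  qed
  then obtain P where P: "\<And>x. P x \<in> T" "\<And>x t. t \<in> T \<Longrightarrow> P x \<bullet> t = x \<bullet> t" by metis
  have uniq: "P x = y" if "y \<in> T" "\<And>t. t \<in> T \<Longrightarrow> y \<bullet> t = x \<bullet> t" for x y
  proof -
    have "P x - y \<in> T" using P that assms by (simp add: subspace_diff)
    then have "(P x - y) \<bullet> (P x - y) = 0" using P that by (simp add: inner_diff_left)
    then show ?thesis by simp
  qed
  have "linear P"
    by (rule linearI; rule uniq)
      (use P assms in \<open>auto simp: inner_add_left subspace_add subspace_scale\<close>)
  then show ?thesis using that P uniq by blast
qed

text \<open>Fixes one projection per subspace, for use inside definitions such as that of the
  bilinear extension of the infinitesimal representation.\<close>

definition oproj :: "'a::euclidean_space set \<Rightarrow> 'a \<Rightarrow> 'a" where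
  "oproj T = (SOME P. linear P \<and> (\<forall>x. P x \<in> T) \<and> (\<forall>t\<in>T. P t = t) \<and> (\<forall>x. \<forall>t\<in>T. P x \<bullet> t = x \<bullet> t))"

lemma oproj:
  assumes "subspace T"
  shows "linear (oproj T)" "oproj T x \<in> T" "t \<in> T \<Longrightarrow> oproj T t = t" "t \<in> T \<Longrightarrow> oproj T x \<bullet> t = x \<bullet> t"
proof -
  have "\<exists>P. linear P \<and> (\<forall>x. P x \<in> T) \<and> (\<forall>t\<in>T. P t = t) \<and> (\<forall>x. \<forall>t\<in>T. P x \<bullet> t = x \<bullet> t)"
    using orthogonal_projection_exists[OF assms] by metis
  from someI_ex[OF this]
  show "linear (oproj T)" "oproj T x \<in> T" "t \<in> T \<Longrightarrow> oproj T t = t" "t \<in> T \<Longrightarrow> oproj T x \<bullet> t = x \<bullet> t"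
    unfolding oproj_def[symmetric] by auto
qed

section \<open>The constant rank theorem\<close>

text \<open>A right inverse \<open>s\<close> of \<open>P\<close> embeds \<open>P\<close>
  R\<open>into\<close>R\<open>. As the dimension of\<close>P \<open>R\<close> is not smaller,
  \<open>s\<close> reaches all of \<open>R\<close>; hence \<open>p = s v\<close> with
  \<open>v = P p = 0\<close>.\<close>

lemma linear_surj_subspace_inj_on:
  fixes P :: "'a::euclidean_space \<Rightarrow> 'b::euclidean_space"
  assumes "linear P" "subspace R" "dim R \<le> dim (P ` R)" "p \<in> R" "P p = 0"
  shows "p = 0"
proof -
  obtain s where s: "range s \<subseteq> R" "linear s" "\<And>v. v \<in> P ` R \<Longrightarrow> P (s v) = v"
    using linear_exists_right_inverse_on[OF assms(1,2)] by blast
  have sub: "subspace (P ` R)" using assms by (simp add: linear_subspace_image)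
  have "inj_on s (P ` R)" using s(3) by (metis inj_onI)
  then have "dim (s ` (P ` R)) = dim (P ` R)"
    using s(2) sub by (intro dim_image_eq) (auto simp: span_eq_iff[THEN iffD2])
  then have "s ` (P ` R) = R"
    using s assms sub by (intro subspace_dim_equal) (auto simp: linear_subspace_image)
  then obtain v where "v \<in> P ` R" "p = s v" using assms by blast
  then show ?thesis using s assms by (metis linear_0)
qed

text \<open>A right inverse of the derivative turns \<open>f\<close> into a map that depends only on the
  coordinates along \<open>T\<close>, because the rank does not exceed the dimension of \<open>T\<close>.\<close>

lemma constant_rank_graph:
  fixes f :: "'a::euclidean_space \<Rightarrow> 'b::euclidean_space"
  assumes U: "open U" and f: "smooth_on U f" and a: "a \<in> U"
    and T: "T = range (frechet_derivative f (at a))"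
    and dim: "\<And>y. y \<in> U \<Longrightarrow> dim (range (frechet_derivative f (at y))) \<le> dim T"
    and P: "linear P" "\<And>x. P x \<in> T" "\<And>t. t \<in> T \<Longrightarrow> P t = t"
  obtains N Q h where "open N" "a \<in> N" "N \<subseteq> U" "open Q" "smooth_on Q h" "f ` N \<subseteq> h ` (Q \<inter> T)"
    "h ` (Q \<inter> T) \<subseteq> f ` U" "\<And>t. t \<in> Q \<Longrightarrow> t \<in> T \<Longrightarrow> P (h t) = t"
proof -
  define A where "A = frechet_derivative f (at a)"
  have fd: "(f has_derivative frechet_derivative f (at y)) (at y)" if "y \<in> U" for y
    by (rule smooth_on_has_derivative[OF U f that])
  have lf: "linear (frechet_derivative f (at y))" if "y \<in> U" for y
    using fd[OF that] has_derivative_linear by blast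
  have lA: "linear A" unfolding A_def by (rule lf[OF a])
  have TA: "T = range A" unfolding A_def by (rule T)
  then have subT: "subspace T" using lA by (simp add: linear_subspace_image)
  obtain s where s: "linear s" "\<And>t. t \<in> T \<Longrightarrow> A (s t) = t"
    using linear_exists_right_inverse_on[OF lA subspace_UNIV] TA by blast
  \<comment> \<open>Since \<open>A\<close> undoes \<open>s\<close> on \<open>T\<close>, this choice
    gives \<open>A (\<Psi> y) = P (f y)\<close>; since \<open>P\<close> fixes the range of
    \<open>A\<close>, the derivative of \<open>\<Psi>\<close> at \<open>a\<close> is the
    identity.\<close>
  define \<Psi> where "\<Psi> y = y + s (P (f y) - A y)" for y
  have smP: "smooth_on U \<Psi>" unfolding \<Psi>_def
    by (intro smooth_on_add smooth_on_ident smooth_on_diff smooth_on_linear_compose[OF s(1)]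
        smooth_on_linear_compose[OF P(1)] f smooth_on_linear lA)
  have PA: "P (A v) = A v" for v using P(3) TA by blast
  have bl: "bounded_linear s" "bounded_linear P" "bounded_linear A"
    using s(1) P(1) lA by (auto simp: linear_conv_bounded_linear)
  have fda: "(f has_derivative A) (at a)" unfolding A_def by (rule fd[OF a])
  have "((\<lambda>y. P (f y) - A y) has_derivative (\<lambda>v. P (A v) - A v)) (at a)"
    by (rule has_derivative_diff[OF bounded_linear.has_derivative[OF bl(2) fda]
          bounded_linear_imp_has_derivative[OF bl(3)]])
  from has_derivative_add[OF has_derivative_ident bounded_linear.has_derivative[OF bl(1) this]]
  have "(\<Psi> has_derivative (\<lambda>v. v + s (P (A v) - A v))) (at a)" unfolding \<Psi>_def .
  then have "frechet_derivative \<Psi> (at a) = (\<lambda>v. v)"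
    using frechet_derivative_at[of \<Psi>] PA by (simp add: linear_0[OF s(1)])
  then obtain U' V g where IF: "open U'" "U' \<subseteq> U" "a \<in> U'" "open V" "\<Psi> a \<in> V"
      "homeomorphism U' V \<Psi> g" "\<And>k. Ck_on k V g"
    using smooth_inverse_function[of U \<Psi> a] U smP a smooth_on_open[OF U] by metis
  have gs: "smooth_on V g" using IF smooth_on_open by blast
  have gU: "g z \<in> U'" "\<Psi> (g z) = z" if "z \<in> V" for z using IF(6) that by (auto simp: homeomorphism_def)
  define b where "b = \<Psi> a"
  obtain r where r: "r > 0" "ball b r \<subseteq> V" using IF(4,5) b_def open_contains_ball by blast
  define F where "F z = f (g z)" for z
  have Fs: "smooth_on V F" unfolding F_def
    by (rule smooth_on_compose[OF gs f]) (use gU IF in auto)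
  have PF: "P (F z) = A z" if "z \<in> V" for z
  proof -
    have "P (f (g z)) - A (g z) \<in> T" using P(2) TA subT by (simp add: subspace_diff)
    then have "A (\<Psi> (g z)) = P (f (g z))" unfolding \<Psi>_def using s(2) by (simp add: linear_add[OF lA])
    then show ?thesis using gU[OF that] by (simp add: F_def)
  qed
  \<comment> \<open>From \<open>P (F z) = A z\<close> it follows that \<open>P\<close> maps the
    range of the derivative of \<open>f\<close> at \<open>g z\<close> onto \<open>T\<close>. The
    rank bound makes \<open>P\<close> injective on this range, and there \<open>P\<close> sends the
    derivative of \<open>F\<close> along \<open>k\<close> to \<open>A k = 0\<close>.\<close>
  have F0: "frechet_derivative F (at z) k = 0" if z: "z \<in> V" and k: "A k = 0" for z k
  proof -
    have Fd: "(F has_derivative frechet_derivative F (at z)) (at z)"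
      by (rule smooth_on_has_derivative[OF IF(4) Fs z])
    let ?R = "range (frechet_derivative f (at (g z)))"
    have gz: "g z \<in> U" using gU[OF z] IF by blast
    have "(A has_derivative (\<lambda>v. P (frechet_derivative F (at z) v))) (at z)"
      by (rule has_derivative_transform_within_open[OF bounded_linear.has_derivative[OF bl(2) Fd] IF(4) z])
        (rule PF)
    moreover have "(A has_derivative A) (at z)"
      by (rule bounded_linear_imp_has_derivative[OF bl(3)])
    ultimately have PFA: "P (frechet_derivative F (at z) v) = A v" for v
      using has_derivative_unique by metis
    have "(F has_derivative (\<lambda>v. frechet_derivative f (at (g z)) (frechet_derivative g (at z) v))) (at z)"
      unfolding F_def
      by (rule has_derivative_compose[OF smooth_on_has_derivative[OF IF(4) gs z] fd[OF gz]])
    then have Fr: "frechet_derivative F (at z) v \<in> ?R" for v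
      using has_derivative_unique[OF Fd] by (metis rangeI)
    have "T \<subseteq> P ` ?R"
    proof
      fix t assume "t \<in> T"
      then obtain v where "t = A v" using TA by blast
      then show "t \<in> P ` ?R" using PFA Fr by (metis image_eqI)
    qed
    then have "dim ?R \<le> dim (P ` ?R)" using dim[OF gz] dim_subset le_trans by blast
    then show ?thesis
      using linear_surj_subspace_inj_on[OF P(1) _ _ Fr] PFA k lf[OF gz] by (simp add: linear_subspace_image)
  qed
  \<comment> \<open>The segment from \<open>z\<close> to \<open>z'\<close> stays in the ball, and
    its direction lies in the kernel of \<open>A\<close>, along which the derivative of
    \<open>F\<close> vanishes.\<close>
  have Fconst: "F z = F z'" if z: "z \<in> ball b r" "z' \<in> ball b r" "A z = A z'" for z z'
  proof -
    define \<gamma> where "\<gamma> t = z + t *\<^sub>R (z' - z)" for t :: real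
    have gam: "\<gamma> t \<in> ball b r" if "t \<in> {0..1}" for t
    proof -
      have "\<gamma> t = (1 - t) *\<^sub>R z + t *\<^sub>R z'" by (simp add: \<gamma>_def algebra_simps)
      then show ?thesis using convexD[OF convex_ball z(1,2), of "1 - t" t] that by simp
    qed
    have "((\<lambda>t. F (\<gamma> t)) has_derivative (\<lambda>h. 0)) (at t within {0..1})" if t: "t \<in> {0..1}" for t
    proof -
      have V: "\<gamma> t \<in> V" using gam[OF t] r by blast
      have "(\<gamma> has_derivative (\<lambda>h. h *\<^sub>R (z' - z))) (at t within {0..1})"
        unfolding \<gamma>_def by (auto intro!: derivative_eq_intros)
      then have "((\<lambda>t. F (\<gamma> t)) has_derivative (\<lambda>h. frechet_derivative F (at (\<gamma> t)) (h *\<^sub>R (z' - z)))) (at t within {0..1})"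
        by (rule has_derivative_compose[where g = F and f = \<gamma>])
          (rule smooth_on_has_derivative[OF IF(4) Fs V])
      moreover have "A (h *\<^sub>R (z' - z)) = 0" for h using z by (simp add: linear_cmul[OF lA] linear_diff[OF lA])
      ultimately show ?thesis using F0[OF V] by simp
    qed
    then obtain c where "\<forall>t\<in>{0..1}. F (\<gamma> t) = c"
      using has_derivative_zero_constant[of "{0..1::real}" "\<lambda>t. F (\<gamma> t)"] by auto
    then have "F (\<gamma> 0) = F (\<gamma> 1)" by simp
    then show ?thesis by (simp add: \<gamma>_def)
  qed
  \<comment> \<open>An affine section of \<open>A\<close> over \<open>T\<close>, normalized so that
    it passes through \<open>b\<close> at \<open>A b\<close>.\<close>
  define q where "q t = b + s (t - A b)" for t
  have qs: "smooth_on S q" for S unfolding q_def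
    by (intro smooth_on_add smooth_on_const smooth_on_linear_compose[OF s(1)] smooth_on_diff smooth_on_ident)
  have Aq: "A (q t) = t" if "t \<in> T" for t
  proof -
    have "t - A b \<in> T" using that TA subT by (simp add: subspace_diff)
    then show ?thesis using s(2) by (simp add: q_def linear_add[OF lA])
  qed
  define h where "h t = F (q t)" for t
  define Q where "Q = q -` ball b r"
  \<comment> \<open>Both \<open>\<Psi> y\<close> and the point \<open>q (A (\<Psi> y))\<close> of
    the slice have to lie in the ball, so that \<open>Fconst\<close> can compare them. For
    \<open>y = a\<close> both are \<open>b\<close>.\<close>
  define N where "N = U' \<inter> \<Psi> -` (ball b r \<inter> (\<lambda>z. q (A z)) -` ball b r)"
  have qc: "continuous_on UNIV q" using smooth_on_imp_continuous_on[OF qs] .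
  have oQ: "open Q" unfolding Q_def using qc open_vimage[OF open_ball] by blast
  have "continuous_on UNIV (\<lambda>z. q (A z))"
    by (intro smooth_on_imp_continuous_on smooth_on_compose[OF smooth_on_linear[OF lA] qs[of UNIV]]) auto
  then have "open (ball b r \<inter> (\<lambda>z. q (A z)) -` ball b r)"
    using open_vimage[OF open_ball] by blast
  then have oN: "open N" unfolding N_def
    by (rule continuous_open_preimage[rotated 2]) (use IF(1,6) in \<open>auto simp: homeomorphism_def\<close>)
  show ?thesis
  proof (rule that[of N Q h])
    show "open N" "open Q" by fact+
    show "a \<in> N" using IF(3) r by (simp add: N_def b_def[symmetric] q_def linear_0[OF s(1)])
    show "N \<subseteq> U" using IF by (auto simp: N_def)
    show "smooth_on Q h" unfolding h_def
      by (rule smooth_on_compose[OF qs Fs]) (use r in \<open>auto simp: Q_def\<close>)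
    show "f ` N \<subseteq> h ` (Q \<inter> T)"
    proof clarify
      fix y assume y: "y \<in> N"
      let ?t = "A (\<Psi> y)"
      have "f y = F (\<Psi> y)" using y IF(6) by (simp add: F_def N_def homeomorphism_def)
      also have "\<dots> = h ?t" unfolding h_def
        by (rule Fconst) (use y Aq TA in \<open>auto simp: N_def\<close>)
      finally show "f y \<in> h ` (Q \<inter> T)" using y TA by (auto simp: N_def Q_def)
    qed
    show "h ` (Q \<inter> T) \<subseteq> f ` U" using r(2) gU(1) IF(2) unfolding h_def F_def Q_def by blast
    show "P (h t) = t" if "t \<in> Q" "t \<in> T" for t
      using that PF Aq r by (auto simp: h_def Q_def)
  qed
qed

section \<open>Smooth maps between manifolds\<close>

text \<open>The part of \<open>smooth_manifold\<close> that the calculus of smooth maps uses and that passes to products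
  directly.\<close>

definition charted :: "('a, 'e::euclidean_space) manifold \<Rightarrow> bool" where
  "charted M \<longleftrightarrow>
     \<Union> (fst ` atlas M) = topspace (mtop M) \<and>
     (\<forall>U \<phi>. (U, \<phi>) \<in> atlas M \<longrightarrow> openin (mtop M) U \<and>
        (\<exists>E. subspace E \<and> openin (top_of_set E) (\<phi> ` U)) \<and>
        homeomorphic_map (subtopology (mtop M) U) (top_of_set (\<phi> ` U)) \<phi>) \<and>
     (\<forall>U \<phi> W \<psi>. (U, \<phi>) \<in> atlas M \<longrightarrow> (W, \<psi>) \<in> atlas M \<longrightarrow>
        smooth_on (\<phi> ` (U \<inter> W)) (\<psi> \<circ> inv_into U \<phi>))"

lemma smooth_manifold_charted: "smooth_manifold M \<Longrightarrow> charted M"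
  unfolding smooth_manifold_def charted_def by (auto; blast)

lemma charted_cover:
  assumes "charted M" "p \<in> topspace (mtop M)"
  obtains U \<phi> where "(U, \<phi>) \<in> atlas M" "p \<in> U"
proof -
  have "p \<in> \<Union> (fst ` atlas M)" using assms unfolding charted_def by blast
  then show ?thesis using that by force
qed

lemma charted_transition:
  "charted M \<Longrightarrow> (U, \<phi>) \<in> atlas M \<Longrightarrow> (W, \<psi>) \<in> atlas M \<Longrightarrow>
    smooth_on (\<phi> ` (U \<inter> W)) (\<psi> \<circ> inv_into U \<phi>)"
  unfolding charted_def by blast

context
  fixes M :: "('a, 'e::euclidean_space) manifold" and U \<phi>
  assumes M: "charted M" and chart: "(U, \<phi>) \<in> atlas M"
begin

lemma chart_openin: "openin (mtop M) U"
  using M chart unfolding charted_def by blast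

lemma chart_subset: "U \<subseteq> topspace (mtop M)"
  by (rule openin_subset[OF chart_openin])

lemma chart_homeomorphic_map: "homeomorphic_map (subtopology (mtop M) U) (top_of_set (\<phi> ` U)) \<phi>"
  using M chart unfolding charted_def by blast

lemma chart_range: obtains E where "subspace E" "openin (top_of_set E) (\<phi> ` U)"
  using M chart unfolding charted_def by blast

lemma chart_inj_on: "inj_on \<phi> U"
  using homeomorphic_imp_injective_map[OF chart_homeomorphic_map] chart_subset
  by (simp add: inf.absorb2)

lemma chart_inv: "p \<in> U \<Longrightarrow> inv_into U \<phi> (\<phi> p) = p"
  by (simp add: chart_inj_on)

lemma chart_continuous_map: "continuous_map (subtopology (mtop M) U) (top_of_set (\<phi> ` U)) \<phi>"
  by (rule homeomorphic_imp_continuous_map[OF chart_homeomorphic_map])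

lemma chart_inv_continuous_map:
  "continuous_map (top_of_set (\<phi> ` U)) (subtopology (mtop M) U) (inv_into U \<phi>)"
proof -
  obtain g where g: "homeomorphic_maps (subtopology (mtop M) U) (top_of_set (\<phi> ` U)) \<phi> g"
    using chart_homeomorphic_map homeomorphic_map_maps by blast
  then have "continuous_map (top_of_set (\<phi> ` U)) (subtopology (mtop M) U) g"
    by (simp add: homeomorphic_maps_def)
  moreover have "g y = inv_into U \<phi> y" if "y \<in> \<phi> ` U" for y
    using that g chart_subset chart_inv by (auto simp: homeomorphic_maps_def)
  ultimately show ?thesis by (auto intro: continuous_map_eq)
qed

lemma chart_image_openin:
  assumes "openin (mtop M) W" shows "openin (top_of_set (\<phi> ` U)) (\<phi> ` (U \<inter> W))"
proof -
  have "openin (subtopology (mtop M) U) (U \<inter> W)"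
    using assms by (auto simp: openin_subtopology)
  then show ?thesis
    using homeomorphic_imp_open_map[OF chart_homeomorphic_map] unfolding open_map_def by blast
qed

lemma chart_preimage_openin:
  assumes "openin (top_of_set (\<phi> ` U)) Q" shows "openin (mtop M) {p \<in> U. \<phi> p \<in> Q}"
proof -
  have "openin (subtopology (mtop M) U) {p \<in> topspace (subtopology (mtop M) U). \<phi> p \<in> Q}"
    using chart_continuous_map assms by (rule openin_continuous_map_preimage)
  moreover have "{p \<in> topspace (subtopology (mtop M) U). \<phi> p \<in> Q} = {p \<in> U. \<phi> p \<in> Q}"
    using chart_subset by auto
  ultimately show ?thesis using chart_openin openin_trans_full by fastforce
qed

end

text \<open>Local vector-valued smooth functions; \<open>smooth_near\<close> is the real-valued case
  with the neighbourhood left unspecified.\<close>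

definition smooth_fun ::
    "('a, 'e::euclidean_space) manifold \<Rightarrow> 'a set \<Rightarrow> ('a \<Rightarrow> 'b::euclidean_space) \<Rightarrow> bool" where
  "smooth_fun M W k \<longleftrightarrow> openin (mtop M) W \<and>
     (\<forall>U \<phi>. (U, \<phi>) \<in> atlas M \<longrightarrow> smooth_on (\<phi> ` (U \<inter> W)) (k \<circ> inv_into U \<phi>))"

lemma smooth_near_iff: "smooth_near M p f \<longleftrightarrow> (\<exists>W. p \<in> W \<and> smooth_fun M W f)"
  unfolding smooth_near_def smooth_fun_def by auto

text \<open>One chart around each point suffices, because every other chart differs from it by a
  smooth transition map.\<close>

lemma smooth_fun_local:
  assumes M: "charted M" and W: "openin (mtop M) W"
    and loc: "\<And>p. p \<in> W \<Longrightarrow> \<exists>U \<phi> W'. (U, \<phi>) \<in> atlas M \<and> p \<in> U \<and> p \<in> W' \<and> openin (mtop M) W' \<and>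
       smooth_on (\<phi> ` (U \<inter> W')) (k \<circ> inv_into U \<phi>)"
  shows "smooth_fun M W k"
  unfolding smooth_fun_def
proof (intro conjI allI impI W)
  fix U \<phi> assume c: "(U, \<phi>) \<in> atlas M"
  show "smooth_on (\<phi> ` (U \<inter> W)) (k \<circ> inv_into U \<phi>)"
  proof (rule smooth_on_local)
    fix y assume "y \<in> \<phi> ` (U \<inter> W)"
    then obtain p where p: "p \<in> U" "p \<in> W" "y = \<phi> p" by blast
    obtain U1 \<phi>1 W1 where 1: "(U1, \<phi>1) \<in> atlas M" "p \<in> U1" "p \<in> W1" "openin (mtop M) W1"
       "smooth_on (\<phi>1 ` (U1 \<inter> W1)) (k \<circ> inv_into U1 \<phi>1)" using loc[OF p(2)] by blast
    let ?O = "U1 \<inter> W1 \<inter> W"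
    have o: "openin (mtop M) ?O" using 1 W chart_openin[OF M 1(1)] by blast
    have "openin (top_of_set (\<phi> ` (U \<inter> W))) (\<phi> ` (U \<inter> ?O))"
      by (rule openin_subset_trans[OF chart_image_openin[OF M c o]]) auto
    moreover have "y \<in> \<phi> ` (U \<inter> ?O)" using p 1 by blast
    moreover have "smooth_on (\<phi> ` (U \<inter> ?O)) (k \<circ> inv_into U \<phi>)"
    proof (rule smooth_on_cong)
      have "smooth_on (\<phi> ` (U \<inter> ?O)) (\<phi>1 \<circ> inv_into U \<phi>)"
        by (rule smooth_on_subset[OF charted_transition[OF M c 1(1)]]) auto
      then show "smooth_on (\<phi> ` (U \<inter> ?O)) ((k \<circ> inv_into U1 \<phi>1) \<circ> (\<phi>1 \<circ> inv_into U \<phi>))"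
        by (rule smooth_on_compose'[OF _ 1(5)]) (use chart_inv[OF M c] in auto)
    qed (use chart_inv[OF M c] chart_inv[OF M 1(1)] in auto)
    ultimately show "\<exists>W'. openin (top_of_set (\<phi> ` (U \<inter> W))) W' \<and> y \<in> W' \<and> smooth_on W' (k \<circ> inv_into U \<phi>)"
      by blast
  qed
qed

lemma smooth_fun_subset:
  "smooth_fun M W k \<Longrightarrow> openin (mtop M) W' \<Longrightarrow> W' \<subseteq> W \<Longrightarrow> smooth_fun M W' k"
  unfolding smooth_fun_def by (meson Int_mono image_mono order_refl smooth_on_subset)

lemma smooth_fun_cong:
  assumes "charted M" "smooth_fun M W k" "\<And>p. p \<in> W \<Longrightarrow> k p = k' p"
  shows "smooth_fun M W k'"
  unfolding smooth_fun_def
proof (intro conjI allI impI)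
  show "openin (mtop M) W" using assms(2) smooth_fun_def by blast
  fix U \<phi> assume c: "(U, \<phi>) \<in> atlas M"
  then have "smooth_on (\<phi> ` (U \<inter> W)) (k \<circ> inv_into U \<phi>)" using assms(2) smooth_fun_def by blast
  then show "smooth_on (\<phi> ` (U \<inter> W)) (k' \<circ> inv_into U \<phi>)"
    by (rule smooth_on_cong[rotated]) (use chart_inv[OF assms(1) c] assms(3) in auto)
qed

lemma smooth_fun_compose:
  assumes "charted M" "smooth_fun M W k" "smooth_on T g" "\<And>p. p \<in> W \<Longrightarrow> k p \<in> T"
  shows "smooth_fun M W (\<lambda>p. g (k p))"
  unfolding smooth_fun_def
proof (intro conjI allI impI)
  show "openin (mtop M) W" using assms(2) smooth_fun_def by blast
  fix U \<phi> assume c: "(U, \<phi>) \<in> atlas M"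
  then have "smooth_on (\<phi> ` (U \<inter> W)) (k \<circ> inv_into U \<phi>)" using assms(2) smooth_fun_def by blast
  then show "smooth_on (\<phi> ` (U \<inter> W)) ((\<lambda>p. g (k p)) \<circ> inv_into U \<phi>)"
    unfolding comp_def
    by (rule smooth_on_compose[OF _ assms(3)]) (use chart_inv[OF assms(1) c] assms(4) in auto)
qed

lemma smooth_fun_Pair: "smooth_fun M W k \<Longrightarrow> smooth_fun M W l \<Longrightarrow> smooth_fun M W (\<lambda>p. (k p, l p))"
  unfolding smooth_fun_def comp_def by (auto intro!: smooth_on_Pair)

lemma smooth_fun_const: "openin (mtop M) W \<Longrightarrow> smooth_fun M W (\<lambda>p. c)"
  unfolding smooth_fun_def comp_def by (auto intro!: smooth_on_const)

lemma smooth_fun_continuous_map: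
  assumes M: "charted M" and k: "smooth_fun M W k"
  shows "continuous_map (subtopology (mtop M) W) euclidean k"
proof -
  have W: "openin (mtop M) W" using k smooth_fun_def by blast
  have "openin (mtop M) {p \<in> W. k p \<in> T}" if T: "open T" for T
  proof (subst openin_subopen, intro ballI)
    fix p assume p: "p \<in> {p \<in> W. k p \<in> T}"
    then have "p \<in> topspace (mtop M)" using W openin_subset by blast
    then obtain U \<phi> where c: "(U, \<phi>) \<in> atlas M" "p \<in> U" using charted_cover[OF M] by blast
    let ?O = "{q \<in> U \<inter> W. k q \<in> T}" and ?Y = "\<phi> ` (U \<inter> W)"
    have "continuous_on ?Y (k \<circ> inv_into U \<phi>)"
      using k c smooth_on_imp_continuous_on unfolding smooth_fun_def by blast
    then have "openin (top_of_set ?Y) (?Y \<inter> (k \<circ> inv_into U \<phi>) -` T)"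
      using T by (simp add: continuous_openin_preimage_gen)
    then have "openin (top_of_set (\<phi> ` U)) (?Y \<inter> (k \<circ> inv_into U \<phi>) -` T)"
      using chart_image_openin[OF M c(1) W] openin_trans by blast
    from chart_preimage_openin[OF M c(1) this]
    have "openin (mtop M) {q \<in> U. \<phi> q \<in> ?Y \<inter> (k \<circ> inv_into U \<phi>) -` T}" .
    moreover have "{q \<in> U. \<phi> q \<in> ?Y \<inter> (k \<circ> inv_into U \<phi>) -` T} = ?O"
      using chart_inv[OF M c(1)] by (auto simp: inj_on_eq_iff[OF chart_inj_on[OF M c(1)]])
    ultimately show "\<exists>O'. openin (mtop M) O' \<and> p \<in> O' \<and> O' \<subseteq> {p \<in> W. k p \<in> T}"
      using p c by (intro exI[of _ ?O]) auto
  qed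
  moreover have "topspace (subtopology (mtop M) W) = W" using W openin_subset by auto
  ultimately show ?thesis
    using W by (auto simp: continuous_map_def openin_open_subtopology)
qed

lemma smooth_mapI:
  assumes "charted N" "continuous_map (mtop M) (mtop N) f"
    and "\<And>W \<psi>. (W, \<psi>) \<in> atlas N \<Longrightarrow> smooth_fun M {p \<in> topspace (mtop M). f p \<in> W} (\<psi> \<circ> f)"
    and M: "charted M"
  shows "smooth_map M N f"
  unfolding smooth_map_def
proof (intro conjI assms(2) ballI, clarify)
  fix U \<phi> W \<psi> assume c: "(U, \<phi>) \<in> atlas M" "(W, \<psi>) \<in> atlas N"
  have "smooth_on (\<phi> ` (U \<inter> {p \<in> topspace (mtop M). f p \<in> W})) ((\<psi> \<circ> f) \<circ> inv_into U \<phi>)"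
    using assms(3)[OF c(2)] c(1) unfolding smooth_fun_def by blast
  moreover have "U \<inter> {p \<in> topspace (mtop M). f p \<in> W} = {p \<in> U. f p \<in> W}"
    using chart_subset[OF M c(1)] by blast
  ultimately show "smooth_on (\<phi> ` {p \<in> U. f p \<in> W}) (\<psi> \<circ> f \<circ> inv_into U \<phi>)" by simp
qed

lemma smooth_map_chart:
  assumes M: "charted M" and N: "charted N" and f: "smooth_map M N f" and c: "(W, \<psi>) \<in> atlas N"
  shows "smooth_fun M {p \<in> topspace (mtop M). f p \<in> W} (\<psi> \<circ> f)"
  unfolding smooth_fun_def
proof (intro conjI allI impI)
  show "openin (mtop M) {p \<in> topspace (mtop M). f p \<in> W}"
    using f chart_openin[OF N c] openin_continuous_map_preimage unfolding smooth_map_def by blast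
  fix U \<phi> assume d: "(U, \<phi>) \<in> atlas M"
  have "U \<inter> {p \<in> topspace (mtop M). f p \<in> W} = {p \<in> U. f p \<in> W}"
    using chart_subset[OF M d] by blast
  then show "smooth_on (\<phi> ` (U \<inter> {p \<in> topspace (mtop M). f p \<in> W})) (\<psi> \<circ> f \<circ> inv_into U \<phi>)"
    using f c d unfolding smooth_map_def by fastforce
qed

lemma smooth_map_continuous_map: "smooth_map M N f \<Longrightarrow> continuous_map (mtop M) (mtop N) f"
  unfolding smooth_map_def by blast

lemma smooth_fun_pullback:
  assumes M: "charted M" and N: "charted N" and F: "smooth_map M N F" and k: "smooth_fun N W k"
  shows "smooth_fun M {p \<in> topspace (mtop M). F p \<in> W} (k \<circ> F)"
proof (rule smooth_fun_local[OF M])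
  have W: "openin (mtop N) W" using k smooth_fun_def by blast
  have F': "continuous_map (mtop M) (mtop N) F" using F by (rule smooth_map_continuous_map)
  show "openin (mtop M) {p \<in> topspace (mtop M). F p \<in> W}"
    using openin_continuous_map_preimage[OF F' W] .
  fix p assume p: "p \<in> {p \<in> topspace (mtop M). F p \<in> W}"
  then obtain U \<phi> where c: "(U, \<phi>) \<in> atlas M" "p \<in> U" using charted_cover[OF M] by blast
  have "F p \<in> topspace (mtop N)" using p W openin_subset by blast
  then obtain V \<psi> where d: "(V, \<psi>) \<in> atlas N" "F p \<in> V" using charted_cover[OF N] by blast
  let ?W = "{p \<in> topspace (mtop M). F p \<in> V \<inter> W}"
  have "openin (mtop M) ?W"
    using openin_continuous_map_preimage[OF F'] W chart_openin[OF N d(1)] by blast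
  moreover have "smooth_on (\<phi> ` (U \<inter> ?W)) (k \<circ> F \<circ> inv_into U \<phi>)"
  proof (rule smooth_on_cong)
    have "smooth_on (\<phi> ` (U \<inter> ?W)) (\<psi> \<circ> F \<circ> inv_into U \<phi>)"
      using smooth_map_chart[OF M N F d(1)] c unfolding smooth_fun_def
      by (auto elim!: allE[of _ U] allE[of _ \<phi>] intro: smooth_on_subset)
    moreover have "smooth_on (\<psi> ` (V \<inter> W)) (k \<circ> inv_into V \<psi>)"
      using k d unfolding smooth_fun_def by blast
    ultimately show "smooth_on (\<phi> ` (U \<inter> ?W)) ((k \<circ> inv_into V \<psi>) \<circ> (\<psi> \<circ> F \<circ> inv_into U \<phi>))"
      by (rule smooth_on_compose') (use chart_inv[OF M c(1)] in auto)
  qed (use chart_inv[OF M c(1)] chart_inv[OF N d(1)] in auto)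
  ultimately show "\<exists>U \<phi> W'. (U, \<phi>) \<in> atlas M \<and> p \<in> U \<and> p \<in> W' \<and> openin (mtop M) W' \<and>
       smooth_on (\<phi> ` (U \<inter> W')) (k \<circ> F \<circ> inv_into U \<phi>)"
    using c p d by (intro exI[of _ U] exI[of _ \<phi>] exI[of _ ?W]) blast
qed

lemma smooth_near_pullback:
  assumes "charted M" "charted N" "smooth_map M N F" "smooth_near N (F p) f" "p \<in> topspace (mtop M)"
  shows "smooth_near M p (f \<circ> F)"
proof -
  obtain W where W: "F p \<in> W" "smooth_fun N W f" using assms(4) unfolding smooth_near_iff by blast
  have "p \<in> {p \<in> topspace (mtop M). F p \<in> W}" using W(1) assms(5) by blast
  moreover have "smooth_fun M {p \<in> topspace (mtop M). F p \<in> W} (f \<circ> F)"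
    by (rule smooth_fun_pullback[OF assms(1,2,3) W(2)])
  ultimately show ?thesis unfolding smooth_near_iff by (intro exI conjI)
qed

lemma smooth_map_compose:
  assumes M: "charted M" and N: "charted N" and P: "charted P"
    and F: "smooth_map M N F" and G: "smooth_map N P G"
  shows "smooth_map M P (G \<circ> F)"
proof (rule smooth_mapI[OF P _ _ M])
  show "continuous_map (mtop M) (mtop P) (G \<circ> F)"
    by (rule continuous_map_compose[OF smooth_map_continuous_map[OF F] smooth_map_continuous_map[OF G]])
  fix W \<psi> assume c: "(W, \<psi>) \<in> atlas P"
  have "smooth_fun M {p \<in> topspace (mtop M). F p \<in> {q \<in> topspace (mtop N). G q \<in> W}} ((\<psi> \<circ> G) \<circ> F)"
    by (rule smooth_fun_pullback[OF M N F smooth_map_chart[OF N P G c]])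
  moreover have "{p \<in> topspace (mtop M). F p \<in> {q \<in> topspace (mtop N). G q \<in> W}}
      = {p \<in> topspace (mtop M). (G \<circ> F) p \<in> W}"
    using smooth_map_continuous_map[OF F] by (auto simp: continuous_map_def)
  ultimately show "smooth_fun M {p \<in> topspace (mtop M). (G \<circ> F) p \<in> W} (\<psi> \<circ> (G \<circ> F))"
    by (simp add: comp_assoc)
qed

lemma smooth_map_const:
  assumes "charted M" "charted N" "c \<in> topspace (mtop N)"
  shows "smooth_map M N (\<lambda>p. c)"
proof (rule smooth_mapI[OF assms(2) _ _ assms(1)])
  show "continuous_map (mtop M) (mtop N) (\<lambda>p. c)" using assms by simp
  fix W \<psi>
  show "smooth_fun M {p \<in> topspace (mtop M). c \<in> W} (\<psi> \<circ> (\<lambda>p. c))"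
    unfolding comp_def by (rule smooth_fun_const) (cases "c \<in> W"; simp)
qed

lemma smooth_map_ident: "charted M \<Longrightarrow> smooth_map M M (\<lambda>p. p)"
proof (rule smooth_mapI)
  fix W \<psi> assume M: "charted M" and c: "(W, \<psi>) \<in> atlas M"
  have e: "{p \<in> topspace (mtop M). p \<in> W} = W" using chart_subset[OF M c] by blast
  show "smooth_fun M {p \<in> topspace (mtop M). p \<in> W} (\<psi> \<circ> (\<lambda>p. p))"
    unfolding e using charted_transition[OF M _ c] chart_openin[OF M c] by (simp add: smooth_fun_def comp_def)
qed auto

section \<open>Products of manifolds\<close>

lemma inv_into_map_prod:
  assumes "inj_on \<phi> U" "inj_on \<psi> W" "a \<in> U" "b \<in> W"
  shows "inv_into (U \<times> W) (map_prod \<phi> \<psi>) (\<phi> a, \<psi> b) = (a, b)"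
proof -
  have "inj_on (map_prod \<phi> \<psi>) (U \<times> W)" using assms by (simp add: map_prod_inj_on)
  then show ?thesis using inv_into_f_f[of "map_prod \<phi> \<psi>" "U \<times> W" "(a, b)"] assms by simp
qed

lemma prod_manifold_atlasE:
  assumes "(D, \<Phi>) \<in> atlas (prod_manifold M N)"
  obtains U \<phi> W \<psi> where "D = U \<times> W" "\<Phi> = map_prod \<phi> \<psi>" "(U, \<phi>) \<in> atlas M" "(W, \<psi>) \<in> atlas N"
  using assms unfolding prod_manifold_def by auto

lemma prod_manifold_atlasI:
  "(U, \<phi>) \<in> atlas M \<Longrightarrow> (W, \<psi>) \<in> atlas N \<Longrightarrow> (U \<times> W, map_prod \<phi> \<psi>) \<in> atlas (prod_manifold M N)"
  unfolding prod_manifold_def by auto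

lemma mtop_prod_manifold [simp]: "mtop (prod_manifold M N) = prod_topology (mtop M) (mtop N)"
  unfolding prod_manifold_def by simp

lemma charted_prod_manifold:
  assumes M: "charted M" and N: "charted N"
  shows "charted (prod_manifold M N)"
  unfolding charted_def
proof (intro conjI allI impI)
  show "\<Union> (fst ` atlas (prod_manifold M N)) = topspace (mtop (prod_manifold M N))"
  proof (intro equalityI subsetI)
    fix z assume "z \<in> \<Union> (fst ` atlas (prod_manifold M N))"
    then obtain D \<Phi> where "(D, \<Phi>) \<in> atlas (prod_manifold M N)" "z \<in> D" by force
    then show "z \<in> topspace (mtop (prod_manifold M N))"
      using chart_subset[OF M] chart_subset[OF N] by (elim prod_manifold_atlasE) fastforce
  next
    fix z assume "z \<in> topspace (mtop (prod_manifold M N))"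
    then have "fst z \<in> topspace (mtop M)" "snd z \<in> topspace (mtop N)" by auto
    then obtain U \<phi> W \<psi> where "(U, \<phi>) \<in> atlas M" "(W, \<psi>) \<in> atlas N" "fst z \<in> U" "snd z \<in> W"
      using charted_cover[OF M] charted_cover[OF N] by metis
    then show "z \<in> \<Union> (fst ` atlas (prod_manifold M N))"
      using prod_manifold_atlasI[of U \<phi> M W \<psi> N] by (force simp: mem_Times_iff)
  qed
next
  fix D \<Phi> assume "(D, \<Phi>) \<in> atlas (prod_manifold M N)"
  then obtain U \<phi> W \<psi> where D: "D = U \<times> W" "\<Phi> = map_prod \<phi> \<psi>" and c: "(U, \<phi>) \<in> atlas M" "(W, \<psi>) \<in> atlas N"
    by (rule prod_manifold_atlasE)
  show "openin (mtop (prod_manifold M N)) D"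
    using chart_openin[OF M c(1)] chart_openin[OF N c(2)] by (simp add: D openin_prod_Times_iff)
  obtain E E' where E: "subspace E" "openin (top_of_set E) (\<phi> ` U)" "subspace E'" "openin (top_of_set E') (\<psi> ` W)"
    using chart_range[OF M c(1)] chart_range[OF N c(2)] by metis
  have im: "\<Phi> ` D = \<phi> ` U \<times> \<psi> ` W" by (simp add: D map_prod_surj_on)
  show "\<exists>E. subspace E \<and> openin (top_of_set E) (\<Phi> ` D)"
    using E by (intro exI[of _ "E \<times> E'"]) (simp add: im subspace_Times openin_Times)
  obtain f g where fg: "homeomorphic_maps (subtopology (mtop M) U) (top_of_set (\<phi> ` U)) \<phi> f"
     "homeomorphic_maps (subtopology (mtop N) W) (top_of_set (\<psi> ` W)) \<psi> g"
    using chart_homeomorphic_map[OF M c(1)] chart_homeomorphic_map[OF N c(2)] homeomorphic_map_maps by metis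
  have "homeomorphic_maps (subtopology (mtop (prod_manifold M N)) D) (top_of_set (\<Phi> ` D)) (\<lambda>(x,y). (\<phi> x, \<psi> y)) (\<lambda>(x,y). (f x, g y))"
    unfolding im unfolding D(1) mtop_prod_manifold subtopology_Times prod_topology_subtopology_eu[symmetric]
    using fg by (simp only: homeomorphic_maps_prod simp_thms)
  then show "homeomorphic_map (subtopology (mtop (prod_manifold M N)) D) (top_of_set (\<Phi> ` D)) \<Phi>"
    unfolding homeomorphic_map_maps D(2) map_prod_def by blast
next
  fix D \<Phi> D' \<Phi>'
  assume "(D, \<Phi>) \<in> atlas (prod_manifold M N)" "(D', \<Phi>') \<in> atlas (prod_manifold M N)"
  then obtain U \<phi> W \<psi> U' \<phi>' W' \<psi>' where D: "D = U \<times> W" "\<Phi> = map_prod \<phi> \<psi>" and c: "(U, \<phi>) \<in> atlas M" "(W, \<psi>) \<in> atlas N"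
    and D': "D' = U' \<times> W'" "\<Phi>' = map_prod \<phi>' \<psi>'" and c': "(U', \<phi>') \<in> atlas M" "(W', \<psi>') \<in> atlas N"
    by (elim prod_manifold_atlasE) metis
  show "smooth_on (\<Phi> ` (D \<inter> D')) (\<Phi>' \<circ> inv_into D \<Phi>)"
  proof (rule smooth_on_cong)
    have "smooth_on (\<Phi> ` (D \<inter> D')) (\<lambda>z. (\<phi>' \<circ> inv_into U \<phi>) (fst z))"
      by (rule smooth_on_compose[OF smooth_on_fst[OF smooth_on_ident] charted_transition[OF M c(1) c'(1)]])
        (auto simp: D D')
    moreover have "smooth_on (\<Phi> ` (D \<inter> D')) (\<lambda>z. (\<psi>' \<circ> inv_into W \<psi>) (snd z))"
      by (rule smooth_on_compose[OF smooth_on_snd[OF smooth_on_ident] charted_transition[OF N c(2) c'(2)]])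
        (auto simp: D D')
    ultimately show "smooth_on (\<Phi> ` (D \<inter> D')) (\<lambda>z. ((\<phi>' \<circ> inv_into U \<phi>) (fst z), (\<psi>' \<circ> inv_into W \<psi>) (snd z)))"
      by (rule smooth_on_Pair)
    fix z assume "z \<in> \<Phi> ` (D \<inter> D')"
    then obtain a b where "a \<in> U" "b \<in> W" "z = (\<phi> a, \<psi> b)" by (auto simp: D D')
    then show "((\<phi>' \<circ> inv_into U \<phi>) (fst z), (\<psi>' \<circ> inv_into W \<psi>) (snd z)) = (\<Phi>' \<circ> inv_into D \<Phi>) z"
      by (simp add: D D' inv_into_map_prod chart_inj_on[OF M c(1)] chart_inj_on[OF N c(2)])
  qed
qed

lemma smooth_map_fst:
  assumes M: "charted M" and N: "charted N"
  shows "smooth_map (prod_manifold M N) M fst"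
proof (rule smooth_mapI[OF M _ _ charted_prod_manifold[OF M N]])
  show "continuous_map (mtop (prod_manifold M N)) (mtop M) fst" by (simp add: continuous_map_fst)
  fix U' \<phi>' assume c': "(U', \<phi>') \<in> atlas M"
  show "smooth_fun (prod_manifold M N) {p \<in> topspace (mtop (prod_manifold M N)). fst p \<in> U'} (\<phi>' \<circ> fst)"
    unfolding smooth_fun_def
  proof (intro conjI allI impI)
    have e: "{p \<in> topspace (mtop (prod_manifold M N)). fst p \<in> U'} = U' \<times> topspace (mtop N)"
      using chart_subset[OF M c'] by auto
    show "openin (mtop (prod_manifold M N)) {p \<in> topspace (mtop (prod_manifold M N)). fst p \<in> U'}"
      unfolding e using chart_openin[OF M c'] by (simp add: openin_prod_Times_iff)
    fix D \<Phi> assume "(D, \<Phi>) \<in> atlas (prod_manifold M N)"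
    then obtain U \<phi> W \<psi> where D: "D = U \<times> W" "\<Phi> = map_prod \<phi> \<psi>" and c: "(U, \<phi>) \<in> atlas M" "(W, \<psi>) \<in> atlas N"
      by (rule prod_manifold_atlasE)
    have sub: "\<Phi> ` (D \<inter> {p \<in> topspace (mtop (prod_manifold M N)). fst p \<in> U'}) \<subseteq> map_prod \<phi> \<psi> ` ((U \<inter> U') \<times> W)"
      unfolding D by (intro image_mono) auto
    show "smooth_on (\<Phi> ` (D \<inter> {p \<in> topspace (mtop (prod_manifold M N)). fst p \<in> U'})) (\<phi>' \<circ> fst \<circ> inv_into D \<Phi>)"
    proof (rule smooth_on_subset[OF _ sub], rule smooth_on_cong)
      show "smooth_on (map_prod \<phi> \<psi> ` ((U \<inter> U') \<times> W)) (\<lambda>z. (\<phi>' \<circ> inv_into U \<phi>) (fst z))"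
        by (rule smooth_on_compose[OF smooth_on_fst[OF smooth_on_ident] charted_transition[OF M c(1) c']]) auto
    qed (auto simp: D inv_into_map_prod chart_inj_on[OF M c(1)] chart_inj_on[OF N c(2)])
  qed
qed

lemma smooth_map_snd:
  assumes M: "charted M" and N: "charted N"
  shows "smooth_map (prod_manifold M N) N snd"
proof (rule smooth_mapI[OF N _ _ charted_prod_manifold[OF M N]])
  show "continuous_map (mtop (prod_manifold M N)) (mtop N) snd" by (simp add: continuous_map_snd)
  fix W' \<psi>' assume c': "(W', \<psi>') \<in> atlas N"
  show "smooth_fun (prod_manifold M N) {p \<in> topspace (mtop (prod_manifold M N)). snd p \<in> W'} (\<psi>' \<circ> snd)"
    unfolding smooth_fun_def
  proof (intro conjI allI impI)
    have e: "{p \<in> topspace (mtop (prod_manifold M N)). snd p \<in> W'} = topspace (mtop M) \<times> W'"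
      using chart_subset[OF N c'] by auto
    show "openin (mtop (prod_manifold M N)) {p \<in> topspace (mtop (prod_manifold M N)). snd p \<in> W'}"
      unfolding e using chart_openin[OF N c'] by (simp add: openin_prod_Times_iff)
    fix D \<Phi> assume "(D, \<Phi>) \<in> atlas (prod_manifold M N)"
    then obtain U \<phi> W \<psi> where D: "D = U \<times> W" "\<Phi> = map_prod \<phi> \<psi>" and c: "(U, \<phi>) \<in> atlas M" "(W, \<psi>) \<in> atlas N"
      by (rule prod_manifold_atlasE)
    have sub: "\<Phi> ` (D \<inter> {p \<in> topspace (mtop (prod_manifold M N)). snd p \<in> W'}) \<subseteq> map_prod \<phi> \<psi> ` (U \<times> (W \<inter> W'))"
      unfolding D by (intro image_mono) auto
    show "smooth_on (\<Phi> ` (D \<inter> {p \<in> topspace (mtop (prod_manifold M N)). snd p \<in> W'})) (\<psi>' \<circ> snd \<circ> inv_into D \<Phi>)"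
    proof (rule smooth_on_subset[OF _ sub], rule smooth_on_cong)
      show "smooth_on (map_prod \<phi> \<psi> ` (U \<times> (W \<inter> W'))) (\<lambda>z. (\<psi>' \<circ> inv_into W \<psi>) (snd z))"
        by (rule smooth_on_compose[OF smooth_on_snd[OF smooth_on_ident] charted_transition[OF N c(2) c']]) auto
    qed (auto simp: D inv_into_map_prod chart_inj_on[OF M c(1)] chart_inj_on[OF N c(2)])
  qed
qed

lemma smooth_map_Pair:
  assumes M: "charted M" and N: "charted N" and P: "charted P"
    and f: "smooth_map M N f" and g: "smooth_map M P g"
  shows "smooth_map M (prod_manifold N P) (\<lambda>p. (f p, g p))"
proof (rule smooth_mapI[OF charted_prod_manifold[OF N P] _ _ M])
  show "continuous_map (mtop M) (mtop (prod_manifold N P)) (\<lambda>p. (f p, g p))"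
    using smooth_map_continuous_map[OF f] smooth_map_continuous_map[OF g]
    by (simp add: continuous_map_pairedI)
  fix D \<Phi> assume "(D, \<Phi>) \<in> atlas (prod_manifold N P)"
  then obtain U \<phi> W \<psi> where D: "D = U \<times> W" "\<Phi> = map_prod \<phi> \<psi>" and c: "(U, \<phi>) \<in> atlas N" "(W, \<psi>) \<in> atlas P"
    by (rule prod_manifold_atlasE)
  have fg: "smooth_fun M {p \<in> topspace (mtop M). f p \<in> U} (\<phi> \<circ> f)"
     "smooth_fun M {p \<in> topspace (mtop M). g p \<in> W} (\<psi> \<circ> g)"
    using smooth_map_chart[OF M N f c(1)] smooth_map_chart[OF M P g c(2)] by auto
  let ?S = "{p \<in> topspace (mtop M). (f p, g p) \<in> D}"
  have e: "?S = {p \<in> topspace (mtop M). f p \<in> U} \<inter> {p \<in> topspace (mtop M). g p \<in> W}"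
    by (auto simp: D)
  have o: "openin (mtop M) ?S" unfolding e using fg unfolding smooth_fun_def by blast
  have "smooth_fun M ?S (\<lambda>p. ((\<phi> \<circ> f) p, (\<psi> \<circ> g) p))"
    by (intro smooth_fun_Pair smooth_fun_subset[OF fg(1) o] smooth_fun_subset[OF fg(2) o]) (auto simp: D)
  then show "smooth_fun M ?S (\<Phi> \<circ> (\<lambda>p. (f p, g p)))" by (simp add: D comp_def)
qed

section \<open>Submanifolds and their tangent spaces\<close>

lemma mtop_submanifold [simp]: "mtop (submanifold S) = top_of_set S"
  unfolding submanifold_def by simp

lemma submanifold_atlas:
  "(U, \<phi>) \<in> atlas (submanifold S) \<longleftrightarrow> openin (top_of_set S) U \<and>
     (\<exists>E. subspace E \<and> openin (top_of_set E) (\<phi> ` U)) \<and>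
     inj_on \<phi> U \<and> smooth_on U \<phi> \<and> smooth_on (\<phi> ` U) (inv_into U \<phi>)"
  unfolding submanifold_def by simp

text \<open>Says that \<open>S\<close> is an embedded submanifold whose dimension may still vary
  from point to point; \<open>smooth_manifold\<close> demands in addition one common
  dimension.\<close>

definition has_charts :: "'a::euclidean_space set \<Rightarrow> bool" where
  "has_charts S \<longleftrightarrow> (\<forall>p\<in>S. \<exists>U \<phi>. (U, \<phi>) \<in> atlas (submanifold S) \<and> p \<in> U)"

lemma charted_submanifold:
  assumes "has_charts S" shows "charted (submanifold S)"
  unfolding charted_def
proof (intro conjI allI impI)
  have "U \<subseteq> S" if "(U, \<phi>) \<in> atlas (submanifold S)" for U \<phi>
    using that openin_imp_subset unfolding submanifold_atlas by blast
  then show "\<Union> (fst ` atlas (submanifold S)) = topspace (mtop (submanifold S))"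
    using assms unfolding has_charts_def by (auto; force)
next
  fix U \<phi> assume c: "(U, \<phi>) \<in> atlas (submanifold S)"
  then show o: "openin (mtop (submanifold S)) U" "\<exists>E. subspace E \<and> openin (top_of_set E) (\<phi> ` U)"
    unfolding submanifold_atlas by auto
  have "subtopology (mtop (submanifold S)) U = top_of_set U"
    using openin_imp_subset[of euclidean S U] o(1) by (simp add: subtopology_subtopology inf.absorb2)
  moreover have "homeomorphic_maps (top_of_set U) (top_of_set (\<phi> ` U)) \<phi> (inv_into U \<phi>)"
    using c unfolding submanifold_atlas homeomorphic_maps_def
    by (auto simp: continuous_map_in_subtopology smooth_on_imp_continuous_on inv_into_into)
  ultimately show "homeomorphic_map (subtopology (mtop (submanifold S)) U) (top_of_set (\<phi> ` U)) \<phi>"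
    unfolding homeomorphic_map_maps by auto
next
  fix U \<phi> W \<psi> assume c: "(U, \<phi>) \<in> atlas (submanifold S)" "(W, \<psi>) \<in> atlas (submanifold S)"
  then have "smooth_on (\<phi> ` (U \<inter> W)) (inv_into U \<phi>)" "smooth_on W \<psi>" "inj_on \<phi> U"
    unfolding submanifold_atlas using smooth_on_subset[of "\<phi> ` U" _ "\<phi> ` (U \<inter> W)"] by blast+
  then show "smooth_on (\<phi> ` (U \<inter> W)) (\<psi> \<circ> inv_into U \<phi>)"
    by (intro smooth_on_compose'[of _ _ W]) auto
qed

lemma identity_chart:
  assumes "subspace E" "openin (top_of_set E) S"
  shows "(S, \<lambda>x. x) \<in> atlas (submanifold S)"
proof -
  have "smooth_on S (inv_into S (\<lambda>x. x))"
    by (rule smooth_on_cong[OF _ smooth_on_ident]) (metis inj_on_def inv_into_f_f)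
  then show ?thesis
    using assms unfolding submanifold_atlas by (auto intro!: smooth_on_ident)
qed

lemma has_charts_openin: "subspace E \<Longrightarrow> openin (top_of_set E) S \<Longrightarrow> has_charts S"
  unfolding has_charts_def using identity_chart by blast

lemma has_charts_subspace: "subspace V \<Longrightarrow> has_charts V"
  by (rule has_charts_openin[of V]) auto

lemma has_charts_open: "open U \<Longrightarrow> has_charts U"
  by (rule has_charts_openin[of UNIV]) auto

text \<open>Charts of a submanifold and their inverses are smooth in the ambient sense, so composing
  with them neither creates nor destroys smoothness. From here on functions on submanifolds are
  treated without charts.\<close>

lemma smooth_fun_submanifold:
  assumes "has_charts S"
  shows "smooth_fun (submanifold S) W k \<longleftrightarrow> openin (top_of_set S) W \<and> smooth_on W k"
proof
  note ch = charted_submanifold[OF assms]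
  assume k: "smooth_fun (submanifold S) W k"
  then have W: "openin (top_of_set S) W" unfolding smooth_fun_def by simp
  have "smooth_on W k"
  proof (rule smooth_on_local)
    fix p assume p: "p \<in> W"
    then have "p \<in> topspace (mtop (submanifold S))" using W openin_imp_subset by auto
    then obtain U \<phi> where c: "(U, \<phi>) \<in> atlas (submanifold S)" "p \<in> U" using charted_cover[OF ch] by blast
    have "smooth_on (U \<inter> W) \<phi>"
      by (rule smooth_on_subset[of U]) (use c in \<open>auto simp: submanifold_atlas\<close>)
    moreover have "smooth_on (\<phi> ` (U \<inter> W)) (k \<circ> inv_into U \<phi>)" using k c unfolding smooth_fun_def by blast
    ultimately have "smooth_on (U \<inter> W) ((k \<circ> inv_into U \<phi>) \<circ> \<phi>)" by (rule smooth_on_compose') auto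
    then have "smooth_on (U \<inter> W) k"
      by (rule smooth_on_cong[rotated]) (use chart_inv[OF ch c(1)] in auto)
    moreover have "openin (top_of_set W) (U \<inter> W)"
    proof (rule openin_subset_trans[of S])
      have "openin (top_of_set S) U" using c unfolding submanifold_atlas by blast
      then show "openin (top_of_set S) (U \<inter> W)" using W by blast
    qed (use W openin_imp_subset in auto)
    ultimately show "\<exists>W'. openin (top_of_set W) W' \<and> p \<in> W' \<and> smooth_on W' k" using p c by blast
  qed
  then show "openin (top_of_set S) W \<and> smooth_on W k" using W by blast
next
  assume k: "openin (top_of_set S) W \<and> smooth_on W k"
  show "smooth_fun (submanifold S) W k"
    unfolding smooth_fun_def
  proof (intro conjI allI impI)
    show "openin (mtop (submanifold S)) W" using k by simp
    fix U \<phi> assume c: "(U, \<phi>) \<in> atlas (submanifold S)"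
    then have "smooth_on (\<phi> ` (U \<inter> W)) (inv_into U \<phi>)" "inj_on \<phi> U"
      unfolding submanifold_atlas using smooth_on_subset[of "\<phi> ` U" _ "\<phi> ` (U \<inter> W)"] by blast+
    then show "smooth_on (\<phi> ` (U \<inter> W)) (k \<circ> inv_into U \<phi>)"
      using k by (intro smooth_on_compose'[of _ _ W]) auto
  qed
qed

text \<open>Charts of \<open>S\<close> extend locally to ambient smooth maps, so a map into
  \<open>S\<close> can be tested as a map into the surrounding Euclidean space.\<close>

lemma smooth_map_into_submanifold:
  assumes M: "charted M" and S: "has_charts S"
  shows "smooth_map M (submanifold S) k \<longleftrightarrow>
    smooth_fun M (topspace (mtop M)) k \<and> k ` topspace (mtop M) \<subseteq> S"
proof
  assume k: "smooth_map M (submanifold S) k"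
  have c: "continuous_map (mtop M) (top_of_set S) k" using smooth_map_continuous_map[OF k] by simp
  then have kS: "k ` topspace (mtop M) \<subseteq> S" by (auto simp: continuous_map_in_subtopology)
  have "smooth_fun (submanifold S) S (\<lambda>x. x)"
    unfolding smooth_fun_submanifold[OF S] by (simp add: smooth_on_ident)
  then have "smooth_fun M {p \<in> topspace (mtop M). k p \<in> S} ((\<lambda>x. x) \<circ> k)"
    by (rule smooth_fun_pullback[OF M charted_submanifold[OF S] k])
  moreover have "{p \<in> topspace (mtop M). k p \<in> S} = topspace (mtop M)" using kS by blast
  ultimately show "smooth_fun M (topspace (mtop M)) k \<and> k ` topspace (mtop M) \<subseteq> S"
    using kS by (simp add: comp_def)
next
  assume k: "smooth_fun M (topspace (mtop M)) k \<and> k ` topspace (mtop M) \<subseteq> S"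
  show "smooth_map M (submanifold S) k"
  proof (rule smooth_mapI[OF charted_submanifold[OF S] _ _ M])
    show cont: "continuous_map (mtop M) (mtop (submanifold S)) k"
      using smooth_fun_continuous_map[OF M conjunct1[OF k]] k
      by (simp add: continuous_map_in_subtopology image_subset_iff_funcset)
    fix W \<psi> assume c: "(W, \<psi>) \<in> atlas (submanifold S)"
    then have W: "openin (mtop (submanifold S)) W" "smooth_on W \<psi>" unfolding submanifold_atlas by auto
    have o: "openin (mtop M) {p \<in> topspace (mtop M). k p \<in> W}"
      by (rule openin_continuous_map_preimage[OF cont W(1)])
    show "smooth_fun M {p \<in> topspace (mtop M). k p \<in> W} (\<psi> \<circ> k)"
      unfolding comp_def
      by (rule smooth_fun_compose[OF M smooth_fun_subset[OF conjunct1[OF k] o] W(2)]) auto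
  qed
qed

lemma smooth_map_submanifolds:
  assumes "has_charts S" "has_charts T"
  shows "smooth_map (submanifold S) (submanifold T) k \<longleftrightarrow> smooth_on S k \<and> k ` S \<subseteq> T"
  by (simp add: smooth_map_into_submanifold[OF charted_submanifold[OF assms(1)] assms(2)]
      smooth_fun_submanifold[OF assms(1)])

section \<open>Curves and their velocities\<close>

lemma charted_interval: "charted (submanifold {-e<..<e::real})"
  by (rule charted_submanifold[OF has_charts_open]) simp

lemma smooth_fun_along_curve:
  fixes \<gamma> :: "real \<Rightarrow> 'a"
  assumes M: "charted M" and \<gamma>: "smooth_map (submanifold {-e<..<e}) M \<gamma>" "e > 0"
    and k: "smooth_fun M W k" "\<gamma> 0 \<in> W"
  obtains d where "d > 0" "d \<le> e" "smooth_on {-d<..<d} (\<lambda>t. k (\<gamma> t))" "\<gamma> ` {-d<..<d} \<subseteq> W"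
proof -
  have h: "has_charts {-e<..<e}" by (rule has_charts_open) simp
  let ?J = "{t \<in> {-e<..<e}. \<gamma> t \<in> W}"
  have "smooth_fun (submanifold {-e<..<e}) {t \<in> topspace (mtop (submanifold {-e<..<e})). \<gamma> t \<in> W} (k \<circ> \<gamma>)"
    by (rule smooth_fun_pullback[OF charted_interval M \<gamma>(1) k(1)])
  then have J: "openin (top_of_set {-e<..<e}) ?J" "smooth_on ?J (\<lambda>t. k (\<gamma> t))"
    by (simp_all add: smooth_fun_submanifold[OF h] comp_def)
  then have "open ?J" by (metis open_greaterThanLessThan openin_open_eq)
  moreover have "0 \<in> ?J" using k \<gamma> by simp
  ultimately obtain d where d: "d > 0" "ball 0 d \<subseteq> ?J" using open_contains_ball by blast
  then have sub: "{-min d e<..<min d e} \<subseteq> ?J" by (auto simp: subset_iff dist_real_def)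
  show ?thesis
  proof (rule that[of "min d e"])
    show "smooth_on {-min d e<..<min d e} (\<lambda>t. k (\<gamma> t))" by (rule smooth_on_subset[OF J(2) sub])
    show "\<gamma> ` {-min d e<..<min d e} \<subseteq> W" using sub by blast
  qed (use d \<gamma> in auto)
qed

lemma smooth_on_interval_has_vector_derivative:
  assumes "smooth_on {-e<..<e::real} f" "e > 0"
  shows "(f has_vector_derivative vector_derivative f (at 0)) (at 0)"
proof -
  have "(f has_derivative frechet_derivative f (at 0)) (at 0)"
    by (rule smooth_on_has_derivative[OF _ assms(1)]) (use assms in auto)
  then show ?thesis using differentiable_def vector_derivative_works by blast
qed

lemma velocity_cong:
  assumes "d > 0" "\<And>t. t \<in> {-d<..<d} \<Longrightarrow> \<gamma> t = \<gamma>' t"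
  shows "velocity M \<gamma> = velocity M \<gamma>'"
proof -
  have "\<forall>\<^sub>F t in nhds 0. f (\<gamma> t) = f (\<gamma>' t)" for f :: "'a \<Rightarrow> real"
    using assms by (intro eventually_nhds[THEN iffD2] exI[of _ "{-d<..<d}"]) auto
  then have "deriv (\<lambda>t. f (\<gamma> t)) 0 = deriv (\<lambda>t. f (\<gamma>' t)) 0" for f :: "'a \<Rightarrow> real"
    by (intro deriv_cong_ev) auto
  moreover have "\<gamma> 0 = \<gamma>' 0" using assms by auto
  ultimately show ?thesis unfolding velocity_def by auto
qed

section \<open>Tangent spaces of submanifolds as spaces of ambient vectors\<close>

definition tangent_vectors :: "'a::euclidean_space set \<Rightarrow> 'a \<Rightarrow> 'a set" where
  "tangent_vectors S p = {u. \<exists>\<gamma> e. e > 0 \<and> smooth_on {-e<..<e::real} \<gamma> \<and> \<gamma> ` {-e<..<e} \<subseteq> S \<and>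
     \<gamma> 0 = p \<and> (\<gamma> has_vector_derivative u) (at 0)}"

text \<open>A function on \<open>S\<close> has no Frechet derivative of its own; one extension to a
  neighbourhood of \<open>p\<close> is chosen for each \<open>f\<close>. Different extensions have
  the same derivative along tangent vectors.\<close>

definition smooth_ext :: "'a::euclidean_space set \<Rightarrow> 'a \<Rightarrow> ('a \<Rightarrow> real) \<Rightarrow> 'a \<Rightarrow> real" where
  "smooth_ext S p f = (SOME F. \<exists>U. open U \<and> p \<in> U \<and> smooth_on U F \<and> (\<forall>y\<in>U \<inter> S. F y = f y))"

text \<open>Curves with the same derivative \<open>u\<close> at \<open>p\<close> have the same velocity, the directional derivative
  \<open>tvec S p u\<close>; this identifies the abstract tangent space with a set of vectors.\<close>

definition tvec :: "'a::euclidean_space set \<Rightarrow> 'a \<Rightarrow> 'a \<Rightarrow> ('a \<Rightarrow> real) \<Rightarrow> real" where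
  "tvec S p u = (\<lambda>f. if smooth_near (submanifold S) p f
     then frechet_derivative (smooth_ext S p f) (at p) u else 0)"

lemma smooth_near_submanifold:
  "has_charts S \<Longrightarrow> smooth_near (submanifold S) p f \<longleftrightarrow>
    (\<exists>W. p \<in> W \<and> openin (top_of_set S) W \<and> smooth_on W f)"
  unfolding smooth_near_iff by (simp add: smooth_fun_submanifold)

lemma smooth_ext:
  assumes S: "has_charts S" and f: "smooth_near (submanifold S) p f"
  obtains U where "open U" "p \<in> U" "smooth_on U (smooth_ext S p f)" "\<And>y. y \<in> U \<Longrightarrow> y \<in> S \<Longrightarrow> smooth_ext S p f y = f y"
proof -
  obtain W where W: "p \<in> W" "openin (top_of_set S) W" "smooth_on W f"
    using f smooth_near_submanifold[OF S] by blast
  obtain Q where Q: "open Q" "W = S \<inter> Q" using W(2) by (auto simp: openin_open)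
  obtain U F where U: "open U" "p \<in> U" "smooth_on U F" "\<And>y. y \<in> U \<Longrightarrow> y \<in> W \<Longrightarrow> F y = f y"
    using smooth_on_extension[OF W(3,1)] by blast
  have "smooth_on (U \<inter> Q) F" by (rule smooth_on_subset[OF U(3)]) auto
  then have "\<exists>F U. open U \<and> p \<in> U \<and> smooth_on U F \<and> (\<forall>y\<in>U \<inter> S. F y = f y)"
    using U Q W by (intro exI[of _ F] exI[of _ "U \<inter> Q"]) auto
  from someI_ex[OF this] show ?thesis using that unfolding smooth_ext_def[symmetric] by blast
qed

text \<open>Holds for all ambient vectors, tangent or not, because one fixed extension of
  \<open>f\<close> is differentiated. Sums of velocities thereby become sums of vectors.\<close>

lemma tvec_linear:
  assumes "has_charts S"
  shows "tvec S p (u + v) = (\<lambda>f. tvec S p u f + tvec S p v f)" "tvec S p (c *\<^sub>R u) = (\<lambda>f. c * tvec S p u f)"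
proof -
  have l: "linear (frechet_derivative (smooth_ext S p f) (at p))" if f: "smooth_near (submanifold S) p f" for f
  proof -
    obtain U where U: "open U" "p \<in> U" "smooth_on U (smooth_ext S p f)"
      using smooth_ext[OF assms f] by blast
    then show ?thesis using smooth_on_has_derivative[OF U(1,3,2)] has_derivative_linear by blast
  qed
  show "tvec S p (u + v) = (\<lambda>f. tvec S p u f + tvec S p v f)" "tvec S p (c *\<^sub>R u) = (\<lambda>f. c * tvec S p u f)"
    unfolding tvec_def using linear_add[OF l] linear_cmul[OF l] by auto
qed

text \<open>Near 0 the curve stays where \<open>smooth_ext S p f\<close> agrees with
  \<open>f\<close> on \<open>S\<close>, so the chain rule for the extension computes the
  velocity.\<close>

lemma velocity_submanifold:
  assumes S: "has_charts S" and e: "e > 0" and \<gamma>: "\<gamma> ` {-e<..<e} \<subseteq> S" "\<gamma> 0 = p"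
    "(\<gamma> has_vector_derivative u) (at 0)"
  shows "velocity (submanifold S) \<gamma> = tvec S p u"
proof
  fix f
  show "velocity (submanifold S) \<gamma> f = tvec S p u f"
  proof (cases "smooth_near (submanifold S) p f")
    case True
    let ?F = "smooth_ext S p f"
    obtain U where U: "open U" "p \<in> U" "smooth_on U ?F" "\<And>y. y \<in> U \<Longrightarrow> y \<in> S \<Longrightarrow> ?F y = f y"
      using smooth_ext[OF S True] by blast
    have "(?F has_derivative frechet_derivative ?F (at p)) (at (\<gamma> 0))"
      using smooth_on_has_derivative[OF U(1,3,2)] \<gamma>(2) by simp
    then have "((\<lambda>t. ?F (\<gamma> t)) has_derivative (\<lambda>h. frechet_derivative ?F (at p) (h *\<^sub>R u))) (at 0)"
      by (rule has_derivative_compose[OF \<gamma>(3)[unfolded has_vector_derivative_def]])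
    moreover have "frechet_derivative ?F (at p) (h *\<^sub>R u) = frechet_derivative ?F (at p) u * h" for h
      using smooth_on_has_derivative[OF U(1,3,2)] has_derivative_linear linear_cmul by fastforce
    ultimately have D: "((\<lambda>t. ?F (\<gamma> t)) has_field_derivative frechet_derivative ?F (at p) u) (at 0)"
      by (simp add: has_field_derivative_def)
    have ev: "\<forall>\<^sub>F t in nhds 0. ?F (\<gamma> t) = f (\<gamma> t)"
    proof -
      have "continuous (at 0) \<gamma>" using \<gamma>(3) has_vector_derivative_continuous by blast
      then have "(\<gamma> \<longlongrightarrow> \<gamma> 0) (nhds 0)"
        using tendsto_at_iff_tendsto_nhds[of \<gamma> 0] by (simp add: isCont_def)
      then have "\<forall>\<^sub>F t in nhds 0. \<gamma> t \<in> U"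
        using U(1,2) \<gamma>(2) by (metis topological_tendstoD)
      moreover have "\<forall>\<^sub>F t in nhds (0::real). t \<in> {-e<..<e}"
        using e by (intro eventually_nhds_in_open) auto
      ultimately show ?thesis by eventually_elim (use U(4) \<gamma>(1) in blast)
    qed
    from D have "((\<lambda>t. f (\<gamma> t)) has_field_derivative frechet_derivative ?F (at p) u) (at 0)"
      using DERIV_cong_ev[OF refl ev refl] by simp
    then show ?thesis using True \<gamma>(2) by (simp add: velocity_def tvec_def DERIV_imp_deriv)
  qed (simp add: velocity_def tvec_def \<gamma>(2))
qed

lemma tangent_space_submanifold:
  assumes S: "has_charts S"
  shows "tangent_space (submanifold S) p = tvec S p ` tangent_vectors S p"
proof (intro equalityI subsetI)
  fix \<xi> assume "\<xi> \<in> tangent_space (submanifold S) p"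
  then obtain \<gamma> e where \<gamma>: "\<xi> = velocity (submanifold S) \<gamma>" "e > 0"
    "smooth_map (submanifold {-e<..<e}) (submanifold S) \<gamma>" "\<gamma> 0 = p"
    unfolding tangent_space_def by blast
  have s: "smooth_on {-e<..<e} \<gamma>" "\<gamma> ` {-e<..<e} \<subseteq> S"
    using \<gamma>(3) smooth_map_submanifolds[OF has_charts_open S, of "{-e<..<e}"] by auto
  note d = smooth_on_interval_has_vector_derivative[OF s(1) \<gamma>(2)]
  have "vector_derivative \<gamma> (at 0) \<in> tangent_vectors S p"
    unfolding tangent_vectors_def using s d \<gamma> by blast
  then show "\<xi> \<in> tvec S p ` tangent_vectors S p"
    using velocity_submanifold[OF S \<gamma>(2) s(2) \<gamma>(4) d] \<gamma>(1) by blast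
next
  fix \<xi> assume "\<xi> \<in> tvec S p ` tangent_vectors S p"
  then obtain u \<gamma> e where u: "\<xi> = tvec S p u" and \<gamma>: "e > 0" "smooth_on {-e<..<e::real} \<gamma>"
    "\<gamma> ` {-e<..<e} \<subseteq> S" "\<gamma> 0 = p" "(\<gamma> has_vector_derivative u) (at 0)"
    unfolding tangent_vectors_def by blast
  have "smooth_map (submanifold {-e<..<e}) (submanifold S) \<gamma>"
    using \<gamma> smooth_map_submanifolds[OF has_charts_open S, of "{-e<..<e}"] by auto
  then show "\<xi> \<in> tangent_space (submanifold S) p"
    unfolding tangent_space_def u velocity_submanifold[OF S \<gamma>(1,3,4,5), symmetric] using \<gamma> by blast
qed

text \<open>Inverts \<open>tvec\<close> on tangent vectors by evaluating at the ambient coordinate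
  functions.\<close>

definition vec_of :: "(('a::euclidean_space \<Rightarrow> real) \<Rightarrow> real) \<Rightarrow> 'a" where
  "vec_of \<xi> = (\<Sum>b\<in>Basis. \<xi> (\<lambda>y. y \<bullet> b) *\<^sub>R b)"

lemma vec_of_tvec:
  assumes S: "has_charts S" and u: "u \<in> tangent_vectors S p"
  shows "vec_of (tvec S p u) = u"
proof -
  obtain \<gamma> e where \<gamma>: "e > 0" "smooth_on {-e<..<e::real} \<gamma>"
    "\<gamma> ` {-e<..<e} \<subseteq> S" "\<gamma> 0 = p" "(\<gamma> has_vector_derivative u) (at 0)"
    using u unfolding tangent_vectors_def by blast
  have "p \<in> S" using \<gamma>(1,3,4) by force
  have "tvec S p u (\<lambda>y. y \<bullet> b) = u \<bullet> b" for b
  proof -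
    have "smooth_on S (\<lambda>y. y \<bullet> b)" by (intro smooth_on_inner smooth_on_ident smooth_on_const)
    then have "smooth_near (submanifold S) p (\<lambda>y. y \<bullet> b)"
      unfolding smooth_near_submanifold[OF S] using \<open>p \<in> S\<close> openin_subtopology_self by blast
    moreover have "((\<lambda>t. \<gamma> t \<bullet> b) has_field_derivative u \<bullet> b) (at 0)"
      using bounded_linear.has_vector_derivative[OF bounded_linear_inner_left \<gamma>(5)]
      by (simp add: has_real_derivative_iff_has_vector_derivative)
    ultimately show ?thesis
      unfolding velocity_submanifold[OF S \<gamma>(1,3,4,5), symmetric] velocity_def
      using \<gamma>(4) by (simp add: DERIV_imp_deriv)
  qed
  then show ?thesis unfolding vec_of_def by (simp add: euclidean_representation)
qed

section \<open>Charts of submanifolds\<close>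

locale submanifold_chart =
  fixes S :: "'a::euclidean_space set" and U \<phi> E \<pi>
  assumes S: "has_charts S" and chart: "(U, \<phi>) \<in> atlas (submanifold S)"
    and E: "subspace E" "openin (top_of_set E) (\<phi> ` U)"
    and \<pi>: "linear \<pi>" "\<And>x. \<pi> x \<in> E" "\<And>v. v \<in> E \<Longrightarrow> \<pi> v = v" "\<And>x v. v \<in> E \<Longrightarrow> \<pi> x \<bullet> v = x \<bullet> v"
begin

text \<open>Composing the inverse of the chart with the projection \<open>\<pi>\<close> extends it to an open subset of the
  ambient space, where Frechet derivatives make sense.\<close>

definition "cdom = \<pi> -` (\<phi> ` U)"
definition "\<psi> y = inv_into U \<phi> (\<pi> y)"
definition "D\<psi> a = frechet_derivative \<psi> (at a)"

lemma U_openin: "openin (top_of_set S) U" and inj: "inj_on \<phi> U" and smooth_\<phi>: "smooth_on U \<phi>"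
  using chart unfolding submanifold_atlas by auto

lemma U_subset: "U \<subseteq> S"
  using U_openin openin_imp_subset by blast

lemma \<phi>_in_E: "p \<in> U \<Longrightarrow> \<phi> p \<in> E"
  using E(2) openin_imp_subset by blast

lemma open_cdom: "open cdom"
proof -
  obtain Q where "open Q" "\<phi> ` U = E \<inter> Q" using E(2) by (auto simp: openin_open)
  then have "cdom = \<pi> -` Q" unfolding cdom_def using \<pi>(2) by auto
  moreover have "continuous_on UNIV \<pi>" by (rule linear_continuous_on) (use \<pi>(1) in \<open>simp add: linear_conv_bounded_linear\<close>)
  ultimately show ?thesis using open_vimage[OF \<open>open Q\<close>] by simp
qed

lemma \<phi>_in_cdom: "p \<in> U \<Longrightarrow> \<phi> p \<in> cdom"
  unfolding cdom_def using \<pi>(3) \<phi>_in_E by auto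

lemma \<psi>_\<phi>: "p \<in> U \<Longrightarrow> \<psi> (\<phi> p) = p"
  unfolding \<psi>_def using \<pi>(3) \<phi>_in_E inj by auto

lemma \<psi>_in: "y \<in> cdom \<Longrightarrow> \<psi> y \<in> U"
  unfolding cdom_def \<psi>_def by (simp add: inv_into_into)

lemma \<phi>_\<psi>: "y \<in> cdom \<Longrightarrow> \<phi> (\<psi> y) = \<pi> y"
  unfolding cdom_def \<psi>_def by (simp add: f_inv_into_f)

lemma smooth_\<psi>: "smooth_on cdom \<psi>"
proof -
  have "smooth_on (\<phi> ` U) (inv_into U \<phi>)" using chart unfolding submanifold_atlas by blast
  then show ?thesis unfolding \<psi>_def
    by (rule smooth_on_compose[OF smooth_on_linear[OF \<pi>(1)]]) (simp add: cdom_def)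
qed

lemma \<psi>_has_derivative: "a \<in> cdom \<Longrightarrow> (\<psi> has_derivative D\<psi> a) (at a)"
  unfolding D\<psi>_def by (rule smooth_on_has_derivative[OF open_cdom smooth_\<psi>])

lemma linear_D\<psi>: "a \<in> cdom \<Longrightarrow> linear (D\<psi> a)"
  using \<psi>_has_derivative has_derivative_linear by blast

text \<open>Identifies the space that occurs in \<open>covector_coords\<close>: a nonempty
  relatively open subset of \<open>E\<close> has full dimension.\<close>

lemma span_image: assumes "U \<noteq> {}" shows "span (\<phi> ` U) = E"
proof -
  have "dim (\<phi> ` U) = dim E" using dim_openin[OF E(2,1)] assms by simp
  then have "span (\<phi> ` U) = span E"
    using dim_eq_span[of "\<phi> ` U" E] openin_imp_subset[OF E(2)] by simp
  then show ?thesis using E(1) span_eq_iff by metis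
qed

lemma coordinate_curve:
  assumes p: "p \<in> U" and v: "v \<in> E"
  obtains e where "e > 0" "smooth_on {-e<..<e::real} (\<lambda>t. inv_into U \<phi> (\<phi> p + t *\<^sub>R v))"
    "(\<lambda>t. inv_into U \<phi> (\<phi> p + t *\<^sub>R v)) ` {-e<..<e} \<subseteq> S"
    "((\<lambda>t. inv_into U \<phi> (\<phi> p + t *\<^sub>R v)) has_vector_derivative D\<psi> (\<phi> p) v) (at 0)"
proof -
  let ?l = "\<lambda>t::real. \<phi> p + t *\<^sub>R v"
  have eq: "inv_into U \<phi> (?l t) = \<psi> (?l t)" for t
    unfolding \<psi>_def using \<pi>(3) v \<phi>_in_E[OF p] E(1) by (simp add: subspace_add subspace_scale)
  have "continuous_on UNIV ?l" by (intro continuous_intros)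
  then have "open (?l -` cdom)" by (rule open_vimage[OF open_cdom])
  moreover have "0 \<in> ?l -` cdom" using \<phi>_in_cdom[OF p] by simp
  ultimately obtain e where e: "e > 0" "ball 0 e \<subseteq> ?l -` cdom" using open_contains_ball by blast
  then have sub: "?l t \<in> cdom" if "t \<in> {-e<..<e}" for t
    using that by (auto simp: subset_iff dist_real_def)
  show ?thesis
  proof (rule that[OF e(1)])
    have "smooth_on {-e<..<e} ?l"
      by (intro smooth_on_add smooth_on_const smooth_on_scaleR smooth_on_ident)
    then show "smooth_on {-e<..<e} (\<lambda>t. inv_into U \<phi> (?l t))" unfolding eq
      by (rule smooth_on_compose[OF _ smooth_\<psi> sub])
    show "(\<lambda>t. inv_into U \<phi> (?l t)) ` {-e<..<e} \<subseteq> S" unfolding eq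
      using sub \<psi>_in U_subset by blast
    have "(?l has_derivative (\<lambda>h. h *\<^sub>R v)) (at 0)" by (auto intro!: derivative_eq_intros)
    then have "((\<lambda>t. \<psi> (?l t)) has_derivative (\<lambda>h. D\<psi> (\<phi> p) (h *\<^sub>R v))) (at 0)"
      by (rule has_derivative_compose[where g = \<psi>]) (use \<psi>_has_derivative \<phi>_in_cdom p in simp)
    then show "((\<lambda>t. inv_into U \<phi> (?l t)) has_vector_derivative D\<psi> (\<phi> p) v) (at 0)"
      unfolding eq has_vector_derivative_def
      using linear_cmul[OF linear_D\<psi>[OF \<phi>_in_cdom[OF p]]] by simp
  qed
qed

lemma D\<psi>_tangent: "p \<in> U \<Longrightarrow> v \<in> E \<Longrightarrow> D\<psi> (\<phi> p) v \<in> tangent_vectors S p"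
  using \<psi>_\<phi>[of p] \<phi>_in_E[of p] \<pi>(3) coordinate_curve[of p v]
  unfolding tangent_vectors_def \<psi>_def by (simp; metis (no_types, lifting) add.right_neutral scale_zero_left)

lemma coord_vector_eq:
  assumes p: "p \<in> U" and v: "v \<in> E"
  shows "coord_vector (submanifold S) (U, \<phi>) p v = tvec S p (D\<psi> (\<phi> p) v)"
proof -
  have 0: "inv_into U \<phi> (\<phi> p + 0 *\<^sub>R v) = p" using p inj by simp
  obtain e where e: "e > 0" "(\<lambda>t. inv_into U \<phi> (\<phi> p + t *\<^sub>R v)) ` {-e<..<e} \<subseteq> S"
    "((\<lambda>t. inv_into U \<phi> (\<phi> p + t *\<^sub>R v)) has_vector_derivative D\<psi> (\<phi> p) v) (at 0)"
    by (rule coordinate_curve[OF assms])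
  show ?thesis unfolding coord_vector_def
    using velocity_submanifold[OF S e(1,2) 0 e(3)] by simp
qed

text \<open>The chart is defined on \<open>S\<close> only; \<open>F\<close> can be differentiated in
  the ambient space, and its derivative inverts \<open>D\<psi>\<close> on tangent vectors.\<close>

lemma chart_extension:
  assumes "p \<in> U"
  obtains \<Omega> F where "open \<Omega>" "p \<in> \<Omega>" "\<Omega> \<inter> S \<subseteq> U" "smooth_on \<Omega> F" "\<And>q. q \<in> \<Omega> \<Longrightarrow> q \<in> S \<Longrightarrow> F q = \<phi> q"
proof -
  obtain Q where Q: "open Q" "U = S \<inter> Q" using U_openin by (auto simp: openin_open)
  obtain W F where W: "open W" "p \<in> W" "smooth_on W F" "\<And>y. y \<in> W \<Longrightarrow> y \<in> U \<Longrightarrow> F y = \<phi> y"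
    using smooth_on_extension[OF smooth_\<phi> assms] by blast
  show ?thesis
    by (rule that[of "W \<inter> Q" F]) (use W Q assms in \<open>auto intro: smooth_on_subset[OF W(3)]\<close>)
qed

context
  fixes \<Omega> F q
  assumes \<Omega>: "open \<Omega>" "\<Omega> \<inter> S \<subseteq> U" "smooth_on \<Omega> F" "\<And>q. q \<in> \<Omega> \<Longrightarrow> q \<in> S \<Longrightarrow> F q = \<phi> q"
    and q: "q \<in> \<Omega>" "q \<in> S"
begin

lemma F_has_derivative: "(F has_derivative frechet_derivative F (at q)) (at q)"
  by (rule smooth_on_has_derivative[OF \<Omega>(1,3) q(1)])

text \<open>Near \<open>\<phi> q\<close> the composition of \<open>F\<close> with
  \<open>\<psi>\<close> agrees with \<open>\<pi>\<close>, which is linear and fixes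
  \<open>E\<close>.\<close>

lemma DF_D\<psi>:
  assumes v: "v \<in> E" shows "frechet_derivative F (at q) (D\<psi> (\<phi> q) v) = v"
proof -
  have qU: "q \<in> U" using \<Omega> q by blast
  have "((\<lambda>y. F (\<psi> y)) has_derivative (\<lambda>v. frechet_derivative F (at q) (D\<psi> (\<phi> q) v))) (at (\<phi> q))"
    by (rule has_derivative_compose[where g = F, OF \<psi>_has_derivative[OF \<phi>_in_cdom[OF qU]]])
      (simp add: \<psi>_\<phi>[OF qU] F_has_derivative)
  moreover have "(\<pi> has_derivative \<pi>) (at (\<phi> q))"
    using \<pi>(1) by (simp add: linear_conv_bounded_linear bounded_linear_imp_has_derivative)
  then have "((\<lambda>y. F (\<psi> y)) has_derivative \<pi>) (at (\<phi> q))"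
  proof (rule has_derivative_transform_within_open)
    show "open (cdom \<inter> \<psi> -` \<Omega>)"
      by (rule continuous_open_preimage[OF smooth_on_imp_continuous_on[OF smooth_\<psi>] open_cdom \<Omega>(1)])
    show "\<phi> q \<in> cdom \<inter> \<psi> -` \<Omega>" using \<phi>_in_cdom[OF qU] \<psi>_\<phi>[OF qU] q by simp
    show "\<pi> y = F (\<psi> y)" if "y \<in> cdom \<inter> \<psi> -` \<Omega>" for y
      using that \<Omega>(4) \<phi>_\<psi> \<psi>_in U_subset by fastforce
  qed
  ultimately have "(\<lambda>v. frechet_derivative F (at q) (D\<psi> (\<phi> q) v)) = \<pi>" by (rule has_derivative_unique)
  then show ?thesis using \<pi>(3)[OF v] by metis
qed

text \<open>Along a curve in \<open>S\<close> through \<open>q\<close>, the map \<open>F\<close>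
  takes values in \<open>E\<close> and \<open>\<psi>\<close> undoes it; both facts are
  differentiated at time 0.\<close>

lemma DF_tangent:
  assumes u: "u \<in> tangent_vectors S q"
  shows "frechet_derivative F (at q) u \<in> E" "D\<psi> (\<phi> q) (frechet_derivative F (at q) u) = u"
proof -
  have qU: "q \<in> U" using \<Omega> q by blast
  obtain \<gamma> e where \<gamma>: "e > 0" "smooth_on {-e<..<e::real} \<gamma>"
    "\<gamma> ` {-e<..<e} \<subseteq> S" "\<gamma> 0 = q" "(\<gamma> has_vector_derivative u) (at 0)"
    using u unfolding tangent_vectors_def by blast
  define J where "J = {-e<..<e} \<inter> \<gamma> -` \<Omega>"
  have J: "open J" unfolding J_def
    by (rule continuous_open_preimage[OF smooth_on_imp_continuous_on[OF \<gamma>(2)] _ \<Omega>(1)]) simp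
  have J0: "0 \<in> J" using \<gamma>(1,4) q by (simp add: J_def)
  have JU: "\<gamma> t \<in> U" "F (\<gamma> t) = \<phi> (\<gamma> t)" if "t \<in> J" for t
    using that \<gamma>(3) \<Omega>(2,4) unfolding J_def by blast+
  let ?d = "frechet_derivative F (at q)"
  have ld: "linear ?d" using F_has_derivative has_derivative_linear by blast
  have d\<gamma>: "(\<gamma> has_derivative (\<lambda>h. h *\<^sub>R u)) (at 0)" using \<gamma>(5) by (simp add: has_vector_derivative_def)
  have dF: "((\<lambda>t. F (\<gamma> t)) has_derivative (\<lambda>h. ?d (h *\<^sub>R u))) (at 0)"
    by (rule has_derivative_compose[where g = F, OF d\<gamma>]) (simp add: \<gamma>(4) F_has_derivative)
  have "((\<lambda>t. \<pi> (F (\<gamma> t))) has_derivative (\<lambda>h. \<pi> (?d (h *\<^sub>R u)))) (at 0)"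
    by (rule bounded_linear.has_derivative[OF _ dF]) (use \<pi>(1) in \<open>simp add: linear_conv_bounded_linear\<close>)
  then have "((\<lambda>t. F (\<gamma> t)) has_derivative (\<lambda>h. \<pi> (?d (h *\<^sub>R u)))) (at 0)"
    by (rule has_derivative_transform_within_open[OF _ J J0]) (use JU \<pi>(3) \<phi>_in_E in auto)
  then have "(\<lambda>h. \<pi> (?d (h *\<^sub>R u))) = (\<lambda>h. ?d (h *\<^sub>R u))" using dF by (rule has_derivative_unique)
  then have "\<pi> (?d (1 *\<^sub>R u)) = ?d (1 *\<^sub>R u)" by (rule fun_cong)
  then show "?d u \<in> E" using \<pi>(2) by (metis scaleR_one)
  have "((\<lambda>t. \<psi> (F (\<gamma> t))) has_derivative (\<lambda>h. D\<psi> (\<phi> q) (?d (h *\<^sub>R u)))) (at 0)"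
    by (rule has_derivative_compose[where g = \<psi>, OF dF])
      (use JU[OF J0] \<gamma>(4) \<psi>_has_derivative \<phi>_in_cdom qU in auto)
  then have "(\<gamma> has_derivative (\<lambda>h. D\<psi> (\<phi> q) (?d (h *\<^sub>R u)))) (at 0)"
    by (rule has_derivative_transform_within_open[OF _ J J0]) (use JU \<psi>_\<phi> in auto)
  then have "(\<lambda>h. D\<psi> (\<phi> q) (?d (h *\<^sub>R u))) = (\<lambda>h. h *\<^sub>R u)" using d\<gamma> by (rule has_derivative_unique)
  then have "D\<psi> (\<phi> q) (?d (1 *\<^sub>R u)) = 1 *\<^sub>R u" by (rule fun_cong)
  then show "D\<psi> (\<phi> q) (?d u) = u" by simp
qed

end

lemma tangent_vectors_chart:
  assumes "p \<in> U" shows "tangent_vectors S p = D\<psi> (\<phi> p) ` E"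
proof -
  have pS: "p \<in> S" using assms U_subset by blast
  obtain \<Omega> F where F: "open \<Omega>" "p \<in> \<Omega>" "\<Omega> \<inter> S \<subseteq> U" "smooth_on \<Omega> F" "\<And>q. q \<in> \<Omega> \<Longrightarrow> q \<in> S \<Longrightarrow> F q = \<phi> q"
    using chart_extension[OF assms] by blast
  note d = DF_tangent[OF F(1,3,4,5,2) pS]
  show ?thesis
  proof (intro equalityI subsetI)
    fix u assume "u \<in> tangent_vectors S p"
    then show "u \<in> D\<psi> (\<phi> p) ` E" using d[of u] by (intro image_eqI[of _ _ "frechet_derivative F (at p) u"]) simp_all
  qed (use D\<psi>_tangent[OF assms] in blast)
qed

text \<open>Determines the dimension of the coordinate space by data that do not mention the chart;
  the common dimension of all charts is obtained this way.\<close>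

lemma dim_tangent_vectors:
  assumes "p \<in> U" shows "dim (tangent_vectors S p) = dim E"
proof -
  obtain \<Omega> F where F: "open \<Omega>" "p \<in> \<Omega>" "\<Omega> \<inter> S \<subseteq> U" "smooth_on \<Omega> F" "\<And>q. q \<in> \<Omega> \<Longrightarrow> q \<in> S \<Longrightarrow> F q = \<phi> q"
    using chart_extension[OF assms] by blast
  have pS: "p \<in> S" using assms U_subset by blast
  have "inj_on (D\<psi> (\<phi> p)) E"
    by (rule inj_on_inverseI[of _ "frechet_derivative F (at p)"])
      (rule DF_D\<psi>[OF F(1,3,4,5,2) pS])
  then show ?thesis
    unfolding tangent_vectors_chart[OF assms]
    by (intro dim_image_eq linear_D\<psi> \<phi>_in_cdom assms) (use E(1) in \<open>simp add: span_eq_iff[THEN iffD2]\<close>)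
qed

lemma subspace_tangent_vectors_chart: "p \<in> U \<Longrightarrow> subspace (tangent_vectors S p)"
  using tangent_vectors_chart linear_subspace_image[OF linear_D\<psi>[OF \<phi>_in_cdom] E(1)] by simp

end

lemma submanifold_chart_exists:
  assumes "has_charts S" "(U, \<phi>) \<in> atlas (submanifold S)"
  obtains E \<pi> where "submanifold_chart S U \<phi> E \<pi>"
proof -
  obtain E where E: "subspace E" "openin (top_of_set E) (\<phi> ` U)"
    using assms(2) unfolding submanifold_atlas by blast
  obtain \<pi> where \<pi>: "linear \<pi>" "\<And>x. \<pi> x \<in> E" "\<And>v. v \<in> E \<Longrightarrow> \<pi> v = v" "\<And>x v. v \<in> E \<Longrightarrow> \<pi> x \<bullet> v = x \<bullet> v"
    using orthogonal_projection_exists[OF E(1)] by blast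
  have "submanifold_chart S U \<phi> E \<pi>"
    by (rule submanifold_chart.intro[OF assms E \<pi>])
  then show ?thesis by (rule that)
qed

lemma subspace_tangent_vectors:
  assumes "has_charts S" "p \<in> S" shows "subspace (tangent_vectors S p)"
proof -
  obtain U \<phi> where "(U, \<phi>) \<in> atlas (submanifold S)" "p \<in> U" using assms unfolding has_charts_def by blast
  then show ?thesis
    using submanifold_chart_exists[OF assms(1)] submanifold_chart.subspace_tangent_vectors_chart by metis
qed

lemma second_countable_euclidean: "second_countable (euclidean :: 'a::euclidean_space topology)"
proof -
  obtain B :: "'a set set" where B: "countable B" "\<And>C. C \<in> B \<Longrightarrow> open C"
    "\<And>S. open S \<Longrightarrow> \<exists>U. U \<subseteq> B \<and> S = \<Union>U"
    using univ_second_countable by blast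
  have "\<exists>U\<in>B. x \<in> U \<and> U \<subseteq> V" if "open V" "x \<in> V" for V x using B(3)[OF that(1)] that(2) by auto
  then show ?thesis unfolding second_countable_def using B(1,2) by (intro exI[of _ B]) auto
qed

lemma smooth_manifold_submanifold:
  assumes S: "has_charts S" and n: "\<And>p. p \<in> S \<Longrightarrow> dim (tangent_vectors S p) = n" and "S \<noteq> {}"
  shows "smooth_manifold (submanifold S)"
proof -
  note ch = charted_submanifold[OF S]
  have "Hausdorff_space (mtop (submanifold S))" by (simp add: Hausdorff_space_subtopology)
  moreover have "second_countable (mtop (submanifold S))"
    by (simp add: second_countable_subtopology second_countable_euclidean)
  moreover have "\<Union> (fst ` atlas (submanifold S)) = topspace (mtop (submanifold S))"
    using ch unfolding charted_def by blast
  moreover have "\<exists>E. subspace E \<and> dim E = n \<and> openin (top_of_set E) (\<phi> ` U)"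
    if c: "(U, \<phi>) \<in> atlas (submanifold S)" for U \<phi>
  proof -
    obtain E \<pi> where "submanifold_chart S U \<phi> E \<pi>" using submanifold_chart_exists[OF S c] .
    then interpret submanifold_chart S U \<phi> E \<pi> .
    show ?thesis
    proof (cases "U = {}")
      \<comment> \<open>The empty chart also has to take values in some \<open>n\<close>-dimensional
        subspace; the tangent space at any point of \<open>S\<close> provides one.\<close>
      case True
      obtain p where "p \<in> S" using assms(3) by blast
      then show ?thesis using True subspace_tangent_vectors[OF S] n
        by (intro exI[of _ "tangent_vectors S p"]) simp
    next
      case False
      then obtain p where "p \<in> U" by blast
      then have "dim E = n" using dim_tangent_vectors n U_subset by (metis subsetD)
      then show ?thesis using E by blast
    qed
  qed
  ultimately show ?thesis
    unfolding smooth_manifold_def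
    using chart_openin[OF ch] chart_homeomorphic_map[OF ch] charted_transition[OF ch]
    by (auto intro!: exI[of _ n])
qed

section \<open>Cotangent spaces of submanifolds\<close>

text \<open>Precomposing \<open>l\<close> with the projection gives a functional on the ambient
  space; its coefficient vector is then projected back to \<open>T\<close>.\<close>

lemma riesz_subspace:
  fixes T :: "'a::euclidean_space set"
  assumes T: "subspace T" and add: "\<And>u v. u \<in> T \<Longrightarrow> v \<in> T \<Longrightarrow> l (u + v) = l u + l v"
    and scale: "\<And>c u. u \<in> T \<Longrightarrow> l (c *\<^sub>R u) = c * l u"
  obtains v where "v \<in> T" "\<And>u. u \<in> T \<Longrightarrow> v \<bullet> u = (l u :: real)"
proof -
  obtain P where P: "linear P" "\<And>x. P x \<in> T" "\<And>t. t \<in> T \<Longrightarrow> P t = t" "\<And>x t. t \<in> T \<Longrightarrow> P x \<bullet> t = x \<bullet> t"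
    using orthogonal_projection_exists[OF T] by blast
  have "linear (\<lambda>x. l (P x))"
    by (rule linearI) (simp_all add: linear_add[OF P(1)] linear_cmul[OF P(1)] add scale P(2))
  note l = linear_sum_Basis[OF this]
  let ?v = "\<Sum>b\<in>Basis. l (P b) *\<^sub>R b"
  show ?thesis
  proof (rule that[of "P ?v"])
    fix u assume u: "u \<in> T"
    have "P ?v \<bullet> u = ?v \<bullet> u" by (rule P(4)[OF u])
    also have "\<dots> = (\<Sum>b\<in>Basis. (u \<bullet> b) *\<^sub>R l (P b))"
      by (simp add: inner_commute[of _ u] inner_sum_right mult.commute)
    also have "\<dots> = l (P u)" by (rule l[symmetric])
    finally show "P ?v \<bullet> u = l u" using P(3)[OF u] by simp
  qed (rule P(2))
qed

text \<open>Turns a functional on ambient vectors into an abstract covector; it is zero off the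
  tangent space, as \<open>cotangent_space\<close> demands.\<close>

definition covec :: "'a::euclidean_space set \<Rightarrow> 'a \<Rightarrow> ('a \<Rightarrow> real) \<Rightarrow> (('a \<Rightarrow> real) \<Rightarrow> real) \<Rightarrow> real" where
  "covec S p l = (\<lambda>\<xi>. if \<xi> \<in> tangent_space (submanifold S) p then l (vec_of \<xi>) else 0)"

context
  fixes S :: "'a::euclidean_space set" and p
  assumes S: "has_charts S" and p: "p \<in> S"
begin

lemma tvec_in_tangent_space: "u \<in> tangent_vectors S p \<Longrightarrow> tvec S p u \<in> tangent_space (submanifold S) p"
  unfolding tangent_space_submanifold[OF S] by blast

lemma covec_tvec: "u \<in> tangent_vectors S p \<Longrightarrow> covec S p l (tvec S p u) = l u"
  unfolding covec_def using tvec_in_tangent_space vec_of_tvec[OF S] by simp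

lemma cotangent_tvec_add:
  assumes "\<alpha> \<in> cotangent_space (submanifold S) p" "u \<in> tangent_vectors S p" "v \<in> tangent_vectors S p"
  shows "\<alpha> (tvec S p (u + v)) = \<alpha> (tvec S p u) + \<alpha> (tvec S p v)"
  using assms(1) tvec_in_tangent_space[OF assms(2)] tvec_in_tangent_space[OF assms(3)]
  unfolding tvec_linear(1)[OF S] cotangent_space_def by blast

lemma cotangent_tvec_scale:
  assumes "\<alpha> \<in> cotangent_space (submanifold S) p" "u \<in> tangent_vectors S p"
  shows "\<alpha> (tvec S p (c *\<^sub>R u)) = c * \<alpha> (tvec S p u)"
  using assms(1) tvec_in_tangent_space[OF assms(2)]
  unfolding tvec_linear(2)[OF S] cotangent_space_def by blast

lemma cotangent_eqI:
  assumes "\<alpha> \<in> cotangent_space (submanifold S) p" "\<beta> \<in> cotangent_space (submanifold S) p"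
    and "\<And>u. u \<in> tangent_vectors S p \<Longrightarrow> \<alpha> (tvec S p u) = \<beta> (tvec S p u)"
  shows "\<alpha> = \<beta>"
proof
  fix \<xi>
  show "\<alpha> \<xi> = \<beta> \<xi>"
  proof (cases "\<xi> \<in> tangent_space (submanifold S) p")
    case True
    then obtain u where "u \<in> tangent_vectors S p" "\<xi> = tvec S p u"
      unfolding tangent_space_submanifold[OF S] by auto
    then show ?thesis using assms(3) by simp
  next
    case False
    then show ?thesis using assms(1,2) unfolding cotangent_space_def by simp
  qed
qed

lemma covec_in_cotangent_space:
  assumes add: "\<And>u v. u \<in> tangent_vectors S p \<Longrightarrow> v \<in> tangent_vectors S p \<Longrightarrow> l (u + v) = l u + l v"
    and scale: "\<And>c u. u \<in> tangent_vectors S p \<Longrightarrow> l (c *\<^sub>R u) = c * l u"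
  shows "covec S p l \<in> cotangent_space (submanifold S) p"
  unfolding cotangent_space_def
proof (intro CollectI conjI ballI allI impI)
  note T = subspace_tangent_vectors[OF S p]
  fix X assume "X \<in> tangent_space (submanifold S) p"
  then obtain u where u: "u \<in> tangent_vectors S p" "X = tvec S p u"
    unfolding tangent_space_submanifold[OF S] by auto
  { fix Y assume "Y \<in> tangent_space (submanifold S) p"
    then obtain v where v: "v \<in> tangent_vectors S p" "Y = tvec S p v"
      unfolding tangent_space_submanifold[OF S] by auto
    have "covec S p l (tvec S p (u + v)) = covec S p l X + covec S p l Y"
      using u v T by (simp add: covec_tvec subspace_add add)
    then show "covec S p l (\<lambda>f. X f + Y f) = covec S p l X + covec S p l Y"
      unfolding tvec_linear(1)[OF S] u v . }
  fix c
  have "covec S p l (tvec S p (c *\<^sub>R u)) = c * covec S p l X"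
    using u T by (simp add: covec_tvec subspace_scale scale)
  then show "covec S p l (\<lambda>f. c * X f) = c * covec S p l X"
    unfolding tvec_linear(2)[OF S] u .
qed (simp add: covec_def)

end

context submanifold_chart
begin

abbreviation "coords \<equiv> covector_coords (submanifold S) (U, \<phi>)"

lemma covector_coords_unique:
  assumes p: "p \<in> U" and q: "q \<in> E" "\<And>v. v \<in> E \<Longrightarrow> q \<bullet> v = \<alpha> (tvec S p (D\<psi> (\<phi> p) v))"
  shows "coords p \<alpha> = q"
proof -
  have sp: "span (\<phi> ` U) = E" by (rule span_image) (use p in blast)
  have "(THE q. q \<in> E \<and> (\<forall>v\<in>E. q \<bullet> v = \<alpha> (coord_vector (submanifold S) (U, \<phi>) p v))) = q"
  proof (rule the_equality)
    show "q \<in> E \<and> (\<forall>v\<in>E. q \<bullet> v = \<alpha> (coord_vector (submanifold S) (U, \<phi>) p v))"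
      using q coord_vector_eq[OF p] by simp
    fix q' assume q': "q' \<in> E \<and> (\<forall>v\<in>E. q' \<bullet> v = \<alpha> (coord_vector (submanifold S) (U, \<phi>) p v))"
    then have "(q' - q) \<bullet> v = 0" if "v \<in> E" for v
      using that q(2) coord_vector_eq[OF p] by (simp add: inner_diff_left)
    moreover have "q' - q \<in> E" using q' q(1) E(1) by (simp add: subspace_diff)
    ultimately have "(q' - q) \<bullet> (q' - q) = 0" by blast
    then show "q' = q" by simp
  qed
  then show ?thesis unfolding covector_coords_def prod.case sp .
qed

lemma covector_coords:
  assumes p: "p \<in> U" and \<alpha>: "\<alpha> \<in> cotangent_space (submanifold S) p"
  shows "coords p \<alpha> \<in> E" "\<And>v. v \<in> E \<Longrightarrow> coords p \<alpha> \<bullet> v = \<alpha> (tvec S p (D\<psi> (\<phi> p) v))"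
proof -
  have pS: "p \<in> S" using p U_subset by blast
  note l = linear_D\<psi>[OF \<phi>_in_cdom[OF p]]
  obtain q where q: "q \<in> E" "\<And>v. v \<in> E \<Longrightarrow> q \<bullet> v = \<alpha> (tvec S p (D\<psi> (\<phi> p) v))"
  proof (rule riesz_subspace[OF E(1), where l = "\<lambda>v. \<alpha> (tvec S p (D\<psi> (\<phi> p) v))"])
    show "\<alpha> (tvec S p (D\<psi> (\<phi> p) (u + v))) = \<alpha> (tvec S p (D\<psi> (\<phi> p) u)) + \<alpha> (tvec S p (D\<psi> (\<phi> p) v))"
      if "u \<in> E" "v \<in> E" for u v
      unfolding linear_add[OF l] by (intro cotangent_tvec_add[OF S pS \<alpha>] D\<psi>_tangent[OF p] that)
    show "\<alpha> (tvec S p (D\<psi> (\<phi> p) (c *\<^sub>R u))) = c * \<alpha> (tvec S p (D\<psi> (\<phi> p) u))" if "u \<in> E" for c u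
      unfolding linear_cmul[OF l] by (intro cotangent_tvec_scale[OF S pS \<alpha>] D\<psi>_tangent[OF p] that)
  qed blast
  have "coords p \<alpha> = q" by (rule covector_coords_unique[OF p q])
  then show "coords p \<alpha> \<in> E" "\<And>v. v \<in> E \<Longrightarrow> coords p \<alpha> \<bullet> v = \<alpha> (tvec S p (D\<psi> (\<phi> p) v))"
    using q by simp_all
qed

text \<open>Replaces the definite description by a formula in which smooth dependence can be read
  off. The basis is that of the ambient space, so its vectors are first projected to
  \<open>E\<close>, which does not change inner products with elements of \<open>E\<close>.\<close>

lemma covector_coords_sum:
  assumes p: "p \<in> U" and \<alpha>: "\<alpha> \<in> cotangent_space (submanifold S) p"
  shows "coords p \<alpha> = (\<Sum>b\<in>Basis. \<alpha> (tvec S p (D\<psi> (\<phi> p) (\<pi> b))) *\<^sub>R b)"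
proof -
  have "coords p \<alpha> = (\<Sum>b\<in>Basis. (coords p \<alpha> \<bullet> b) *\<^sub>R b)" by (simp add: euclidean_representation)
  also have "\<dots> = (\<Sum>b\<in>Basis. (coords p \<alpha> \<bullet> \<pi> b) *\<^sub>R b)"
    using \<pi>(4)[OF covector_coords(1)[OF assms]] by (simp add: inner_commute)
  finally show ?thesis using covector_coords(2)[OF assms \<pi>(2)] by simp
qed

definition "ct_dom = Sigma U (cotangent_space (submanifold S))"
definition "ct_chart = (\<lambda>(p, \<alpha>). (\<phi> p, coords p \<alpha>))"

lemma cotangent_chart_eq: "cotangent_chart (submanifold S) (U, \<phi>) = (ct_dom, ct_chart)"
  unfolding cotangent_chart_def ct_dom_def ct_chart_def by simp

lemma inj_on_ct_chart: "inj_on ct_chart ct_dom"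
proof (rule inj_onI, clarify)
  fix p \<alpha> p' \<alpha>' assume d: "(p, \<alpha>) \<in> ct_dom" "(p', \<alpha>') \<in> ct_dom" "ct_chart (p, \<alpha>) = ct_chart (p', \<alpha>')"
  then have p: "p \<in> U" "p' \<in> U" and \<alpha>: "\<alpha> \<in> cotangent_space (submanifold S) p" "\<alpha>' \<in> cotangent_space (submanifold S) p'"
    and "\<phi> p = \<phi> p'" and c: "coords p \<alpha> = coords p' \<alpha>'"
    unfolding ct_dom_def ct_chart_def by auto
  then have pp: "p = p'" using inj by (simp add: inj_on_eq_iff)
  have "\<alpha> = \<alpha>'"
  proof (rule cotangent_eqI[OF S _ \<alpha>(1)])
    show "p \<in> S" using p U_subset by blast
    show "\<alpha>' \<in> cotangent_space (submanifold S) p" using \<alpha> pp by simp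
    fix u assume "u \<in> tangent_vectors S p"
    then obtain v where "v \<in> E" "u = D\<psi> (\<phi> p) v" using tangent_vectors_chart[OF p(1)] by auto
    then show "\<alpha> (tvec S p u) = \<alpha>' (tvec S p u)"
      using covector_coords(2)[OF p(1) \<alpha>(1), of v] covector_coords(2)[OF p(2) \<alpha>(2), of v] c pp by simp
  qed
  then show "p = p' \<and> \<alpha> = \<alpha>'" using pp by simp
qed

lemma ct_chart_image: "ct_chart ` ct_dom = \<phi> ` U \<times> E"
proof (intro equalityI subsetI)
  fix z assume "z \<in> ct_chart ` ct_dom"
  then show "z \<in> \<phi> ` U \<times> E" using covector_coords(1) unfolding ct_dom_def ct_chart_def by auto
next
  fix z assume "z \<in> \<phi> ` U \<times> E"
  then obtain p q where p: "p \<in> U" and q: "q \<in> E" and z: "z = (\<phi> p, q)" by auto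
  have pS: "p \<in> S" using p U_subset by blast
  obtain \<Omega> F where F: "open \<Omega>" "p \<in> \<Omega>" "\<Omega> \<inter> S \<subseteq> U" "smooth_on \<Omega> F" "\<And>q. q \<in> \<Omega> \<Longrightarrow> q \<in> S \<Longrightarrow> F q = \<phi> q"
    using chart_extension[OF p] by blast
  have lF: "linear (frechet_derivative F (at p))"
    using F_has_derivative[OF F(1,3,4,5,2) pS] has_derivative_linear by blast
  \<comment> \<open>The derivative of \<open>F\<close> inverts \<open>D\<psi> (\<phi> p)\<close>, so
    this covector has coordinates \<open>q\<close>.\<close>
  let ?\<alpha> = "covec S p (\<lambda>u. q \<bullet> frechet_derivative F (at p) u)"
  have \<alpha>: "?\<alpha> \<in> cotangent_space (submanifold S) p"
    by (rule covec_in_cotangent_space[OF S pS])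
      (simp_all add: linear_add[OF lF] linear_cmul[OF lF] inner_add_right)
  have "coords p ?\<alpha> = q"
  proof (rule covector_coords_unique[OF p q])
    fix v assume v: "v \<in> E"
    show "q \<bullet> v = ?\<alpha> (tvec S p (D\<psi> (\<phi> p) v))"
      by (simp add: covec_tvec[OF S pS D\<psi>_tangent[OF p v]] DF_D\<psi>[OF F(1,3,4,5,2) pS v])
  qed
  then show "z \<in> ct_chart ` ct_dom" unfolding z ct_dom_def ct_chart_def using p \<alpha>
    by (intro image_eqI[of _ _ "(p, ?\<alpha>)"]) simp_all
qed

end

section \<open>A submanifold diffeomorphic to the cotangent bundle\<close>

text \<open>The linear maps \<open>R _ w\<close> parametrize the tangent spaces of \<open>S\<close>. Their transposes embed the
  cotangent spaces into \<open>'l\<close> and thereby the cotangent bundle into \<open>'l \<times> 'a\<close>, with image \<open>C\<close>. In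
  the application \<open>R\<close> is the infinitesimal representation.\<close>

locale cotangent_model =
  fixes S :: "'a::euclidean_space set" and R :: "'l::euclidean_space \<Rightarrow> 'a \<Rightarrow> 'a" and n :: nat
  assumes SC: "has_charts S" "S \<noteq> {}" and R: "bounded_bilinear R"
    and tangent: "\<And>w. w \<in> S \<Longrightarrow> tangent_vectors S w = range (\<lambda>X. R X w)"
    and dim: "\<And>w. w \<in> S \<Longrightarrow> dim (tangent_vectors S w) = n"
begin

definition "C = {(Z, w). w \<in> S \<and> (\<exists>v. \<forall>X. Z \<bullet> X = v \<bullet> R X w)}"

abbreviation "cotS \<equiv> cotangent_space (submanifold S)"

text \<open>The covector sending \<open>R X w\<close> to \<open>Z \<bullet> X\<close>. For
  \<open>(Z, w)\<close> in \<open>C\<close> the choice of \<open>X\<close> does not matter.\<close>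

definition "f = (\<lambda>(Z, w). (w, covec S w (\<lambda>u. Z \<bullet> (SOME X. R X w = u))))"

text \<open>The transpose of \<open>R _ w\<close> applied to \<open>\<alpha>\<close>, written in the
  standard basis of \<open>'l\<close>.\<close>

definition "g = (\<lambda>(w, \<alpha>). (\<Sum>b\<in>Basis. \<alpha> (tvec S w (R b w)) *\<^sub>R b, w))"

lemma linear_R: "linear (\<lambda>X. R X w)"
  using bounded_bilinear.bounded_linear_left[OF R] by (simp add: linear_conv_bounded_linear)

lemma linear_R2: "linear (R X)"
  using bounded_bilinear.bounded_linear_right[OF R] by (simp add: linear_conv_bounded_linear)

lemma R_tangent: "w \<in> S \<Longrightarrow> R X w \<in> tangent_vectors S w"
  using tangent by simp

lemma
  assumes c: "(Z, w) \<in> C"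
  shows f_cot: "snd (f (Z, w)) \<in> cotS w"
    and f_tvec: "snd (f (Z, w)) (tvec S w (R X w)) = Z \<bullet> X"
proof -
  have w: "w \<in> S" using c by (simp add: C_def)
  obtain v where v: "\<And>X. Z \<bullet> X = v \<bullet> R X w" using c unfolding C_def by auto
  \<comment> \<open>Membership in \<open>C\<close> turns the chosen preimage into an inner product
    with the fixed vector \<open>v\<close>, which is linear in \<open>u\<close>.\<close>
  have l: "Z \<bullet> (SOME X. R X w = u) = v \<bullet> u" if "u \<in> tangent_vectors S w" for u
  proof -
    have "\<exists>X. R X w = u" using that tangent[OF w] by auto
    then have "R (SOME X. R X w = u) w = u" by (rule someI_ex)
    then show ?thesis using v by simp
  qed
  note T = subspace_tangent_vectors[OF SC(1) w]
  show "snd (f (Z, w)) \<in> cotS w"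
    unfolding f_def prod.case snd_conv
    by (rule covec_in_cotangent_space[OF SC(1) w])
      (simp_all add: l subspace_add[OF T] subspace_scale[OF T] inner_add_right)
  show "snd (f (Z, w)) (tvec S w (R X w)) = Z \<bullet> X"
    unfolding f_def prod.case snd_conv covec_tvec[OF SC(1) w R_tangent[OF w]]
    using l[OF R_tangent[OF w]] v by simp
qed

lemma fst_f: "fst (f c) = snd c"
  unfolding f_def by (simp add: split_beta)

lemma f_Pair: "f (Z, w) = (w, snd (f (Z, w)))"
  using fst_f[of "(Z, w)"] by (metis prod.collapse snd_conv)

text \<open>Membership in \<open>C\<close> asks for a vector that induces the pairing with
  \<open>R X w\<close>; representing \<open>\<alpha>\<close> on the tangent space provides
  it.\<close>

lemma
  assumes w: "w \<in> S" and \<alpha>: "\<alpha> \<in> cotS w"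
  shows g_inner: "fst (g (w, \<alpha>)) \<bullet> X = \<alpha> (tvec S w (R X w))"
    and g_in_C: "g (w, \<alpha>) \<in> C"
proof -
  have "linear (\<lambda>X. \<alpha> (tvec S w (R X w)))"
    using cotangent_tvec_add[OF SC(1) w \<alpha> R_tangent[OF w] R_tangent[OF w]]
      cotangent_tvec_scale[OF SC(1) w \<alpha> R_tangent[OF w]]
    by (intro linearI) (simp_all add: linear_add[OF linear_R] linear_cmul[OF linear_R])
  note lin = linear_sum_Basis[OF this]
  have inner: "fst (g (w, \<alpha>)) \<bullet> X = \<alpha> (tvec S w (R X w))" for X
    unfolding g_def prod.case fst_conv
    by (subst lin) (simp add: inner_commute[of _ X] inner_sum_right mult.commute)
  then show "fst (g (w, \<alpha>)) \<bullet> X = \<alpha> (tvec S w (R X w))" .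
  obtain v where "\<And>u. u \<in> tangent_vectors S w \<Longrightarrow> v \<bullet> u = \<alpha> (tvec S w u)"
    using riesz_subspace[OF subspace_tangent_vectors[OF SC(1) w], of "\<lambda>u. \<alpha> (tvec S w u)"]
      cotangent_tvec_add[OF SC(1) w \<alpha>] cotangent_tvec_scale[OF SC(1) w \<alpha>] by metis
  then have "\<And>X. fst (g (w, \<alpha>)) \<bullet> X = v \<bullet> R X w" using inner R_tangent[OF w] by simp
  then show "g (w, \<alpha>) \<in> C" unfolding C_def using w by (auto simp: g_def)
qed

lemma g_f: assumes "c \<in> C" shows "g (f c) = c"
proof -
  obtain Z w where c: "c = (Z, w)" by (cases c)
  have w: "w \<in> S" using assms c by (simp add: C_def)
  have *: "fst (g (w, snd (f (Z, w)))) \<bullet> X = Z \<bullet> X" for X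
    using g_inner[OF w f_cot] f_tvec assms unfolding c by simp
  have "fst (g (f (Z, w))) = Z"
    by (subst f_Pair, rule vector_eq_rdot[THEN iffD1]) (simp add: *)
  moreover have "snd (g (f (Z, w))) = w" by (subst f_Pair) (simp add: g_def)
  ultimately show ?thesis unfolding c by (simp add: prod_eq_iff)
qed

lemma f_g: assumes w: "w \<in> S" and \<alpha>: "\<alpha> \<in> cotS w" shows "f (g (w, \<alpha>)) = (w, \<alpha>)"
proof -
  obtain Z where Z: "g (w, \<alpha>) = (Z, w)" by (simp add: g_def)
  have ZC: "(Z, w) \<in> C" using g_in_C[OF assms] Z by simp
  have "snd (f (Z, w)) = \<alpha>"
  proof (rule cotangent_eqI[OF SC(1) w f_cot[OF ZC] \<alpha>])
    fix u assume "u \<in> tangent_vectors S w"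
    then obtain X where u: "u = R X w" using tangent[OF w] by auto
    show "snd (f (Z, w)) (tvec S w u) = \<alpha> (tvec S w u)"
      unfolding u f_tvec[OF ZC] using g_inner[OF assms, of X] Z by simp
  qed
  then show ?thesis unfolding Z by (subst f_Pair) simp
qed

end

locale cotangent_model_chart = cotangent_model S R n + submanifold_chart S U \<phi> E \<pi>
  for S :: "'a::euclidean_space set" and R :: "'l::euclidean_space \<Rightarrow> 'a \<Rightarrow> 'a" and n U \<phi> E \<pi>
begin

abbreviation "CU \<equiv> {c \<in> C. snd c \<in> U}"

lemma openin_CU: "openin (top_of_set C) CU"
proof -
  obtain Q where Q: "open Q" "U = S \<inter> Q" using U_openin by (auto simp: openin_open)
  have "CU = C \<inter> (UNIV \<times> Q)" unfolding Q(2) by (auto simp: C_def)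
  moreover have "open ((UNIV :: 'l set) \<times> Q)" using Q(1) by (simp add: open_Times)
  ultimately show ?thesis by (simp add: openin_open_Int)
qed

text \<open>Near \<open>w0\<close> the coordinate vector fields lift through \<open>R _ w\<close> to elements of \<open>'l\<close> that depend
  smoothly on \<open>w\<close>: correct a lift at \<open>w0\<close> by the inverse of the family \<open>A w\<close>, which is the identity
  at \<open>w0\<close>.\<close>

lemma local_lift:
  assumes w0: "w0 \<in> U"
  obtains W L where "open W" "w0 \<in> W" "\<And>v. smooth_on W (\<lambda>w. L w v :: 'l)" "W \<inter> S \<subseteq> U"
    "\<And>w v. w \<in> W \<Longrightarrow> w \<in> S \<Longrightarrow> v \<in> E \<Longrightarrow> R (L w v) w = D\<psi> (\<phi> w) v"
proof -
  have w0S: "w0 \<in> S" using w0 U_subset by blast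
  obtain \<Omega> F where F: "open \<Omega>" "w0 \<in> \<Omega>" "\<Omega> \<inter> S \<subseteq> U" "smooth_on \<Omega> F" "\<And>q. q \<in> \<Omega> \<Longrightarrow> q \<in> S \<Longrightarrow> F q = \<phi> q"
    using chart_extension[OF w0] by blast
  define DF where "DF w = frechet_derivative F (at w)" for w
  have lF: "linear (DF w)" if "w \<in> \<Omega>" for w
    unfolding DF_def using smooth_on_has_derivative[OF F(1,4) that] has_derivative_linear by blast
  obtain r where r: "linear r" "\<And>u. u \<in> range (\<lambda>X. R X w0) \<Longrightarrow> R (r u) w0 = u"
    using linear_exists_right_inverse_on[OF linear_R[of w0] subspace_UNIV] by blast
  \<comment> \<open>Lifts the coordinate vector fields at the single point
    \<open>w0\<close>.\<close>
  define s where "s v = r (D\<psi> (\<phi> w0) (\<pi> v))" for v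
  note lD = linear_D\<psi>[OF \<phi>_in_cdom[OF w0]]
  have ls: "linear s"
    by (rule linearI) (simp_all add: s_def linear_add[OF \<pi>(1)] linear_cmul[OF \<pi>(1)]
        linear_add[OF lD] linear_cmul[OF lD] linear_add[OF r(1)] linear_cmul[OF r(1)])
  \<comment> \<open>On \<open>E\<close> this compares \<open>v\<close> with the coordinates at
    \<open>w\<close> of the vector that the lift at \<open>w0\<close> produces there. The summand
    \<open>v - \<pi> v\<close> extends the comparison to an endomorphism of the whole ambient space,
    as the results on inverse families require.\<close>
  define A where "A w v = v - \<pi> v + DF w (R (s (\<pi> v)) w)" for w v
  have lA: "linear (A w)" if "w \<in> \<Omega>" for w
    by (rule linearI) (simp_all add: A_def linear_add[OF \<pi>(1)] linear_cmul[OF \<pi>(1)]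
        linear_add[OF ls] linear_cmul[OF ls] linear_add[OF linear_R] linear_cmul[OF linear_R]
        linear_add[OF lF[OF that]] linear_cmul[OF lF[OF that]] algebra_simps)
  have smA: "smooth_on \<Omega> (\<lambda>w. A w v)" for v
    unfolding A_def DF_def
    by (intro smooth_on_add smooth_on_const smooth_on_frechet_derivative'[OF F(1,4) smooth_on_ident]
        smooth_on_linear[OF linear_R2]) auto
  have A0: "A w0 v = v" for v
  proof -
    have "R (s (\<pi> v)) w0 = D\<psi> (\<phi> w0) (\<pi> v)"
      using r(2) D\<psi>_tangent[OF w0 \<pi>(2)] tangent[OF w0S] \<pi>(3)[OF \<pi>(2)] by (simp add: s_def)
    then have "DF w0 (R (s (\<pi> v)) w0) = \<pi> v"
      unfolding DF_def using DF_D\<psi>[OF F(1,3,4,5,2) w0S \<pi>(2)] by simp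
    then show ?thesis by (simp add: A_def)
  qed
  have "inj (A w0)" using A0 by (simp add: inj_on_def)
  then obtain W where W: "open W" "w0 \<in> W" "W \<subseteq> \<Omega>" "\<And>z. z \<in> W \<Longrightarrow> bij (A z)"
    using linear_family_bij_near[OF F(1) lA smooth_on_imp_continuous_on[OF smA] F(2)] by blast
  define L where "L w v = s (inv_into UNIV (A w) v)" for w v
  show ?thesis
  proof (rule that[OF W(1,2)])
    show "W \<inter> S \<subseteq> U" using W(3) F(3) by blast
    show "smooth_on W (\<lambda>w. L w v)" for v
      unfolding L_def
    proof (rule smooth_on_linear_compose[OF ls smooth_on_inv_family[OF W(1)]])
      show "linear (A y)" if "y \<in> W" for y using lA W(3) that by blast
      show "bij (A y)" if "y \<in> W" for y using W(4) that by blast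
      show "smooth_on W (\<lambda>y. A y v)" for v by (rule smooth_on_subset[OF smA W(3)])
    qed
    fix w v assume w: "w \<in> W" "w \<in> S" and v: "v \<in> E"
    have w\<Omega>: "w \<in> \<Omega>" using w(1) W(3) by blast
    define y where "y = inv_into UNIV (A w) v"
    define e where "e = DF w (R (s (\<pi> y)) w)"
    have eE: "e \<in> E" unfolding e_def DF_def
      by (rule DF_tangent(1)[OF F(1,3,4,5) w\<Omega> w(2)]) (simp_all add: R_tangent[OF w(2)])
    have "A w y = v" unfolding y_def using W(4)[OF w(1)] by (simp add: bij_is_surj surj_f_inv_f)
    \<comment> \<open>Both \<open>v\<close> and \<open>e\<close> lie in \<open>E\<close>, which
      forces the solution \<open>y\<close> into \<open>E\<close>; on \<open>E\<close> the correction
      term \<open>y - \<pi> y\<close> vanishes.\<close>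
    then have v_eq: "v = y - \<pi> y + e" unfolding A_def e_def by simp
    then have "y - \<pi> y = v - e" by simp
    then have "y - \<pi> y \<in> E" using v eE E(1) by (simp add: subspace_diff)
    then have "\<pi> (y - \<pi> y) = y - \<pi> y" by (rule \<pi>(3))
    then have y\<pi>: "y = \<pi> y" using \<pi>(3)[OF \<pi>(2)] by (simp add: linear_diff[OF \<pi>(1)])
    then have "v = e" using v_eq by simp
    then have "D\<psi> (\<phi> w) v = D\<psi> (\<phi> w) (DF w (R (s y) w))" using y\<pi> by (simp add: e_def)
    also have "\<dots> = R (s y) w" unfolding DF_def
      by (rule DF_tangent(2)[OF F(1,3,4,5) w\<Omega> w(2)]) (simp_all add: R_tangent[OF w(2)])
    finally show "R (L w v) w = D\<psi> (\<phi> w) v" by (simp add: L_def y_def)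
  qed
qed

text \<open>In terms of a local lift \<open>L\<close>, the covector coordinates of
  \<open>f (Z, w)\<close> are the numbers \<open>Z \<bullet> L w (\<pi> b)\<close>, which depend
  smoothly on \<open>Z\<close> and \<open>w\<close>.\<close>

lemma smooth_ct_chart_f: "smooth_on CU (\<lambda>c. ct_chart (f c))"
proof (rule smooth_on_local)
  fix c assume c: "c \<in> CU"
  obtain W L where W: "open W" "snd c \<in> W" "\<And>v. smooth_on W (\<lambda>w. L w v :: 'l)" "W \<inter> S \<subseteq> U"
    "\<And>w v. w \<in> W \<Longrightarrow> w \<in> S \<Longrightarrow> v \<in> E \<Longrightarrow> R (L w v) w = D\<psi> (\<phi> w) v"
    using local_lift[of "snd c"] c by blast
  let ?N = "CU \<inter> (UNIV \<times> W)"
  have "openin (top_of_set CU) ?N" using W(1) by (simp add: open_Times openin_open_Int)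
  moreover have "c \<in> ?N" using c W(2) by (cases c) simp
  moreover have "smooth_on ?N (\<lambda>c. ct_chart (f c))"
  proof (rule smooth_on_cong)
    have sn: "smooth_on ?N snd" by (rule smooth_on_linear) (simp add: linear_iff)
    have ft: "smooth_on ?N fst" by (rule smooth_on_linear) (simp add: linear_iff)
    show "smooth_on ?N (\<lambda>c. (\<phi> (snd c), \<Sum>b\<in>Basis. (fst c \<bullet> L (snd c) (\<pi> b)) *\<^sub>R b))"
      by (intro smooth_on_Pair smooth_on_compose[OF sn smooth_\<phi>] smooth_on_sum smooth_on_scaleR
          smooth_on_inner ft smooth_on_compose[OF sn W(3)] smooth_on_const) auto
    fix c assume c: "c \<in> ?N"
    obtain Z w where Zw: "c = (Z, w)" by (cases c)
    have ZC: "(Z, w) \<in> C" and w: "w \<in> U" "w \<in> W" using c Zw by auto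
    have wS: "w \<in> S" using w U_subset by blast
    have "coords w (snd (f (Z, w))) = (\<Sum>b\<in>Basis. snd (f (Z, w)) (tvec S w (D\<psi> (\<phi> w) (\<pi> b))) *\<^sub>R b)"
      by (rule covector_coords_sum[OF w(1) f_cot[OF ZC]])
    also have "\<dots> = (\<Sum>b\<in>Basis. snd (f (Z, w)) (tvec S w (R (L w (\<pi> b)) w)) *\<^sub>R b)"
      using W(5)[OF w(2) wS \<pi>(2)] by simp
    also have "\<dots> = (\<Sum>b\<in>Basis. (Z \<bullet> L w (\<pi> b)) *\<^sub>R b)" by (simp add: f_tvec[OF ZC])
    finally show "(\<phi> (snd c), \<Sum>b\<in>Basis. (fst c \<bullet> L (snd c) (\<pi> b)) *\<^sub>R b) = ct_chart (f c)"
      unfolding Zw by (subst f_Pair) (simp add: ct_chart_def)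
  qed
  ultimately show "\<exists>W. openin (top_of_set CU) W \<and> c \<in> W \<and> smooth_on W (\<lambda>c. ct_chart (f c))"
    by blast
qed

text \<open>A covector with coordinates \<open>q\<close> takes on \<open>R b w\<close> the inner
  product of \<open>q\<close> with the image of \<open>R b w\<close> under the derivative of
  \<open>F\<close>. This is a smooth formula in \<open>q\<close> and \<open>w\<close>, and
  \<open>w\<close> is recovered from its coordinates by \<open>\<psi>\<close>.\<close>

lemma smooth_g_inv_ct_chart: "smooth_on (\<phi> ` U \<times> E) (\<lambda>z. g (inv_into ct_dom ct_chart z))"
proof (rule smooth_on_local)
  fix z assume "z \<in> \<phi> ` U \<times> E"
  then obtain w0 where w0: "w0 \<in> U" "fst z = \<phi> w0" by auto
  obtain \<Omega> F where F: "open \<Omega>" "w0 \<in> \<Omega>" "\<Omega> \<inter> S \<subseteq> U" "smooth_on \<Omega> F" "\<And>q. q \<in> \<Omega> \<Longrightarrow> q \<in> S \<Longrightarrow> F q = \<phi> q"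
    using chart_extension[OF w0(1)] by blast
  let ?N = "(\<phi> ` U \<times> E) \<inter> ((cdom \<inter> \<psi> -` \<Omega>) \<times> UNIV)"
  have "open (cdom \<inter> \<psi> -` \<Omega>)"
    by (rule continuous_open_preimage[OF smooth_on_imp_continuous_on[OF smooth_\<psi>] open_cdom F(1)])
  then have "openin (top_of_set (\<phi> ` U \<times> E)) ?N" by (simp add: open_Times openin_open_Int)
  moreover have "z \<in> ?N" using \<open>z \<in> \<phi> ` U \<times> E\<close> w0 \<phi>_in_cdom \<psi>_\<phi> F(2) by (cases z) auto
  moreover have "smooth_on ?N (\<lambda>z. g (inv_into ct_dom ct_chart z))"
  proof (rule smooth_on_cong)
    have sn: "smooth_on ?N snd" by (rule smooth_on_linear) (simp add: linear_iff)
    have ft: "smooth_on ?N fst" by (rule smooth_on_linear) (simp add: linear_iff)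
    have ps: "smooth_on ?N (\<lambda>z. \<psi> (fst z))" by (rule smooth_on_compose[OF ft smooth_\<psi>]) auto
    show "smooth_on ?N (\<lambda>z. (\<Sum>b\<in>Basis. (snd z \<bullet> frechet_derivative F (at (\<psi> (fst z))) (R b (\<psi> (fst z)))) *\<^sub>R b, \<psi> (fst z)))"
      by (intro smooth_on_Pair smooth_on_sum smooth_on_scaleR smooth_on_inner sn ps smooth_on_const
          smooth_on_frechet_derivative'[OF F(1,4)] smooth_on_linear_compose[OF linear_R2]) auto
    fix z assume z: "z \<in> ?N"
    then have "z \<in> ct_chart ` ct_dom" unfolding ct_chart_image by blast
    then obtain w \<alpha> where w\<alpha>: "(w, \<alpha>) \<in> ct_dom" "z = ct_chart (w, \<alpha>)" by auto
    then have w: "w \<in> U" "\<alpha> \<in> cotangent_space (submanifold S) w" and zeq: "z = (\<phi> w, coords w \<alpha>)"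
      unfolding ct_dom_def ct_chart_def by auto
    have wS: "w \<in> S" using w U_subset by blast
    have \<psi>z: "\<psi> (fst z) = w" using \<psi>_\<phi>[OF w(1)] zeq by simp
    have w\<Omega>: "w \<in> \<Omega>" using z \<psi>z by auto
    have "\<alpha> (tvec S w (R b w)) = coords w \<alpha> \<bullet> frechet_derivative F (at w) (R b w)" for b
    proof -
      note d = DF_tangent[OF F(1,3,4,5) w\<Omega> wS R_tangent[OF wS, of b]]
      show ?thesis using covector_coords(2)[OF w d(1)] d(2) by simp
    qed
    then have "g (w, \<alpha>) = (\<Sum>b\<in>Basis. (coords w \<alpha> \<bullet> frechet_derivative F (at w) (R b w)) *\<^sub>R b, w)"
      by (simp add: g_def)
    moreover have "inv_into ct_dom ct_chart z = (w, \<alpha>)"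
      unfolding w\<alpha>(2) by (rule inv_into_f_f[OF inj_on_ct_chart w\<alpha>(1)])
    ultimately show "(\<Sum>b\<in>Basis. (snd z \<bullet> frechet_derivative F (at (\<psi> (fst z))) (R b (\<psi> (fst z)))) *\<^sub>R b, \<psi> (fst z))
        = g (inv_into ct_dom ct_chart z)"
      unfolding \<psi>z by (simp add: zeq)
  qed
  ultimately show "\<exists>W. openin (top_of_set (\<phi> ` U \<times> E)) W \<and> z \<in> W \<and>
      smooth_on W (\<lambda>z. g (inv_into ct_dom ct_chart z))"
    by blast
qed

lemma f_in_ct_dom: "c \<in> C \<Longrightarrow> f c \<in> ct_dom \<longleftrightarrow> snd c \<in> U"
  using f_cot[of "fst c" "snd c"] fst_f[of c] unfolding ct_dom_def by (cases "f c") auto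

lemma g_in_CU: "z \<in> ct_dom \<Longrightarrow> g z \<in> CU"
  using g_in_C[of "fst z" "snd z"] U_subset unfolding ct_dom_def by (auto simp: g_def)

lemma f_g_ct_dom: "z \<in> ct_dom \<Longrightarrow> f (g z) = z"
  using f_g[of "fst z" "snd z"] U_subset unfolding ct_dom_def by auto

end

section \<open>Manifold structure of the cotangent bundle\<close>

context cotangent_model
begin

definition "CB = cotangent_bundle (submanifold S)"

lemma cotangent_model_chart_exists:
  assumes "(U, \<phi>) \<in> atlas (submanifold S)"
  obtains E \<pi> where "cotangent_model_chart S R n U \<phi> E \<pi>"
proof -
  obtain E \<pi> where "submanifold_chart S U \<phi> E \<pi>"
    using submanifold_chart_exists[OF SC(1) assms] by blast
  then have "cotangent_model_chart S R n U \<phi> E \<pi>"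
    by (intro cotangent_model_chart.intro cotangent_model_axioms)
  then show ?thesis by (rule that)
qed

lemma CB_atlasE:
  assumes "(D, \<Phi>) \<in> atlas CB"
  obtains U \<phi> E \<pi> where "cotangent_model_chart S R n U \<phi> E \<pi>"
    "D = submanifold_chart.ct_dom S U" "\<Phi> = submanifold_chart.ct_chart S U \<phi>"
proof -
  obtain U \<phi> where c: "(U, \<phi>) \<in> atlas (submanifold S)" "(D, \<Phi>) = cotangent_chart (submanifold S) (U, \<phi>)"
    using assms unfolding CB_def cotangent_bundle_def by auto
  obtain E \<pi> where m: "cotangent_model_chart S R n U \<phi> E \<pi>"
    using cotangent_model_chart_exists[OF c(1)] by blast
  interpret ch: cotangent_model_chart S R n U \<phi> E \<pi> by (rule m)
  show ?thesis by (rule that[OF m]) (use c(2) ch.cotangent_chart_eq in simp_all)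
qed

lemma CB_atlasI:
  assumes "cotangent_model_chart S R n U \<phi> E \<pi>"
  shows "(submanifold_chart.ct_dom S U, submanifold_chart.ct_chart S U \<phi>) \<in> atlas CB"
proof -
  interpret ch: cotangent_model_chart S R n U \<phi> E \<pi> by (rule assms)
  show ?thesis
    using ch.chart ch.cotangent_chart_eq unfolding CB_def cotangent_bundle_def
    by (simp add: image_iff) (metis)
qed

lemma chart_at:
  assumes "w \<in> S"
  obtains U \<phi> E \<pi> where "cotangent_model_chart S R n U \<phi> E \<pi>" "w \<in> U"
proof -
  obtain U \<phi> where "(U, \<phi>) \<in> atlas (submanifold S)" "w \<in> U"
    using SC(1) assms unfolding has_charts_def by blast
  then show ?thesis using that cotangent_model_chart_exists by metis
qed

lemma mtop_CB: "mtop CB = topology_generated_by {{z \<in> D. \<Phi> z \<in> Q} | D \<Phi> Q. (D, \<Phi>) \<in> atlas CB \<and> open Q}"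
  unfolding CB_def cotangent_bundle_def by simp

lemma CB_dom_subset: "(D, \<Phi>) \<in> atlas CB \<Longrightarrow> D \<subseteq> Sigma S cotS"
proof (elim CB_atlasE)
  fix U \<phi> E \<pi> assume m: "cotangent_model_chart S R n U \<phi> E \<pi>" and D: "D = submanifold_chart.ct_dom S U"
  interpret ch: cotangent_model_chart S R n U \<phi> E \<pi> by (rule m)
  show ?thesis unfolding D ch.ct_dom_def using ch.U_subset by blast
qed

lemma CB_generator: "(D, \<Phi>) \<in> atlas CB \<Longrightarrow> open Q \<Longrightarrow> openin (mtop CB) {z \<in> D. \<Phi> z \<in> Q}"
  unfolding mtop_CB by (rule topology_generated_by_Basis) blast

lemma CB_dom_openin: "(D, \<Phi>) \<in> atlas CB \<Longrightarrow> openin (mtop CB) D"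
  using CB_generator[of D \<Phi> UNIV] by simp

lemma CB_cover:
  assumes "z \<in> Sigma S cotS"
  obtains U \<phi> E \<pi> where "cotangent_model_chart S R n U \<phi> E \<pi>" "z \<in> submanifold_chart.ct_dom S U"
proof -
  have "fst z \<in> S" using assms by auto
  then obtain U \<phi> E \<pi> where m: "cotangent_model_chart S R n U \<phi> E \<pi>" "fst z \<in> U"
    using chart_at by metis
  interpret ch: cotangent_model_chart S R n U \<phi> E \<pi> by (rule m(1))
  have "z \<in> ch.ct_dom" using assms m(2) unfolding ch.ct_dom_def by auto
  then show ?thesis by (rule that[OF m(1)])
qed

lemma topspace_CB: "topspace (mtop CB) = Sigma S cotS"
proof (intro equalityI subsetI)
  fix z assume "z \<in> topspace (mtop CB)"
  then show "z \<in> Sigma S cotS"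
    unfolding mtop_CB topology_generated_by_topspace using CB_dom_subset by blast
next
  fix z assume "z \<in> Sigma S cotS"
  then obtain U \<phi> E \<pi> where m: "cotangent_model_chart S R n U \<phi> E \<pi>" "z \<in> submanifold_chart.ct_dom S U"
    by (rule CB_cover)
  then show "z \<in> topspace (mtop CB)"
    using CB_dom_openin[OF CB_atlasI[OF m(1)]] openin_subset by blast
qed

lemma f_in: "c \<in> C \<Longrightarrow> f c \<in> Sigma S cotS"
  using f_cot[of "fst c" "snd c"] fst_f[of c] by (cases "f c") (auto simp: C_def)

lemma g_in: "z \<in> Sigma S cotS \<Longrightarrow> g z \<in> C"
  using g_in_C[of "fst z" "snd z"] by auto

lemma f_g': "z \<in> Sigma S cotS \<Longrightarrow> f (g z) = z"
  using f_g[of "fst z" "snd z"] by auto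

lemma continuous_f: "continuous_map (top_of_set C) (mtop CB) f"
  unfolding mtop_CB continuous_on_generated_topo_iff
proof (intro conjI allI impI)
  fix T assume "T \<in> {{z \<in> D. \<Phi> z \<in> Q} | D \<Phi> Q. (D, \<Phi>) \<in> atlas CB \<and> open Q}"
  then obtain D \<Phi> Q where T: "T = {z \<in> D. \<Phi> z \<in> Q}" "(D, \<Phi>) \<in> atlas CB" "open Q" by auto
  obtain U \<phi> E \<pi> where m: "cotangent_model_chart S R n U \<phi> E \<pi>"
    and D: "D = submanifold_chart.ct_dom S U" "\<Phi> = submanifold_chart.ct_chart S U \<phi>"
    using T(2) by (rule CB_atlasE)
  interpret ch: cotangent_model_chart S R n U \<phi> E \<pi> by (rule m)
  have "openin (top_of_set ch.CU) (ch.CU \<inter> (\<lambda>c. \<Phi> (f c)) -` Q)"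
    unfolding D using smooth_on_imp_continuous_on[OF ch.smooth_ct_chart_f] T(3)
    by (rule continuous_openin_preimage_gen)
  then have "openin (top_of_set C) (ch.CU \<inter> (\<lambda>c. \<Phi> (f c)) -` Q)"
    using ch.openin_CU by (rule openin_trans)
  moreover have "ch.CU \<inter> (\<lambda>c. \<Phi> (f c)) -` Q = f -` T \<inter> topspace (top_of_set C)"
    using ch.f_in_ct_dom by (auto simp: T(1) D)
  ultimately show "openin (top_of_set C) (f -` T \<inter> topspace (top_of_set C))" by simp
next
  have "f ` topspace (top_of_set C) \<subseteq> topspace (mtop CB)"
    unfolding topspace_CB by (rule image_subsetI, rule f_in) simp
  then show "f ` topspace (top_of_set C) \<subseteq> \<Union> {{z \<in> D. \<Phi> z \<in> Q} | D \<Phi> Q. (D, \<Phi>) \<in> atlas CB \<and> open Q}"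
    unfolding mtop_CB topology_generated_by_topspace .
qed

lemma continuous_g: "continuous_map (mtop CB) (top_of_set C) g"
  unfolding continuous_map_def
proof (intro conjI allI impI)
  show "g \<in> topspace (mtop CB) \<rightarrow> topspace (top_of_set C)" using g_in unfolding topspace_CB by auto
  fix V assume V: "openin (top_of_set C) V"
  show "openin (mtop CB) {z \<in> topspace (mtop CB). g z \<in> V}"
  proof (subst openin_subopen, intro ballI)
    fix z assume z: "z \<in> {z \<in> topspace (mtop CB). g z \<in> V}"
    then have "z \<in> Sigma S cotS" unfolding topspace_CB by blast
    then obtain U \<phi> E \<pi> where m: "cotangent_model_chart S R n U \<phi> E \<pi>" "z \<in> submanifold_chart.ct_dom S U"
      by (rule CB_cover)
    interpret ch: cotangent_model_chart S R n U \<phi> E \<pi> by (rule m(1))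
    let ?k = "\<lambda>y. g (inv_into ch.ct_dom ch.ct_chart y)" and ?Y = "\<phi> ` U \<times> E"
    obtain P where P: "open P" "V = C \<inter> P" using V by (auto simp: openin_open)
    have "openin (top_of_set ?Y) (?Y \<inter> ?k -` P)"
      using smooth_on_imp_continuous_on[OF ch.smooth_g_inv_ct_chart] P(1)
      by (rule continuous_openin_preimage_gen)
    \<comment> \<open>The generators of the topology are chart preimages of open sets of the whole
      coordinate space, so the relatively open set has to be cut out by such a
      \<open>Q\<close>.\<close>
    then obtain Q where Q: "open Q" "?Y \<inter> ?k -` P = ?Y \<inter> Q" by (auto simp: openin_open)
    let ?O = "{z \<in> ch.ct_dom. ch.ct_chart z \<in> Q}"
    have iff: "ch.ct_chart y \<in> Q \<longleftrightarrow> g y \<in> V" if y: "y \<in> ch.ct_dom" for y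
    proof -
      have Y: "ch.ct_chart y \<in> ?Y" using y ch.ct_chart_image by blast
      have "ch.ct_chart y \<in> ?Y \<inter> Q \<longleftrightarrow> ch.ct_chart y \<in> ?Y \<inter> ?k -` P" by (simp only: Q(2))
      then have "ch.ct_chart y \<in> Q \<longleftrightarrow> ?k (ch.ct_chart y) \<in> P"
        unfolding Int_iff vimage_eq using Y by (simp only: simp_thms)
      also have "?k (ch.ct_chart y) = g y" by (simp add: inv_into_f_f[OF ch.inj_on_ct_chart y])
      finally show ?thesis using ch.g_in_CU[OF y] P(2) by blast
    qed
    have "openin (mtop CB) ?O" by (rule CB_generator[OF CB_atlasI[OF m(1)] Q(1)])
    moreover have "z \<in> ?O" using iff[OF m(2)] m(2) z by blast
    moreover have "?O \<subseteq> {z \<in> topspace (mtop CB). g z \<in> V}"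
      using iff CB_dom_openin[OF CB_atlasI[OF m(1)], THEN openin_subset] by blast
    ultimately show "\<exists>T. openin (mtop CB) T \<and> z \<in> T \<and> T \<subseteq> {z \<in> topspace (mtop CB). g z \<in> V}" by blast
  qed
qed

text \<open>The source of the Hausdorff property and of second countability: both hold for
  \<open>C\<close> as a subset of a Euclidean space.\<close>

lemma homeomorphic_maps_f_g: "homeomorphic_maps (top_of_set C) (mtop CB) f g"
  unfolding homeomorphic_maps_def using continuous_f continuous_g g_f f_g'
  by (simp add: topspace_CB)

text \<open>Continuity of the chart and of its inverse is obtained by a detour through
  \<open>C\<close>: the chart is \<open>g\<close> followed by the smooth map
  \<open>c \<mapsto> ch.ct_chart (f c)\<close>, and its inverse is \<open>f\<close> after
  \<open>?k\<close>.\<close>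

lemma CB_chart_homeomorphic:
  assumes "cotangent_model_chart S R n U \<phi> E \<pi>"
  shows "homeomorphic_map (subtopology (mtop CB) (submanifold_chart.ct_dom S U))
    (top_of_set (submanifold_chart.ct_chart S U \<phi> ` submanifold_chart.ct_dom S U)) (submanifold_chart.ct_chart S U \<phi>)"
proof -
  interpret ch: cotangent_model_chart S R n U \<phi> E \<pi> by (rule assms)
  have D: "ch.ct_dom \<subseteq> topspace (mtop CB)"
    by (rule openin_subset[OF CB_dom_openin[OF CB_atlasI[OF assms]]])
  let ?k = "\<lambda>y. g (inv_into ch.ct_dom ch.ct_chart y)" and ?Y = "\<phi> ` U \<times> E"
  have kC: "?k y \<in> ch.CU" if "y \<in> ?Y" for y
    using ch.g_in_CU inv_into_into[of y ch.ct_chart ch.ct_dom] that ch.ct_chart_image by blast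
  have fk: "f (?k y) = inv_into ch.ct_dom ch.ct_chart y" if "y \<in> ?Y" for y
    using ch.f_g_ct_dom inv_into_into[of y ch.ct_chart ch.ct_dom] that ch.ct_chart_image by blast
  have "homeomorphic_maps (subtopology (mtop CB) ch.ct_dom) (top_of_set ?Y) ch.ct_chart (\<lambda>y. f (?k y))"
    unfolding homeomorphic_maps_def
  proof (intro conjI ballI)
    have "continuous_map (subtopology (mtop CB) ch.ct_dom) (top_of_set C) g"
      by (rule continuous_map_from_subtopology[OF continuous_g])
    then have g: "continuous_map (subtopology (mtop CB) ch.ct_dom) (top_of_set ch.CU) g"
      using ch.g_in_CU by (auto simp: continuous_map_in_subtopology)
    have "continuous_map (top_of_set ch.CU) euclidean (\<lambda>c. ch.ct_chart (f c))"
      using smooth_on_imp_continuous_on[OF ch.smooth_ct_chart_f] by simp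
    from continuous_map_compose[OF g this]
    have "continuous_map (subtopology (mtop CB) ch.ct_dom) euclidean ch.ct_chart"
      by (rule continuous_map_eq) (simp add: ch.f_g_ct_dom)
    then show "continuous_map (subtopology (mtop CB) ch.ct_dom) (top_of_set ?Y) ch.ct_chart"
      using ch.ct_chart_image by (auto simp: continuous_map_in_subtopology)
    have "continuous_map (top_of_set ?Y) (top_of_set C) ?k"
      using smooth_on_imp_continuous_on[OF ch.smooth_g_inv_ct_chart] kC
      by (auto simp: continuous_map_in_subtopology)
    from continuous_map_compose[OF this continuous_f]
    have "continuous_map (top_of_set ?Y) (mtop CB) (\<lambda>y. f (?k y))" by (simp add: comp_def)
    then show "continuous_map (top_of_set ?Y) (subtopology (mtop CB) ch.ct_dom) (\<lambda>y. f (?k y))"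
      using fk inv_into_into[of _ ch.ct_chart ch.ct_dom] ch.ct_chart_image
      by (auto simp: continuous_map_in_subtopology Pi_iff)
  next
    fix x assume "x \<in> topspace (subtopology (mtop CB) ch.ct_dom)"
    then have x: "x \<in> ch.ct_dom" by simp
    then show "f (?k (ch.ct_chart x)) = x"
      by (simp add: inv_into_f_f[OF ch.inj_on_ct_chart x] ch.f_g_ct_dom)
  next
    fix y assume "y \<in> topspace (top_of_set ?Y)"
    then have y: "y \<in> ?Y" by simp
    then show "ch.ct_chart (f (?k y)) = y"
      unfolding fk[OF y] using ch.ct_chart_image by (simp add: f_inv_into_f)
  qed
  then show ?thesis unfolding ch.ct_chart_image homeomorphic_map_maps by blast
qed

text \<open>Inserting \<open>f\<close> after \<open>g\<close> factors the transition map through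
  \<open>C\<close> into two maps known to be smooth. The transformation rule for covector
  coordinates never has to be computed.\<close>

lemma CB_transition:
  assumes "(D, \<Phi>) \<in> atlas CB" "(D', \<Phi>') \<in> atlas CB"
  shows "smooth_on (\<Phi> ` (D \<inter> D')) (\<Phi>' \<circ> inv_into D \<Phi>)"
proof -
  obtain U \<phi> E \<pi> where m: "cotangent_model_chart S R n U \<phi> E \<pi>"
    and D: "D = submanifold_chart.ct_dom S U" "\<Phi> = submanifold_chart.ct_chart S U \<phi>"
    using assms(1) by (rule CB_atlasE)
  interpret ch: cotangent_model_chart S R n U \<phi> E \<pi> by (rule m)
  obtain U' \<phi>' E' \<pi>' where m': "cotangent_model_chart S R n U' \<phi>' E' \<pi>'"
    and D': "D' = submanifold_chart.ct_dom S U'" "\<Phi>' = submanifold_chart.ct_chart S U' \<phi>'"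
    using assms(2) by (rule CB_atlasE)
  interpret ch': cotangent_model_chart S R n U' \<phi>' E' \<pi>' by (rule m')
  have inv: "inv_into D \<Phi> (\<Phi> z) = z" if "z \<in> D" for z
    unfolding D using inv_into_f_f[OF ch.inj_on_ct_chart] that D by simp
  have "smooth_on (\<Phi> ` (D \<inter> D')) (\<lambda>y. g (inv_into D \<Phi> y))"
    unfolding D by (rule smooth_on_subset[OF ch.smooth_g_inv_ct_chart]) (use ch.ct_chart_image in blast)
  then have "smooth_on (\<Phi> ` (D \<inter> D')) (\<lambda>y. ch'.ct_chart (f (g (inv_into D \<Phi> y))))"
    by (rule smooth_on_compose[OF _ ch'.smooth_ct_chart_f]) (use inv ch'.g_in_CU D' in auto)
  then show ?thesis
    by (rule smooth_on_cong[rotated]) (use inv ch'.f_g_ct_dom D' in auto)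
qed

lemma CB_dim:
  assumes "(D, \<Phi>) \<in> atlas CB"
  shows "\<exists>E. subspace E \<and> dim E = 2 * n \<and> openin (top_of_set E) (\<Phi> ` D)"
proof -
  obtain U \<phi> E \<pi> where m: "cotangent_model_chart S R n U \<phi> E \<pi>"
    and D: "D = submanifold_chart.ct_dom S U" "\<Phi> = submanifold_chart.ct_chart S U \<phi>"
    using assms(1) by (rule CB_atlasE)
  interpret ch: cotangent_model_chart S R n U \<phi> E \<pi> by (rule m)
  show ?thesis
  proof (cases "U = {}")
    \<comment> \<open>For an empty chart the square of any tangent space serves as the coordinate
      space of dimension \<open>2 * n\<close>.\<close>
    case True
    obtain w where w: "w \<in> S" using SC(2) by blast
    let ?T = "tangent_vectors S w"
    have "subspace ?T" by (rule subspace_tangent_vectors[OF SC(1) w])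
    moreover have "\<Phi> ` D = {}" using True ch.ct_chart_image D by simp
    ultimately show ?thesis using dim[OF w]
      by (intro exI[of _ "?T \<times> ?T"]) (simp add: dim_Times subspace_Times)
  next
    case False
    then obtain w where "w \<in> U" by blast
    then have "dim E = n" using ch.dim_tangent_vectors dim ch.U_subset by (metis subsetD)
    moreover have "openin (top_of_set (E \<times> E)) (\<phi> ` U \<times> E)"
      by (rule openin_Times[OF ch.E(2)]) simp
    ultimately show ?thesis unfolding D ch.ct_chart_image using ch.E(1)
      by (intro exI[of _ "E \<times> E"]) (simp add: dim_Times subspace_Times)
  qed
qed

lemma smooth_manifold_CB: "smooth_manifold CB"
proof -
  have hs: "top_of_set C homeomorphic_space mtop CB"
    using homeomorphic_maps_f_g homeomorphic_space_def by blast
  have "Hausdorff_space (mtop CB)"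
    using homeomorphic_Hausdorff_space[OF hs] by (simp add: Hausdorff_space_subtopology)
  moreover have "second_countable (mtop CB)"
    using homeomorphic_space_second_countability[OF hs]
    by (simp add: second_countable_subtopology second_countable_euclidean)
  moreover have "\<Union> (fst ` atlas CB) = topspace (mtop CB)"
  proof (intro equalityI subsetI)
    fix z assume "z \<in> \<Union> (fst ` atlas CB)"
    then obtain D \<Phi> where "(D, \<Phi>) \<in> atlas CB" "z \<in> D" by force
    then show "z \<in> topspace (mtop CB)" using CB_dom_subset topspace_CB by blast
  next
    fix z assume "z \<in> topspace (mtop CB)"
    then have "z \<in> Sigma S cotS" unfolding topspace_CB .
    then obtain U \<phi> E \<pi> where m: "cotangent_model_chart S R n U \<phi> E \<pi>" "z \<in> submanifold_chart.ct_dom S U"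
      by (rule CB_cover)
    then show "z \<in> \<Union> (fst ` atlas CB)" using CB_atlasI[OF m(1)] by force
  qed
  moreover have "homeomorphic_map (subtopology (mtop CB) D) (top_of_set (\<Phi> ` D)) \<Phi>" if "(D, \<Phi>) \<in> atlas CB" for D \<Phi>
    using that
  proof (rule CB_atlasE)
    fix U \<phi> E \<pi> assume "cotangent_model_chart S R n U \<phi> E \<pi>"
      "D = submanifold_chart.ct_dom S U" "\<Phi> = submanifold_chart.ct_chart S U \<phi>"
    then show ?thesis using CB_chart_homeomorphic by simp
  qed
  ultimately show ?thesis
    unfolding smooth_manifold_def using CB_dom_openin CB_dim CB_transition
    by (auto intro!: exI[of _ "2 * n"])
qed

section \<open>The model as a submanifold and its diffeomorphism with the bundle\<close>

text \<open>Charts of \<open>submanifold C\<close> take values in \<open>'l \<times> 'a\<close>, those of the cotangent bundle in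
  \<open>'a \<times> 'a\<close>; the linear map \<open>j\<close> injects \<open>E\<close> into \<open>'l\<close>.\<close>

lemma C_chart:
  assumes c: "c \<in> C"
  obtains X \<eta> E' where "(X, \<eta>) \<in> atlas (submanifold C)" "c \<in> X" "subspace E'" "dim E' = 2 * n"
    "openin (top_of_set E') (\<eta> ` X)"
proof -
  have w: "snd c \<in> S" using c by (auto simp: C_def)
  obtain U \<phi> E \<pi> where m: "cotangent_model_chart S R n U \<phi> E \<pi>" "snd c \<in> U"
    using chart_at[OF w] by blast
  interpret ch: cotangent_model_chart S R n U \<phi> E \<pi> by (rule m(1))
  obtain W L where W: "snd c \<in> W" "\<And>w v. w \<in> W \<Longrightarrow> w \<in> S \<Longrightarrow> v \<in> E \<Longrightarrow> R (L w v :: 'l) w = ch.D\<psi> (\<phi> w) v"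
    using ch.local_lift[OF m(2)] by metis
  have dE: "dim E = n" using ch.dim_tangent_vectors[OF m(2)] dim[OF w] by simp
  obtain \<Omega> F where F: "open \<Omega>" "snd c \<in> \<Omega>" "\<Omega> \<inter> S \<subseteq> U" "smooth_on \<Omega> F" "\<And>q. q \<in> \<Omega> \<Longrightarrow> q \<in> S \<Longrightarrow> F q = \<phi> q"
    using ch.chart_extension[OF m(2)] by blast
  \<comment> \<open>By the local lift, \<open>E\<close> lies in the range of this map, so a right
    inverse \<open>j\<close> embeds \<open>E\<close> into \<open>'l\<close>.\<close>
  define j' where "j' Z = frechet_derivative F (at (snd c)) (R Z (snd c))" for Z
  have lF: "linear (frechet_derivative F (at (snd c)))"
    using smooth_on_has_derivative[OF F(1,4,2)] has_derivative_linear by blast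
  have lj': "linear j'"
    by (rule linearI) (simp_all add: j'_def linear_add[OF linear_R] linear_cmul[OF linear_R]
        linear_add[OF lF] linear_cmul[OF lF])
  have "E \<subseteq> range j'"
  proof
    fix v assume v: "v \<in> E"
    have "j' (L (snd c) v) = v"
      unfolding j'_def W(2)[OF W(1) w v] using ch.DF_D\<psi>[OF F(1,3,4,5,2) w v] by simp
    then show "v \<in> range j'" by (metis rangeI)
  qed
  moreover obtain j where j: "linear j" "\<And>v. v \<in> range j' \<Longrightarrow> j' (j v) = v"
    using linear_exists_right_inverse_on[OF lj' subspace_UNIV] by blast
  ultimately have jj: "j' (j v) = v" if "v \<in> E" for v using that by blast
  \<comment> \<open>Besides applying \<open>j\<close>, it swaps base and fiber coordinates: elements
    of \<open>C\<close> carry the fiber component first.\<close>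
  define J where "J = (\<lambda>(a :: 'a, q). (j q, a))"
  define J' where "J' = (\<lambda>(y, a :: 'a). (a, j' y))"
  define \<eta> where "\<eta> c = J (ch.ct_chart (f c))" for c
  let ?Y = "\<phi> ` U \<times> E" and ?k = "\<lambda>y. g (inv_into ch.ct_dom ch.ct_chart y)"
  have J: "J' (J z) = z" if "z \<in> ?Y" for z using that jj by (auto simp: J_def J'_def)
  have cf: "ch.ct_chart (f c) \<in> ?Y" "?k (ch.ct_chart (f c)) = c" if c: "c \<in> ch.CU" for c
  proof -
    have fc: "f c \<in> ch.ct_dom" using ch.f_in_ct_dom c by blast
    then show "ch.ct_chart (f c) \<in> ?Y" using ch.ct_chart_image by blast
    show "?k (ch.ct_chart (f c)) = c"
      using inv_into_f_f[OF ch.inj_on_ct_chart fc] g_f c by simp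
  qed
  have kf: "?k y \<in> ch.CU" "ch.ct_chart (f (?k y)) = y" if y: "y \<in> ?Y" for y
  proof -
    have i: "inv_into ch.ct_dom ch.ct_chart y \<in> ch.ct_dom"
      using inv_into_into[of y ch.ct_chart ch.ct_dom] y ch.ct_chart_image by blast
    then show "?k y \<in> ch.CU" by (rule ch.g_in_CU)
    show "ch.ct_chart (f (?k y)) = y"
      using ch.f_g_ct_dom[OF i] y ch.ct_chart_image by (simp add: f_inv_into_f)
  qed
  have im: "\<eta> ` ch.CU = j ` E \<times> \<phi> ` U"
  proof -
    have "(\<lambda>c. ch.ct_chart (f c)) ` ch.CU = ?Y"
    proof (rule equalityI)
      show "(\<lambda>c. ch.ct_chart (f c)) ` ch.CU \<subseteq> ?Y" by (rule image_subsetI) (rule cf(1))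
      show "?Y \<subseteq> (\<lambda>c. ch.ct_chart (f c)) ` ch.CU"
      proof
        fix y assume y: "y \<in> ?Y"
        show "y \<in> (\<lambda>c. ch.ct_chart (f c)) ` ch.CU"
          by (rule image_eqI[where x = "?k y"]) (use kf[OF y] in simp_all)
      qed
    qed
    moreover have "\<eta> ` ch.CU = J ` ((\<lambda>c. ch.ct_chart (f c)) ` ch.CU)"
      unfolding \<eta>_def image_image ..
    ultimately have "\<eta> ` ch.CU = J ` ?Y" by simp
    also have "\<dots> = j ` E \<times> \<phi> ` U" by (auto simp: J_def)
    finally show ?thesis .
  qed
  have inv: "?k (J' (\<eta> c)) = c" if "c \<in> ch.CU" for c
    unfolding \<eta>_def using J cf[OF that] by simp
  have inj: "inj_on \<eta> ch.CU" by (rule inj_on_inverseI[of _ "\<lambda>y. ?k (J' y)"]) (rule inv)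
  have lJ: "linear J" "linear J'"
    by (rule linearI; auto simp: J_def J'_def linear_add[OF j(1)] linear_cmul[OF j(1)]
        linear_add[OF lj'] linear_cmul[OF lj'])+
  have s1: "smooth_on ch.CU \<eta>" unfolding \<eta>_def
    by (rule smooth_on_linear_compose[OF lJ(1) ch.smooth_ct_chart_f])
  have "smooth_on (\<eta> ` ch.CU) (\<lambda>y. ?k (J' y))"
    by (rule smooth_on_compose[OF smooth_on_linear[OF lJ(2)] ch.smooth_g_inv_ct_chart])
      (auto simp: \<eta>_def J cf(1))
  then have s2: "smooth_on (\<eta> ` ch.CU) (inv_into ch.CU \<eta>)"
    by (rule smooth_on_cong[rotated]) (use inv inv_into_f_f[OF inj] in auto)
  have sj: "subspace (j ` E)" by (rule linear_subspace_image[OF j(1) ch.E(1)])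
  have E': "subspace (j ` E \<times> E)" using sj ch.E(1) by (rule subspace_Times)
  have o: "openin (top_of_set (j ` E \<times> E)) (\<eta> ` ch.CU)" unfolding im
    by (rule openin_Times[OF _ ch.E(2)]) simp
  have "inj_on j E" by (rule inj_on_inverseI[of _ j']) (rule jj)
  then have "dim (j ` E) = dim E"
    by (intro dim_image_eq[OF j(1)]) (use ch.E(1) in \<open>simp add: span_eq_iff[THEN iffD2]\<close>)
  then have d: "dim (j ` E \<times> E) = 2 * n" using dE sj ch.E(1) by (simp add: dim_Times)
  show ?thesis
  proof (rule that[OF _ _ E' d o])
    show "(ch.CU, \<eta>) \<in> atlas (submanifold C)"
      unfolding submanifold_atlas using ch.openin_CU inj s1 s2 E' o by blast
    show "c \<in> ch.CU" using c m(2) by blast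
  qed
qed

lemma has_charts_C: "has_charts C"
  unfolding has_charts_def using C_chart by metis

lemma smooth_manifold_C: "smooth_manifold (submanifold C)"
proof (rule smooth_manifold_submanifold[OF has_charts_C, where n = "2 * n"])
  fix c assume c: "c \<in> C"
  obtain X \<eta> E' where X: "(X, \<eta>) \<in> atlas (submanifold C)" "c \<in> X" "subspace E'" "dim E' = 2 * n"
    "openin (top_of_set E') (\<eta> ` X)"
    using C_chart[OF c] by blast
  obtain \<pi> where \<pi>: "linear \<pi>" "\<And>x. \<pi> x \<in> E'" "\<And>v. v \<in> E' \<Longrightarrow> \<pi> v = v" "\<And>x v. v \<in> E' \<Longrightarrow> \<pi> x \<bullet> v = x \<bullet> v"
    using orthogonal_projection_exists[OF X(3)] by blast
  have "submanifold_chart C X \<eta> E' \<pi>"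
    by (rule submanifold_chart.intro[OF has_charts_C X(1,3,5) \<pi>])
  then show "dim (tangent_vectors C c) = 2 * n"
    using submanifold_chart.dim_tangent_vectors X(2,4) by metis
next
  obtain w where "w \<in> S" using SC(2) by blast
  then have "(0, w) \<in> C" unfolding C_def by (auto intro!: exI[of _ 0])
  then show "C \<noteq> {}" by blast
qed

lemma smooth_manifold_S: "smooth_manifold (submanifold S)"
  by (rule smooth_manifold_submanifold[OF SC(1) dim SC(2)])

lemma diffeomorphism_f: "diffeomorphism (submanifold C) CB f"
  unfolding diffeomorphism_def
proof (intro conjI exI[of _ g])
  note chC = charted_submanifold[OF has_charts_C]
  note chB = smooth_manifold_charted[OF smooth_manifold_CB]
  show "smooth_map (submanifold C) CB f"
  proof (rule smooth_mapI[OF chB _ _ chC])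
    show "continuous_map (mtop (submanifold C)) (mtop CB) f" using continuous_f by simp
    fix D \<Phi> assume "(D, \<Phi>) \<in> atlas CB"
    then obtain U \<phi> E \<pi> where m: "cotangent_model_chart S R n U \<phi> E \<pi>"
      and D: "D = submanifold_chart.ct_dom S U" "\<Phi> = submanifold_chart.ct_chart S U \<phi>"
      by (rule CB_atlasE)
    interpret ch: cotangent_model_chart S R n U \<phi> E \<pi> by (rule m)
    have e: "{p \<in> topspace (mtop (submanifold C)). f p \<in> D} = ch.CU"
      unfolding D using ch.f_in_ct_dom by auto
    show "smooth_fun (submanifold C) {p \<in> topspace (mtop (submanifold C)). f p \<in> D} (\<Phi> \<circ> f)"
      unfolding e unfolding smooth_fun_submanifold[OF has_charts_C] comp_def D
      using ch.openin_CU ch.smooth_ct_chart_f by blast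
  qed
  show "smooth_map CB (submanifold C) g"
    unfolding smooth_map_into_submanifold[OF chB has_charts_C] smooth_fun_def
  proof (intro conjI allI impI)
    show "g ` topspace (mtop CB) \<subseteq> C" unfolding topspace_CB using g_in by blast
    fix D \<Phi> assume d: "(D, \<Phi>) \<in> atlas CB"
    then obtain U \<phi> E \<pi> where m: "cotangent_model_chart S R n U \<phi> E \<pi>"
      and D: "D = submanifold_chart.ct_dom S U" "\<Phi> = submanifold_chart.ct_chart S U \<phi>"
      by (rule CB_atlasE)
    interpret ch: cotangent_model_chart S R n U \<phi> E \<pi> by (rule m)
    show "smooth_on (\<Phi> ` (D \<inter> topspace (mtop CB))) (g \<circ> inv_into D \<Phi>)"
      unfolding D comp_def
      by (rule smooth_on_subset[OF ch.smooth_g_inv_ct_chart]) (use ch.ct_chart_image in blast)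
  qed simp
qed (use g_f f_g' topspace_CB in auto)

text \<open>The preimage \<open>X\<close> chosen in \<open>f\<close> depends on the tangent vector
  and on \<open>w\<close> but not on \<open>Z\<close>, so the fiber component is linear in
  \<open>Z\<close>. Bijectivity comes from \<open>g\<close>, which also preserves the base
  point.\<close>

lemma fiber_isomorphism:
  assumes w: "w \<in> S" and I: "I = {Z. (Z, w) \<in> C}"
  shows "f ` (I \<times> {w}) = {w} \<times> cotS w"
    and "\<exists>\<Lambda>. pointwise_linear_on I \<Lambda> \<and> bij_betw \<Lambda> I (cotS w) \<and> (\<forall>Z\<in>I. f (Z, w) = (w, \<Lambda> Z))"
proof -
  let ?\<Lambda> = "\<lambda>Z. snd (f (Z, w))"
  have fL: "f (Z, w) = (w, ?\<Lambda> Z)" for Z by (rule f_Pair)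
  have im: "\<alpha> \<in> ?\<Lambda> ` I" if "\<alpha> \<in> cotS w" for \<alpha>
  proof -
    obtain Z where Z: "g (w, \<alpha>) = (Z, w)" by (simp add: g_def)
    then have "(Z, w) \<in> C" using g_in_C[OF w that] by simp
    moreover have "?\<Lambda> Z = \<alpha>" using f_g[OF w that] Z by simp
    ultimately show ?thesis unfolding I by blast
  qed
  have I_cot: "?\<Lambda> Z \<in> cotS w" if "Z \<in> I" for Z using f_cot that unfolding I by blast
  have L_im: "?\<Lambda> ` I = cotS w" using im I_cot by blast
  have "f ` (I \<times> {w}) = (\<lambda>Z. (w, ?\<Lambda> Z)) ` I" using fL by force
  also have "\<dots> = {w} \<times> cotS w" using L_im by force
  finally show "f ` (I \<times> {w}) = {w} \<times> cotS w" .
  have "inj_on ?\<Lambda> I"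
  proof (rule inj_onI)
    fix Z Z' assume Z: "Z \<in> I" "Z' \<in> I" "?\<Lambda> Z = ?\<Lambda> Z'"
    then have "f (Z, w) = f (Z', w)" using fL by metis
    then have "(Z, w) = (Z', w)" using g_f Z unfolding I by (metis mem_Collect_eq)
    then show "Z = Z'" by simp
  qed
  moreover have "pointwise_linear_on I ?\<Lambda>"
    unfolding pointwise_linear_on_def f_def prod.case snd_conv covec_def
    by (auto simp: inner_add_left fun_eq_iff)
  ultimately show "\<exists>\<Lambda>. pointwise_linear_on I \<Lambda> \<and> bij_betw \<Lambda> I (cotS w) \<and> (\<forall>Z\<in>I. f (Z, w) = (w, \<Lambda> Z))"
    using L_im fL unfolding bij_betw_def by (intro exI[of _ ?\<Lambda>]) blast
qed

end

section \<open>Lie group representations\<close>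

lemma vector_derivative_in_subspace:
  fixes V :: "'a::euclidean_space set"
  assumes V: "subspace V" and c: "(c has_vector_derivative u) (at 0)" "d > 0" "\<And>t. t \<in> {-d<..<d} \<Longrightarrow> c t \<in> V"
  shows "u \<in> V"
proof -
  obtain P where P: "linear P" "\<And>x. P x \<in> V" "\<And>t. t \<in> V \<Longrightarrow> P t = t"
      "\<And>x t. t \<in> V \<Longrightarrow> P x \<bullet> t = x \<bullet> t"
    using orthogonal_projection_exists[OF V] by blast
  have bl: "bounded_linear P" using P(1) by (simp add: linear_conv_bounded_linear)
  have "((\<lambda>t. P (c t)) has_vector_derivative P u) (at 0)"
    by (rule bounded_linear.has_vector_derivative[OF bl c(1)])
  then have "(c has_vector_derivative P u) (at 0)"
    by (rule has_vector_derivative_transform_within_open[of _ _ _ "{-d<..<d}"]) (use c P in auto)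
  then have "P u = u" using c(1) by (rule vector_derivative_unique_at)
  then show ?thesis using P(2) by metis
qed

text \<open>Supplies curves in the group with prescribed coordinate velocity at an arbitrary point;
  they bound the range of the derivative of the orbit map.\<close>

lemma chart_coordinate_curve:
  fixes M :: "('a, 'e::euclidean_space) manifold"
  assumes M: "charted M" and c: "(U, \<phi>) \<in> atlas M" and E: "subspace E" "openin (top_of_set E) (\<phi> ` U)"
    and y: "y \<in> \<phi> ` U" and v: "v \<in> E"
  obtains e where "e > 0" "smooth_map (submanifold {-e<..<e::real}) M (\<lambda>t. inv_into U \<phi> (y + t *\<^sub>R v))"
proof -
  let ?l = "\<lambda>t::real. y + t *\<^sub>R v"
  obtain Q where Q: "open Q" "\<phi> ` U = E \<inter> Q" using E(2) by (auto simp: openin_open)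
  have "continuous_on UNIV ?l" by (intro continuous_intros)
  then have "open (?l -` Q)" by (rule open_vimage[OF Q(1)])
  moreover have "0 \<in> ?l -` Q" using y Q by simp
  ultimately obtain e where e: "e > 0" "ball 0 e \<subseteq> ?l -` Q" using open_contains_ball by blast
  have yE: "y \<in> E" using y Q(2) by blast
  have sub: "?l t \<in> \<phi> ` U" if "t \<in> {-e<..<e}" for t
  proof -
    have "t \<in> ball 0 e" using that by (auto simp: dist_real_def)
    then have "?l t \<in> Q" using e(2) by blast
    moreover have "?l t \<in> E" using yE v E(1) by (simp add: subspace_add subspace_scale)
    ultimately show ?thesis unfolding Q(2) by blast
  qed
  let ?I = "{-e<..<e}"
  have hI: "has_charts ?I" by (rule has_charts_open) simp
  have sl: "smooth_on S ?l" for S by (intro smooth_on_add smooth_on_const smooth_on_scaleR smooth_on_ident)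
  have "continuous_map (top_of_set ?I) (top_of_set (\<phi> ` U)) ?l"
    using sub smooth_on_imp_continuous_on[OF sl] by (auto simp: continuous_map_in_subtopology)
  from continuous_map_compose[OF this chart_inv_continuous_map[OF M c]]
  have cont: "continuous_map (top_of_set ?I) (mtop M) (\<lambda>t. inv_into U \<phi> (?l t))"
    by (simp add: comp_def continuous_map_in_subtopology)
  have "smooth_map (submanifold ?I) M (\<lambda>t. inv_into U \<phi> (?l t))"
  proof (rule smooth_mapI[OF M _ _ charted_interval])
    show cont': "continuous_map (mtop (submanifold ?I)) (mtop M) (\<lambda>t. inv_into U \<phi> (?l t))"
      using cont by simp
    fix W \<psi> assume d: "(W, \<psi>) \<in> atlas M"
    let ?J = "{p \<in> topspace (mtop (submanifold ?I)). inv_into U \<phi> (?l p) \<in> W}"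
    have o: "openin (mtop (submanifold ?I)) ?J"
      by (rule openin_continuous_map_preimage[OF cont' chart_openin[OF M d]])
    have "smooth_on ?J (\<lambda>t. (\<psi> \<circ> inv_into U \<phi>) (?l t))"
    proof (rule smooth_on_compose[OF sl charted_transition[OF M c d]])
      fix t assume t: "t \<in> ?J"
      then have l: "?l t \<in> \<phi> ` U" using sub by simp
      have "inv_into U \<phi> (?l t) \<in> U \<inter> W" using inv_into_into[OF l] t by simp
      moreover have "\<phi> (inv_into U \<phi> (?l t)) = ?l t" using l by (rule f_inv_into_f)
      ultimately show "?l t \<in> \<phi> ` (U \<inter> W)" by (metis imageI)
    qed
    then show "smooth_fun (submanifold ?I) ?J (\<psi> \<circ> (\<lambda>t. inv_into U \<phi> (?l t)))"
      unfolding smooth_fun_submanifold[OF hI] using o by (simp add: comp_def)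
  qed
  then show ?thesis using that e(1) by blast
qed

locale lie_rep =
  fixes G :: "'g monoid" (structure)
    and M :: "('g, 'e::euclidean_space) manifold"
    and L :: "'l::euclidean_space set"
    and \<iota> :: "'l \<Rightarrow> ('g \<Rightarrow> real) \<Rightarrow> real"
    and V :: "'v::euclidean_space set"
    and \<rho> :: "'g \<Rightarrow> 'v \<Rightarrow> 'v"
  assumes lie: "lie_group G M"
    and comp: "compact_space (mtop M)"
    and alg: "lie_algebra_of G M L \<iota>"
    and rep: "smooth_representation G M V \<rho>"
    and orth: "\<And>g u v. g \<in> carrier G \<Longrightarrow> u \<in> V \<Longrightarrow> v \<in> V \<Longrightarrow> \<rho> g u \<bullet> \<rho> g v = u \<bullet> v"
begin

lemma group_G: "group G" and smfd: "smooth_manifold M" and top_M: "topspace (mtop M) = carrier G"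
  and smooth_mult: "smooth_map (prod_manifold M M) M (\<lambda>(g, h). g \<otimes> h)"
  using lie unfolding lie_group_def by auto

sublocale group G by (rule group_G)

lemma chM: "charted M" by (rule smooth_manifold_charted[OF smfd])

lemma L: "subspace L" and \<iota>_lin: "pointwise_linear_on L \<iota>" and \<iota>_bij: "bij_betw \<iota> L (tangent_space M \<one>)"
  using alg unfolding lie_algebra_of_def by auto

lemma V: "subspace V" and \<rho>_V: "g \<in> carrier G \<Longrightarrow> v \<in> V \<Longrightarrow> \<rho> g v \<in> V"
  and \<rho>_add: "g \<in> carrier G \<Longrightarrow> u \<in> V \<Longrightarrow> v \<in> V \<Longrightarrow> \<rho> g (u + v) = \<rho> g u + \<rho> g v"
  and \<rho>_scale: "g \<in> carrier G \<Longrightarrow> v \<in> V \<Longrightarrow> \<rho> g (c *\<^sub>R v) = c *\<^sub>R \<rho> g v"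
  and \<rho>_one: "v \<in> V \<Longrightarrow> \<rho> \<one> v = v"
  and \<rho>_mult: "g \<in> carrier G \<Longrightarrow> h \<in> carrier G \<Longrightarrow> v \<in> V \<Longrightarrow> \<rho> (g \<otimes> h) v = \<rho> g (\<rho> h v)"
  and \<rho>_smooth_map: "v \<in> V \<Longrightarrow> smooth_map M (submanifold V) (\<lambda>g. \<rho> g v)"
  using rep unfolding smooth_representation_def by blast+

lemma hV: "has_charts V" by (rule has_charts_subspace[OF V])

lemma \<rho>_inv: "g \<in> carrier G \<Longrightarrow> v \<in> V \<Longrightarrow> \<rho> (inv g) (\<rho> g v) = v" "g \<in> carrier G \<Longrightarrow> v \<in> V \<Longrightarrow> \<rho> g (\<rho> (inv g) v) = v"
  using \<rho>_mult[of "inv g" g v] \<rho>_mult[of g "inv g" v] \<rho>_one by simp_all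

lemma \<rho>_smooth_fun: "v \<in> V \<Longrightarrow> smooth_fun M (carrier G) (\<lambda>g. \<rho> g v)"
  using \<rho>_smooth_map smooth_map_into_submanifold[OF chM hV] top_M by simp

lemma smooth_right: assumes h: "h \<in> carrier G" shows "smooth_map M M (\<lambda>g. g \<otimes> h)"
proof -
  have "smooth_map M (prod_manifold M M) (\<lambda>g. (g, h))"
    by (rule smooth_map_Pair[OF chM chM chM smooth_map_ident[OF chM] smooth_map_const[OF chM chM]])
      (simp add: top_M h)
  from smooth_map_compose[OF chM charted_prod_manifold[OF chM chM] chM this smooth_mult]
  show ?thesis by (simp add: comp_def)
qed

lemma smooth_left: assumes h: "h \<in> carrier G" shows "smooth_map M M (\<lambda>g. h \<otimes> g)"
proof -
  have "smooth_map M (prod_manifold M M) (\<lambda>g. (h, g))"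
    by (rule smooth_map_Pair[OF chM chM chM smooth_map_const[OF chM chM] smooth_map_ident[OF chM]])
      (simp add: top_M h)
  from smooth_map_compose[OF chM charted_prod_manifold[OF chM chM] chM this smooth_mult]
  show ?thesis by (simp add: comp_def)
qed

lemma smooth_conj:
  assumes "h \<in> carrier G" "k \<in> carrier G" shows "smooth_map M M (\<lambda>g. h \<otimes> g \<otimes> k)"
  using smooth_map_compose[OF chM chM chM smooth_left[OF assms(1)] smooth_right[OF assms(2)]]
  by (simp add: comp_def)

definition "curve \<gamma> e g \<longleftrightarrow> e > 0 \<and> smooth_map (submanifold {-e<..<e::real}) M \<gamma> \<and> \<gamma> 0 = g"

lemma curve_in: "curve \<gamma> e g \<Longrightarrow> t \<in> {-e<..<e} \<Longrightarrow> \<gamma> t \<in> carrier G"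
  unfolding curve_def using smooth_map_continuous_map[of "submanifold {-e<..<e}" M \<gamma>] top_M
  by (auto simp: continuous_map_def Pi_iff)

lemma curve_map:
  assumes "curve \<gamma> e g" "smooth_map M M k" shows "curve (\<lambda>t. k (\<gamma> t)) e (k g)"
  using assms smooth_map_compose[OF charted_interval chM chM, of e \<gamma> k]
  unfolding curve_def by (auto simp: comp_def)

lemma curve_smooth_fun:
  assumes "curve \<gamma> e g" "smooth_fun M W k" "g \<in> W"
  obtains d where "d > 0" "d \<le> e" "smooth_on {-d<..<d} (\<lambda>t. k (\<gamma> t))" "\<gamma> ` {-d<..<d} \<subseteq> W"
    "((\<lambda>t. k (\<gamma> t)) has_vector_derivative vector_derivative (\<lambda>t. k (\<gamma> t)) (at 0)) (at 0)"
proof -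
  obtain d where d: "d > 0" "d \<le> e" "smooth_on {-d<..<d} (\<lambda>t. k (\<gamma> t))" "\<gamma> ` {-d<..<d} \<subseteq> W"
    using smooth_fun_along_curve[OF chM _ _ assms(2), of e \<gamma>] assms(1,3) unfolding curve_def by blast
  then show ?thesis using that smooth_on_interval_has_vector_derivative[OF d(3,1)] by blast
qed

lemma curve_exists: assumes "X \<in> L" obtains \<gamma> e where "curve \<gamma> e \<one>" "\<iota> X = velocity M \<gamma>"
proof -
  have "\<iota> X \<in> tangent_space M \<one>" using assms \<iota>_bij bij_betwE by blast
  then show ?thesis using that unfolding tangent_space_def curve_def by blast
qed

lemma curve_velocity: assumes "curve \<gamma> e \<one>" obtains X where "X \<in> L" "\<iota> X = velocity M \<gamma>"
proof -
  have "velocity M \<gamma> \<in> tangent_space M \<one>" using assms unfolding tangent_space_def curve_def by blast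
  then show ?thesis using that \<iota>_bij unfolding bij_betw_def by (metis imageE)
qed

abbreviation "Rm \<equiv> infinitesimal_rep \<iota> \<rho>"

text \<open>\<open>Rm X v\<close> is defined by evaluating \<open>\<iota> X\<close> on coordinate
  functions; this identifies it as a derivative along any curve representing \<open>X\<close>. The
  algebraic laws for \<open>Rm\<close> in its second argument then follow from uniqueness of
  derivatives.\<close>

lemma velocity_rep:
  assumes \<gamma>: "curve \<gamma> e \<one>" and X: "\<iota> X = velocity M \<gamma>" and v: "v \<in> V"
  shows "((\<lambda>t. \<rho> (\<gamma> t) v) has_vector_derivative Rm X v) (at 0)"
proof -
  note s = \<rho>_smooth_fun[OF v]
  obtain d where d: "((\<lambda>t. \<rho> (\<gamma> t) v) has_vector_derivative vector_derivative (\<lambda>t. \<rho> (\<gamma> t) v) (at 0)) (at 0)"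
    by (rule curve_smooth_fun[OF \<gamma> s one_closed])
  let ?D = "vector_derivative (\<lambda>t. \<rho> (\<gamma> t) v) (at 0)"
  have "\<iota> X (\<lambda>g. \<rho> g v \<bullet> b) = ?D \<bullet> b" for b
  proof -
    have "smooth_fun M (carrier G) (\<lambda>g. \<rho> g v \<bullet> b)"
      by (rule smooth_fun_compose[OF chM s, of UNIV "\<lambda>y. y \<bullet> b"])
        (auto intro: smooth_on_inner smooth_on_ident smooth_on_const)
    then have "smooth_near M (\<gamma> 0) (\<lambda>g. \<rho> g v \<bullet> b)"
      using \<gamma> unfolding smooth_near_iff curve_def by auto
    moreover have "((\<lambda>t. \<rho> (\<gamma> t) v \<bullet> b) has_field_derivative ?D \<bullet> b) (at 0)"
      using bounded_linear.has_vector_derivative[OF bounded_linear_inner_left d]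
      by (simp add: has_real_derivative_iff_has_vector_derivative)
    ultimately show ?thesis unfolding X velocity_def by (simp add: DERIV_imp_deriv)
  qed
  then have "Rm X v = ?D" unfolding infinitesimal_rep_def by (simp add: euclidean_representation)
  then show ?thesis using d by simp
qed

lemma Rm_in_V: assumes X: "X \<in> L" and v: "v \<in> V" shows "Rm X v \<in> V"
proof -
  obtain \<gamma> e where \<gamma>: "curve \<gamma> e \<one>" "\<iota> X = velocity M \<gamma>" by (rule curve_exists[OF X])
  show ?thesis
  proof (rule vector_derivative_in_subspace[OF V velocity_rep[OF \<gamma> v]])
    show "e > 0" using \<gamma>(1) by (simp add: curve_def)
    show "\<rho> (\<gamma> t) v \<in> V" if "t \<in> {-e<..<e}" for t by (rule \<rho>_V[OF curve_in[OF \<gamma>(1) that] v])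
  qed
qed

lemma Rm_add_left: "X \<in> L \<Longrightarrow> Y \<in> L \<Longrightarrow> Rm (X + Y) v = Rm X v + Rm Y v"
  using \<iota>_lin unfolding pointwise_linear_on_def infinitesimal_rep_def
  by (simp add: scaleR_add_left sum.distrib)

lemma Rm_scale_left: "X \<in> L \<Longrightarrow> Rm (c *\<^sub>R X) v = c *\<^sub>R Rm X v"
  using \<iota>_lin unfolding pointwise_linear_on_def infinitesimal_rep_def
  by (simp add: scaleR_sum_right)

lemma curve_transform:
  assumes "curve \<gamma> e g" "(f has_vector_derivative u) (at 0)" "\<And>t. t \<in> {-e<..<e} \<Longrightarrow> f t = f' t"
  shows "(f' has_vector_derivative u) (at 0)"
  by (rule has_vector_derivative_transform_within_open[OF assms(2), of "{-e<..<e}"])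
    (use assms in \<open>auto simp: curve_def\<close>)

lemma Rm_add_right: assumes X: "X \<in> L" and u: "u \<in> V" and v: "v \<in> V" shows "Rm X (u + v) = Rm X u + Rm X v"
proof -
  obtain \<gamma> e where \<gamma>: "curve \<gamma> e \<one>" "\<iota> X = velocity M \<gamma>" by (rule curve_exists[OF X])
  have "((\<lambda>t. \<rho> (\<gamma> t) u + \<rho> (\<gamma> t) v) has_vector_derivative Rm X u + Rm X v) (at 0)"
    by (intro has_vector_derivative_add velocity_rep[OF \<gamma>] u v)
  then have "((\<lambda>t. \<rho> (\<gamma> t) (u + v)) has_vector_derivative Rm X u + Rm X v) (at 0)"
    by (rule curve_transform[OF \<gamma>(1)]) (simp add: \<rho>_add[OF curve_in[OF \<gamma>(1)]] u v)
  then show ?thesis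
    by (rule vector_derivative_unique_at[OF velocity_rep[OF \<gamma> subspace_add[OF V u v]]])
qed

lemma Rm_scale_right: assumes X: "X \<in> L" and v: "v \<in> V" shows "Rm X (c *\<^sub>R v) = c *\<^sub>R Rm X v"
proof -
  obtain \<gamma> e where \<gamma>: "curve \<gamma> e \<one>" "\<iota> X = velocity M \<gamma>" by (rule curve_exists[OF X])
  have "((\<lambda>t. c *\<^sub>R \<rho> (\<gamma> t) v) has_vector_derivative c *\<^sub>R Rm X v) (at 0)"
    by (rule bounded_linear.has_vector_derivative[OF bounded_linear_scaleR_right velocity_rep[OF \<gamma> v]])
  then have "((\<lambda>t. \<rho> (\<gamma> t) (c *\<^sub>R v)) has_vector_derivative c *\<^sub>R Rm X v) (at 0)"
    by (rule curve_transform[OF \<gamma>(1)]) (simp add: \<rho>_scale[OF curve_in[OF \<gamma>(1)]] v)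
  then show ?thesis
    by (rule vector_derivative_unique_at[OF velocity_rep[OF \<gamma> subspace_scale[OF V v]]])
qed

text \<open>The inner product of \<open>\<rho> (\<gamma> t) u\<close> and
  \<open>\<rho> (\<gamma> t) v\<close> is constant in \<open>t\<close> by invariance; its derivative
  at 0 is the asserted relation.\<close>

lemma Rm_skew: assumes X: "X \<in> L" and u: "u \<in> V" and v: "v \<in> V" shows "Rm X u \<bullet> v = - (u \<bullet> Rm X v)"
proof -
  obtain \<gamma> e where \<gamma>: "curve \<gamma> e \<one>" "\<iota> X = velocity M \<gamma>" by (rule curve_exists[OF X])
  have "\<gamma> 0 = \<one>" using \<gamma>(1) by (simp add: curve_def)
  moreover have "((\<lambda>t. \<rho> (\<gamma> t) u \<bullet> \<rho> (\<gamma> t) v) has_vector_derivative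
     (\<rho> (\<gamma> 0) u \<bullet> Rm X v + Rm X u \<bullet> \<rho> (\<gamma> 0) v)) (at 0)"
    by (rule bounded_bilinear.has_vector_derivative[OF bounded_bilinear_inner velocity_rep[OF \<gamma> u] velocity_rep[OF \<gamma> v]])
  ultimately have "((\<lambda>t. \<rho> (\<gamma> t) u \<bullet> \<rho> (\<gamma> t) v) has_vector_derivative (u \<bullet> Rm X v + Rm X u \<bullet> v)) (at 0)"
    by (simp add: \<rho>_one u v)
  then have "((\<lambda>t. u \<bullet> v) has_vector_derivative (u \<bullet> Rm X v + Rm X u \<bullet> v)) (at 0)"
    by (rule curve_transform[OF \<gamma>(1)]) (simp add: orth[OF curve_in[OF \<gamma>(1)]] u v)
  then have "u \<bullet> Rm X v + Rm X u \<bullet> v = 0"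
    by (rule vector_derivative_unique_at[OF _ has_vector_derivative_const])
  then show ?thesis by simp
qed

text \<open>\<open>X'\<close> plays the role of the adjoint action of \<open>g\<close> on
  \<open>X\<close>: it is represented by the conjugate of a curve that represents
  \<open>X\<close>.\<close>

lemma Rm_conj:
  assumes g: "g \<in> carrier G" and X: "X \<in> L"
  obtains X' where "X' \<in> L" "\<And>v. v \<in> V \<Longrightarrow> Rm X' (\<rho> g v) = \<rho> g (Rm X v)"
proof -
  obtain \<gamma> e where \<gamma>: "curve \<gamma> e \<one>" "\<iota> X = velocity M \<gamma>" by (rule curve_exists[OF X])
  have "curve (\<lambda>t. g \<otimes> \<gamma> t \<otimes> inv g) e \<one>"
    using curve_map[OF \<gamma>(1) smooth_conj[OF g inv_closed[OF g]]] g by simp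
  then obtain X' where c: "curve (\<lambda>t. g \<otimes> \<gamma> t \<otimes> inv g) e \<one>" and X': "X' \<in> L" "\<iota> X' = velocity M (\<lambda>t. g \<otimes> \<gamma> t \<otimes> inv g)"
    using curve_velocity by metis
  \<comment> \<open>\<open>\<rho> g\<close> is linear on \<open>V\<close> only; preceded by a
    projection it becomes a bounded linear map on the ambient space, to which derivative rules
    apply.\<close>
  obtain P where P: "linear P" "\<And>x. P x \<in> V" "\<And>t. t \<in> V \<Longrightarrow> P t = t"
      "\<And>x t. t \<in> V \<Longrightarrow> P x \<bullet> t = x \<bullet> t"
    using orthogonal_projection_exists[OF V] by blast
  have "linear (\<lambda>y. \<rho> g (P y))"
    by (rule linearI) (simp_all add: linear_add[OF P(1)] linear_cmul[OF P(1)] \<rho>_add \<rho>_scale g P(2))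
  then have bl: "bounded_linear (\<lambda>y. \<rho> g (P y))" by (simp add: linear_conv_bounded_linear)
  have "Rm X' (\<rho> g v) = \<rho> g (Rm X v)" if v: "v \<in> V" for v
  proof -
    have "((\<lambda>t. \<rho> g (P (\<rho> (\<gamma> t) v))) has_vector_derivative \<rho> g (P (Rm X v))) (at 0)"
      by (rule bounded_linear.has_vector_derivative[OF bl velocity_rep[OF \<gamma> v]])
    then have "((\<lambda>t. \<rho> (g \<otimes> \<gamma> t \<otimes> inv g) (\<rho> g v)) has_vector_derivative \<rho> g (P (Rm X v))) (at 0)"
    proof (rule curve_transform[OF \<gamma>(1)])
      fix t assume "t \<in> {-e<..<e}"
      then have "\<gamma> t \<in> carrier G" by (rule curve_in[OF \<gamma>(1)])
      then show "\<rho> g (P (\<rho> (\<gamma> t) v)) = \<rho> (g \<otimes> \<gamma> t \<otimes> inv g) (\<rho> g v)"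
        using g v by (simp add: P(3) \<rho>_V \<rho>_mult \<rho>_inv)
    qed
    then have "\<rho> g (P (Rm X v)) = Rm X' (\<rho> g v)"
      using velocity_rep[OF c X'(2) \<rho>_V[OF g v]] by (rule vector_derivative_unique_at)
    then show ?thesis using P(3)[OF Rm_in_V[OF X v]] by simp
  qed
  then show ?thesis using that X'(1) by blast
qed

section \<open>Directions along orbits\<close>

definition "T w = (\<lambda>X. Rm X w) ` L"

lemma subspace_T: "subspace (T w)"
proof -
  obtain P where P: "linear P" "\<And>x. P x \<in> L" "\<And>t. t \<in> L \<Longrightarrow> P t = t"
      "\<And>x t. t \<in> L \<Longrightarrow> P x \<bullet> t = x \<bullet> t"
    using orthogonal_projection_exists[OF L] by blast
  have "linear (\<lambda>X. Rm (P X) w)"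
    by (rule linearI) (simp_all add: linear_add[OF P(1)] linear_cmul[OF P(1)] Rm_add_left Rm_scale_left P(2))
  moreover have "T w = (\<lambda>X. Rm (P X) w) ` L" unfolding T_def using P(3) by simp
  ultimately show ?thesis using L by (simp add: linear_subspace_image)
qed

lemma T_subset: "w \<in> V \<Longrightarrow> T w \<subseteq> V"
  unfolding T_def using Rm_in_V by blast

text \<open>By \<open>Rm_conj\<close>, \<open>\<rho> g\<close> maps \<open>T w\<close> into
  \<open>T (\<rho> g w)\<close>, and it is injective because \<open>\<rho> (inv g)\<close> undoes
  it. Applied also to \<open>inv g\<close>, this gives equality.\<close>

lemma dim_T_le: assumes g: "g \<in> carrier G" and w: "w \<in> V" shows "dim (T w) \<le> dim (T (\<rho> g w))"
proof -
  obtain P where P: "linear P" "\<And>x. P x \<in> V" "\<And>t. t \<in> V \<Longrightarrow> P t = t"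
      "\<And>x t. t \<in> V \<Longrightarrow> P x \<bullet> t = x \<bullet> t"
    using orthogonal_projection_exists[OF V] by blast
  let ?f = "\<lambda>y. \<rho> g (P y)"
  have l: "linear ?f"
    by (rule linearI) (simp_all add: linear_add[OF P(1)] linear_cmul[OF P(1)] \<rho>_add \<rho>_scale g P(2))
  have sp: "span (T w) = T w" using subspace_T span_eq_iff by blast
  have "inj_on ?f (T w)"
    by (rule inj_on_inverseI[of _ "\<rho> (inv g)"]) (use T_subset[OF w] P(3) \<rho>_inv(1)[OF g] in auto)
  then have "dim (T w) = dim (?f ` T w)" using dim_image_eq[OF l, of "T w"] sp by simp
  also have "\<dots> \<le> dim (T (\<rho> g w))"
  proof (rule dim_subset, rule image_subsetI)
    fix y assume "y \<in> T w"
    then obtain X where X: "X \<in> L" "y = Rm X w" unfolding T_def by blast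
    obtain X' where "X' \<in> L" "\<And>v. v \<in> V \<Longrightarrow> Rm X' (\<rho> g v) = \<rho> g (Rm X v)" using Rm_conj[OF g X(1)] by blast
    then have "?f y = Rm X' (\<rho> g w)" using w P(3)[OF Rm_in_V[OF X(1) w]] X(2) by simp
    then show "?f y \<in> T (\<rho> g w)" unfolding T_def using \<open>X' \<in> L\<close> by blast
  qed
  finally show ?thesis .
qed

lemma dim_T: assumes "g \<in> carrier G" "w \<in> V" shows "dim (T (\<rho> g w)) = dim (T w)"
  using dim_T_le[OF assms] dim_T_le[OF inv_closed[OF assms(1)] \<rho>_V[OF assms]] \<rho>_inv(1)[OF assms] by simp

end

section \<open>Orbits\<close>

locale lie_rep_orbit = lie_rep G M L \<iota> V \<rho>
  for G :: "'g monoid" (structure)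
    and M :: "('g, 'e::euclidean_space) manifold"
    and L :: "'l::euclidean_space set"
    and \<iota> :: "'l \<Rightarrow> ('g \<Rightarrow> real) \<Rightarrow> real"
    and V :: "'v::euclidean_space set"
    and \<rho> :: "'g \<Rightarrow> 'v \<Rightarrow> 'v" +
  fixes x :: 'v
  assumes x: "x \<in> V"
begin

abbreviation "S \<equiv> rep_orbit G \<rho> x"

lemma S_subset: "S \<subseteq> V" unfolding rep_orbit_def using \<rho>_V x by blast

lemma x_in_S: "x \<in> S" unfolding rep_orbit_def using \<rho>_one[OF x] one_closed by (metis imageI)

lemma S_invariant: "g \<in> carrier G \<Longrightarrow> w \<in> S \<Longrightarrow> \<rho> g w \<in> S"
  unfolding rep_orbit_def using \<rho>_mult[of g _ x, symmetric] x by auto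

lemma dim_T_orbit: assumes "w \<in> S" shows "dim (T w) = dim (T x)"
  using assms dim_T x unfolding rep_orbit_def by blast

text \<open>The preimage in \<open>G\<close> of the image of an open set \<open>N\<close> is the union of the translates of \<open>N\<close> by
  the stabilizer, hence open; compactness of its complement makes the orbit map open.\<close>

lemma orbit_map_open:
  assumes N: "openin (mtop M) N"
  shows "openin (top_of_set S) ((\<lambda>g. \<rho> g x) ` N)"
proof -
  let ?F = "\<lambda>g. \<rho> g x"
  have NG: "N \<subseteq> carrier G" using openin_subset[OF N] top_M by simp
  define A where "A = {g \<in> carrier G. ?F g \<in> ?F ` N}"
  have "A = (\<Union>h\<in>{h \<in> carrier G. \<rho> h x = x}. {g \<in> topspace (mtop M). g \<otimes> h \<in> N})"
  proof (intro equalityI subsetI)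
    fix g assume "g \<in> A"
    then obtain k where g: "g \<in> carrier G" and k: "k \<in> N" "\<rho> g x = \<rho> k x" unfolding A_def by auto
    have kG: "k \<in> carrier G" using k NG by blast
    have "\<rho> (inv g \<otimes> k) x = x" using g kG k(2)[symmetric] x by (simp add: \<rho>_mult \<rho>_inv)
    moreover have "g \<otimes> (inv g \<otimes> k) = k" using g kG by (simp add: m_assoc[symmetric])
    ultimately show "g \<in> (\<Union>h\<in>{h \<in> carrier G. \<rho> h x = x}. {g \<in> topspace (mtop M). g \<otimes> h \<in> N})"
      using g kG k(1) by (intro UN_I[of "inv g \<otimes> k"]) (simp_all add: top_M)
  next
    fix g assume "g \<in> (\<Union>h\<in>{h \<in> carrier G. \<rho> h x = x}. {g \<in> topspace (mtop M). g \<otimes> h \<in> N})"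
    then obtain h where h: "h \<in> carrier G" "\<rho> h x = x" "g \<in> carrier G" "g \<otimes> h \<in> N" by (auto simp: top_M)
    have "\<rho> g x = \<rho> (g \<otimes> h) x" using h x by (simp add: \<rho>_mult)
    then show "g \<in> A" unfolding A_def using h by blast
  qed
  moreover have "openin (mtop M) {g \<in> topspace (mtop M). g \<otimes> h \<in> N}" if "h \<in> carrier G" for h
    by (rule openin_continuous_map_preimage[OF smooth_map_continuous_map[OF smooth_right[OF that]] N])
  ultimately have "openin (mtop M) A" by auto
  then have "closedin (mtop M) (topspace (mtop M) - A)" by (rule openin_closedin_eq[THEN iffD1, THEN conjunct2])
  then have cK: "compactin (mtop M) (carrier G - A)" using closedin_compact_space[OF comp] top_M by simp
  have "continuous_map (mtop M) euclidean ?F"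
    using smooth_fun_continuous_map[OF chM \<rho>_smooth_fun[OF x]] by (simp add: top_M[symmetric])
  then have "compactin euclidean (?F ` (carrier G - A))" using image_compactin[OF cK] by blast
  then have "closed (?F ` (carrier G - A))" by (simp add: compact_imp_closed)
  \<comment> \<open>\<open>A\<close> is a full preimage under the orbit map, so the image of its
    complement misses the image of \<open>N\<close> and is exactly the rest of the orbit.\<close>
  moreover have "?F ` N = S \<inter> - (?F ` (carrier G - A))"
  proof (intro equalityI subsetI)
    fix y assume "y \<in> ?F ` N"
    then have "y \<in> S" unfolding rep_orbit_def using NG by blast
    moreover have "y \<notin> ?F ` (carrier G - A)"
    proof
      assume "y \<in> ?F ` (carrier G - A)"
      then obtain k where "k \<in> carrier G" "k \<notin> A" "y = ?F k" by blast
      then show False using \<open>y \<in> ?F ` N\<close> unfolding A_def by simp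
    qed
    ultimately show "y \<in> S \<inter> - (?F ` (carrier G - A))" by simp
  next
    fix y assume "y \<in> S \<inter> - (?F ` (carrier G - A))"
    then show "y \<in> ?F ` N" unfolding rep_orbit_def A_def by auto
  qed
  ultimately show ?thesis by (simp add: openin_open_Int open_Compl)
qed

text \<open>By equivariance the derivative of \<open>g \<mapsto> \<rho> g x\<close> has range \<open>T (\<rho> g x)\<close>, of constant dimension.
  Hence the orbit is near \<open>w\<close> a graph over \<open>T w\<close>, and the projection onto \<open>T w\<close> is a chart.\<close>

lemma orbit_chart:
  assumes w: "w \<in> S"
  obtains U P where "(U, P) \<in> atlas (submanifold S)" "w \<in> U" "openin (top_of_set (T w)) (P ` U)"
proof -
  obtain g0 where g0: "g0 \<in> carrier G" "w = \<rho> g0 x" using w unfolding rep_orbit_def by blast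
  have wV: "w \<in> V" using w S_subset by blast
  have "g0 \<in> topspace (mtop M)" using g0 top_M by simp
  then obtain U0 \<phi>0 where c: "(U0, \<phi>0) \<in> atlas M" "g0 \<in> U0" using charted_cover[OF chM] by blast
  have U0G: "U0 \<subseteq> carrier G" using chart_subset[OF chM c(1)] top_M by simp
  obtain E0 where E0: "subspace E0" "openin (top_of_set E0) (\<phi>0 ` U0)" using chart_range[OF chM c(1)] by blast
  obtain Q0 where Q0: "open Q0" "\<phi>0 ` U0 = E0 \<inter> Q0" using E0(2) by (auto simp: openin_open)
  obtain \<pi> where \<pi>: "linear \<pi>" "\<And>x. \<pi> x \<in> E0" "\<And>t. t \<in> E0 \<Longrightarrow> \<pi> t = t"
      "\<And>x t. t \<in> E0 \<Longrightarrow> \<pi> x \<bullet> t = x \<bullet> t"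
    using orthogonal_projection_exists[OF E0(1)] by blast
  have bl\<pi>: "bounded_linear \<pi>" using \<pi>(1) by (simp add: linear_conv_bounded_linear)
  \<comment> \<open>An open subset of the ambient coordinate space: projecting it to
    \<open>E0\<close> lands in the chart image, so the orbit map in coordinates becomes a map
    \<open>f\<close> on an open set.\<close>
  define Oc where "Oc = \<pi> -` Q0"
  have Oc\<phi>: "\<pi> y \<in> \<phi>0 ` U0" if "y \<in> Oc" for y using that \<pi>(2) Q0(2) unfolding Oc_def by blast
  have oOc: "open Oc" unfolding Oc_def
    by (rule open_vimage[OF Q0(1) linear_continuous_on[OF bl\<pi>]])
  define i where "i y = inv_into U0 \<phi>0 (\<pi> y)" for y
  have iU: "i y \<in> U0" if "y \<in> Oc" for y unfolding i_def by (rule inv_into_into[OF Oc\<phi>[OF that]])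
  define f where "f y = \<rho> (i y) x" for y
  have "U0 \<inter> carrier G = U0" using U0G by blast
  then have "smooth_on (\<phi>0 ` U0) ((\<lambda>g. \<rho> g x) \<circ> inv_into U0 \<phi>0)"
    using \<rho>_smooth_fun[OF x] c(1) unfolding smooth_fun_def by metis
  then have smf: "smooth_on Oc f"
    unfolding f_def i_def comp_def by (rule smooth_on_compose[OF smooth_on_linear[OF \<pi>(1)]]) (rule Oc\<phi>)
  define a where "a = \<phi>0 g0"
  have aE: "a \<in> E0" using c(2) Q0(2) a_def by blast
  have aO: "a \<in> Oc" unfolding Oc_def using \<pi>(3)[OF aE] c(2) Q0(2) a_def by auto
  have \<phi>O: "\<phi>0 k \<in> Oc" "i (\<phi>0 k) = k" if "k \<in> U0" for k
  proof -
    have k: "\<phi>0 k \<in> E0 \<inter> Q0" using that Q0(2) by blast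
    then show "\<phi>0 k \<in> Oc" unfolding Oc_def using \<pi>(3) by simp
    show "i (\<phi>0 k) = k" unfolding i_def using k \<pi>(3) chart_inv[OF chM c(1) that] by simp
  qed
  have fa: "f a = w" unfolding f_def a_def \<phi>O(2)[OF c(2)] g0(2) ..
  let ?D = "\<lambda>y. frechet_derivative f (at y)"
  have fd: "(f has_derivative ?D y) (at y)" if "y \<in> Oc" for y
    by (rule smooth_on_has_derivative[OF oOc smf that])
  have lD: "linear (?D y)" if "y \<in> Oc" for y using fd[OF that] has_derivative_linear by blast
  have fS: "f y \<in> S" if "y \<in> Oc" for y
    unfolding f_def rep_orbit_def using iU[OF that] U0G by blast
  \<comment> \<open>A coordinate curve through \<open>?k\<close> is translated by
    \<open>inv ?k\<close> to a curve through the identity. Acting on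
    \<open>f y = \<rho> ?k x\<close>, the translated curve has the same effect as the original one
    on \<open>x\<close>.\<close>
  have range_sub: "range (?D y) \<subseteq> T (f y)" if y: "y \<in> Oc" for y
  proof clarify
    fix h
    let ?k = "i y"
    let ?\<delta> = "\<lambda>t::real. inv_into U0 \<phi>0 (\<pi> y + t *\<^sub>R \<pi> h)"
    have kG: "?k \<in> carrier G" using iU[OF y] U0G by blast
    obtain e where e: "e > 0" "smooth_map (submanifold {-e<..<e}) M ?\<delta>"
      using chart_coordinate_curve[OF chM c(1) E0 Oc\<phi>[OF y] \<pi>(2)] by blast
    then have \<delta>: "curve ?\<delta> e ?k" unfolding curve_def by (simp add: i_def)
    have \<gamma>: "curve (\<lambda>t. ?\<delta> t \<otimes> inv ?k) e \<one>"
      using curve_map[OF \<delta> smooth_right[OF inv_closed[OF kG]]] kG by simp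
    obtain X where X: "X \<in> L" "\<iota> X = velocity M (\<lambda>t. ?\<delta> t \<otimes> inv ?k)" using curve_velocity[OF \<gamma>] by blast
    have fyV: "f y \<in> V" using fS[OF y] S_subset by blast
    have "((\<lambda>t. \<rho> (?\<delta> t \<otimes> inv ?k) (f y)) has_vector_derivative Rm X (f y)) (at 0)"
      by (rule velocity_rep[OF \<gamma> X(2) fyV])
    then have d1: "((\<lambda>t. f (y + t *\<^sub>R h)) has_vector_derivative Rm X (f y)) (at 0)"
    proof (rule curve_transform[OF \<delta>])
      fix t assume "t \<in> {-e<..<e}"
      then have "?\<delta> t \<in> carrier G" by (rule curve_in[OF \<delta>])
      then have "\<rho> (?\<delta> t \<otimes> inv ?k) (f y) = \<rho> (?\<delta> t) x"
        unfolding f_def using kG x by (simp add: \<rho>_mult \<rho>_V \<rho>_inv)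
      also have "\<dots> = f (y + t *\<^sub>R h)"
        unfolding f_def i_def by (simp add: linear_add[OF \<pi>(1)] linear_cmul[OF \<pi>(1)])
      finally show "\<rho> (?\<delta> t \<otimes> inv ?k) (f y) = f (y + t *\<^sub>R h)" .
    qed
    have "((\<lambda>t::real. y + t *\<^sub>R h) has_derivative (\<lambda>s. s *\<^sub>R h)) (at 0)"
      by (auto intro!: derivative_eq_intros)
    then have "((\<lambda>t. f (y + t *\<^sub>R h)) has_derivative (\<lambda>s. ?D y (s *\<^sub>R h))) (at 0)"
      by (rule has_derivative_compose[where g = f]) (simp add: fd[OF y])
    then have "((\<lambda>t. f (y + t *\<^sub>R h)) has_vector_derivative ?D y h) (at 0)"
      unfolding has_vector_derivative_def by (simp add: linear_cmul[OF lD[OF y]])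
    then have "?D y h = Rm X (f y)" using d1 by (rule vector_derivative_unique_at)
    then show "?D y h \<in> T (f y)" unfolding T_def using X(1) by blast
  qed
  \<comment> \<open>Conversely, a curve representing \<open>X\<close> is translated by
    \<open>g0\<close> and read in the chart; its coordinate velocity \<open>h\<close> is mapped to
    \<open>Rm X w\<close>.\<close>
  have "T w \<subseteq> range (?D a)"
  proof
    fix u assume "u \<in> T w"
    then obtain X where X: "X \<in> L" "u = Rm X w" unfolding T_def by blast
    obtain \<gamma> e where \<gamma>: "curve \<gamma> e \<one>" "\<iota> X = velocity M \<gamma>" by (rule curve_exists[OF X(1)])
    have \<delta>: "curve (\<lambda>t. \<gamma> t \<otimes> g0) e g0" using curve_map[OF \<gamma>(1) smooth_right[OF g0(1)]] g0(1) by simp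
    have "smooth_fun M U0 \<phi>0"
      unfolding smooth_fun_def using chart_openin[OF chM c(1)] charted_transition[OF chM _ c(1)] by blast
    then obtain d where d: "d > 0" "d \<le> e" "(\<lambda>t. \<gamma> t \<otimes> g0) ` {-d<..<d} \<subseteq> U0"
      "((\<lambda>t. \<phi>0 (\<gamma> t \<otimes> g0)) has_vector_derivative vector_derivative (\<lambda>t. \<phi>0 (\<gamma> t \<otimes> g0)) (at 0)) (at 0)"
      using curve_smooth_fun[OF \<delta> _ c(2)] by metis
    define h where "h = vector_derivative (\<lambda>t. \<phi>0 (\<gamma> t \<otimes> g0)) (at 0)"
    have \<phi>0': "\<phi>0 (\<gamma> 0 \<otimes> g0) = a" using \<delta> unfolding curve_def a_def by simp
    have "((\<lambda>t. f (\<phi>0 (\<gamma> t \<otimes> g0))) has_derivative (\<lambda>s. ?D a (s *\<^sub>R h))) (at 0)"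
      by (rule has_derivative_compose[where g = f, OF d(4)[unfolded has_vector_derivative_def, folded h_def]])
        (simp add: \<phi>0' fd[OF aO])
    then have "((\<lambda>t. f (\<phi>0 (\<gamma> t \<otimes> g0))) has_vector_derivative ?D a h) (at 0)"
      unfolding has_vector_derivative_def by (simp add: linear_cmul[OF lD[OF aO]])
    then have "((\<lambda>t. \<rho> (\<gamma> t) w) has_vector_derivative ?D a h) (at 0)"
    proof (rule has_vector_derivative_transform_within_open[of _ _ _ "{-d<..<d}"])
      fix t assume t: "t \<in> {-d<..<d}"
      then have tU: "\<gamma> t \<otimes> g0 \<in> U0" using d(3) by blast
      have "t \<in> {-e<..<e}" using t d(2) by auto
      then have "\<gamma> t \<in> carrier G" by (rule curve_in[OF \<gamma>(1)])
      then show "f (\<phi>0 (\<gamma> t \<otimes> g0)) = \<rho> (\<gamma> t) w"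
        unfolding f_def \<phi>O(2)[OF tU] using g0 x by (simp add: \<rho>_mult)
    qed (use d(1) in auto)
    then have "u = ?D a h" unfolding X(2) using velocity_rep[OF \<gamma> wV] vector_derivative_unique_at by metis
    then show "u \<in> range (?D a)" by simp
  qed
  then have Ta: "T w = range (?D a)" using range_sub[OF aO] fa by auto
  have dims: "dim (range (?D y)) \<le> dim (T w)" if "y \<in> Oc" for y
  proof -
    have "dim (range (?D y)) \<le> dim (T (f y))" by (rule dim_subset[OF range_sub[OF that]])
    also have "\<dots> = dim (T w)" using dim_T_orbit[OF fS[OF that]] dim_T_orbit[OF w] by simp
    finally show ?thesis .
  qed
  obtain P where P: "linear P" "\<And>x. P x \<in> T w" "\<And>t. t \<in> T w \<Longrightarrow> P t = t"
      "\<And>x t. t \<in> T w \<Longrightarrow> P x \<bullet> t = x \<bullet> t"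
    using orthogonal_projection_exists[OF subspace_T] by blast
  obtain N Q h where N: "open N" "a \<in> N" "N \<subseteq> Oc" and Q: "open Q" "smooth_on Q h"
    and fN: "f ` N \<subseteq> h ` (Q \<inter> T w)" and hQ: "h ` (Q \<inter> T w) \<subseteq> f ` Oc"
    and Ph: "\<And>t. t \<in> Q \<Longrightarrow> t \<in> T w \<Longrightarrow> P (h t) = t"
    by (rule constant_rank_graph[OF oOc smf aO Ta dims P(1,2,3)]) blast+
  define N' where "N' = {k \<in> U0. \<phi>0 k \<in> \<phi>0 ` U0 \<inter> N}"
  have oN': "openin (mtop M) N'"
    unfolding N'_def by (rule chart_preimage_openin[OF chM c(1)]) (simp add: openin_open_Int N(1))
  \<comment> \<open>Taken as the image of an open subset of the group, so that
    \<open>orbit_map_open\<close> makes it relatively open in the orbit.\<close>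
  define U where "U = (\<lambda>g. \<rho> g x) ` N'"
  have oU: "openin (top_of_set S) U" unfolding U_def by (rule orbit_map_open[OF oN'])
  then obtain R0 where R0: "open R0" "U = S \<inter> R0" by (auto simp: openin_open)
  have UfN: "U \<subseteq> f ` N"
  proof
    fix p assume "p \<in> U"
    then obtain k where k: "k \<in> U0" "\<phi>0 k \<in> N" "p = \<rho> k x" unfolding U_def N'_def by blast
    then have "p = f (\<phi>0 k)" unfolding f_def \<phi>O(2)[OF k(1)] by simp
    then show "p \<in> f ` N" using k(2) by blast
  qed
  have hP: "h (P p) = p" "P p \<in> Q \<inter> T w" if "p \<in> U" for p
  proof -
    have "p \<in> h ` (Q \<inter> T w)" using that UfN fN by blast
    then obtain t where "t \<in> Q" "t \<in> T w" "p = h t" by blast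
    then show "h (P p) = p" "P p \<in> Q \<inter> T w" using Ph by auto
  qed
  have im: "P ` U = T w \<inter> (Q \<inter> h -` R0)"
  proof (intro equalityI subsetI)
    fix t assume "t \<in> P ` U"
    then show "t \<in> T w \<inter> (Q \<inter> h -` R0)" using hP R0(2) by auto
  next
    fix t assume t: "t \<in> T w \<inter> (Q \<inter> h -` R0)"
    then have "h t \<in> f ` Oc" using hQ by blast
    then obtain y where "y \<in> Oc" "h t = f y" by blast
    then have "h t \<in> S" using fS[of y] by (simp only:)
    then have "h t \<in> U" using t R0(2) by blast
    moreover have "P (h t) = t" using t Ph by blast
    ultimately show "t \<in> P ` U" by (metis imageI)
  qed
  have oP: "openin (top_of_set (T w)) (P ` U)" unfolding im
    by (intro openin_open_Int continuous_open_preimage[OF smooth_on_imp_continuous_on[OF Q(2)] Q(1) R0(1)])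
  have inj: "inj_on P U" by (rule inj_on_inverseI[of _ h]) (rule hP(1))
  have "smooth_on (P ` U) h" by (rule smooth_on_subset[OF Q(2)]) (use im in blast)
  then have "smooth_on (P ` U) (inv_into U P)"
    by (rule smooth_on_cong[rotated]) (use hP(1) inv_into_f_f[OF inj] in auto)
  then have "(U, P) \<in> atlas (submanifold S)"
    unfolding submanifold_atlas using oU oP subspace_T inj smooth_on_linear[OF P(1)] by blast
  moreover have "w \<in> U"
  proof -
    have "g0 \<in> N'" unfolding N'_def using c(2) N(2) a_def by blast
    then show ?thesis unfolding U_def using g0(2) by blast
  qed
  ultimately show ?thesis using that oP by blast
qed

lemma has_charts_S: "has_charts S"
  unfolding has_charts_def using orbit_chart by metis

text \<open>Curves in the group give the inclusion of \<open>T w\<close>; equality follows by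
  dimension, since the chart around \<open>w\<close> has \<open>T w\<close> itself as coordinate
  space.\<close>

lemma tangent_vectors_S: assumes w: "w \<in> S" shows "tangent_vectors S w = T w"
proof (rule subspace_dim_equal[symmetric])
  show "subspace (T w)" by (rule subspace_T)
  show "subspace (tangent_vectors S w)" by (rule subspace_tangent_vectors[OF has_charts_S w])
  have wV: "w \<in> V" using w S_subset by blast
  show "T w \<subseteq> tangent_vectors S w"
  proof
    fix u assume "u \<in> T w"
    then obtain X where X: "X \<in> L" "u = Rm X w" unfolding T_def by blast
    obtain \<gamma> e where \<gamma>: "curve \<gamma> e \<one>" "\<iota> X = velocity M \<gamma>" by (rule curve_exists[OF X(1)])
    obtain d where d: "d > 0" "d \<le> e" "smooth_on {-d<..<d} (\<lambda>t. \<rho> (\<gamma> t) w)"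
      using curve_smooth_fun[OF \<gamma>(1) \<rho>_smooth_fun[OF wV] one_closed] by metis
    have "(\<lambda>t. \<rho> (\<gamma> t) w) ` {-d<..<d} \<subseteq> S"
    proof (rule image_subsetI)
      fix t assume "t \<in> {-d<..<d}"
      then have "t \<in> {-e<..<e}" using d(2) by auto
      then show "\<rho> (\<gamma> t) w \<in> S" by (rule S_invariant[OF curve_in[OF \<gamma>(1)] w])
    qed
    moreover have "\<rho> (\<gamma> 0) w = w" using \<gamma>(1) \<rho>_one[OF wV] unfolding curve_def by simp
    ultimately show "u \<in> tangent_vectors S w"
      unfolding tangent_vectors_def using d(1,3) velocity_rep[OF \<gamma> wV] X(2) by blast
  qed
  obtain U P where U: "(U, P) \<in> atlas (submanifold S)" "w \<in> U" "openin (top_of_set (T w)) (P ` U)"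
    using orbit_chart[OF w] by blast
  obtain \<pi> where \<pi>: "linear \<pi>" "\<And>x. \<pi> x \<in> T w" "\<And>t. t \<in> T w \<Longrightarrow> \<pi> t = t"
      "\<And>x t. t \<in> T w \<Longrightarrow> \<pi> x \<bullet> t = x \<bullet> t"
    using orthogonal_projection_exists[OF subspace_T] by blast
  have "submanifold_chart S U P (T w) \<pi>"
    by (rule submanifold_chart.intro[OF has_charts_S U(1) subspace_T U(3) \<pi>])
  then show "dim (tangent_vectors S w) \<le> dim (T w)"
    using submanifold_chart.dim_tangent_vectors U(2) by (metis order_refl)
qed

abbreviation "PL \<equiv> oproj L"
abbreviation "PV \<equiv> oproj V"
lemmas PL = oproj[OF L]
lemmas PV = oproj[OF V]

text \<open>Extends the infinitesimal representation, bilinear on \<open>L\<close> and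
  \<open>V\<close> only, to the ambient spaces as \<open>cotangent_model\<close> requires. The
  extension kills the orthogonal complement of \<open>L\<close>, which later forces the first
  components of the model to lie in \<open>L\<close>.\<close>

definition "R X w = Rm (PL X) (PV w)"

lemma bounded_bilinear_R: "bounded_bilinear R"
proof -
  have "linear (\<lambda>w. R X w)" for X
    by (rule linearI) (simp_all add: R_def linear_add[OF PV(1)] linear_cmul[OF PV(1)]
        Rm_add_right Rm_scale_right PL(2) PV(2))
  moreover have "linear (\<lambda>X. R X w)" for w
    by (rule linearI) (simp_all add: R_def linear_add[OF PL(1)] linear_cmul[OF PL(1)]
        Rm_add_left Rm_scale_left PL(2))
  ultimately show ?thesis by (simp add: bilinear_conv_bounded_bilinear[symmetric] bilinear_def)
qed

lemma range_R: assumes "w \<in> S" shows "range (\<lambda>X. R X w) = T w"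
proof -
  have "w \<in> V" using assms S_subset by blast
  then have "R X w = Rm (PL X) w" for X by (simp add: R_def PV(3))
  then show ?thesis unfolding T_def using PL(2,3) by (auto simp: image_iff) metis
qed

sublocale cm: cotangent_model S R "dim (T x)"
proof (rule cotangent_model.intro)
  show "has_charts S" by (rule has_charts_S)
  show "S \<noteq> {}" using x_in_S by blast
  show "bounded_bilinear R" by (rule bounded_bilinear_R)
  fix w assume w: "w \<in> S"
  show "tangent_vectors S w = range (\<lambda>X. R X w)" "dim (tangent_vectors S w) = dim (T x)"
    using tangent_vectors_S[OF w] range_R[OF w] dim_T_orbit[OF w] by simp_all
qed

end

section \<open>The coadjoint orbit\<close>

context lie_rep_orbit
begin

section \<open>The semi-direct product and its adjoint action\<close>

abbreviation "sd \<equiv> semidirect G V \<rho>"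
abbreviation "N \<equiv> semidirect_manifold M V"
abbreviation "sdi \<equiv> semidirect_iso G M \<iota> V"

lemma sd_simps: "carrier sd = carrier G \<times> V" "(g, v) \<otimes>\<^bsub>sd\<^esub> (h, w) = (g \<otimes> h, v + \<rho> g w)" "\<one>\<^bsub>sd\<^esub> = (\<one>, 0)"
  unfolding semidirect_def by simp_all

lemma \<rho>_zero: "g \<in> carrier G \<Longrightarrow> \<rho> g 0 = 0"
  using \<rho>_scale[of g 0 0] subspace_0[OF V] by simp

lemma \<rho>_minus: "g \<in> carrier G \<Longrightarrow> v \<in> V \<Longrightarrow> \<rho> g (- v) = - \<rho> g v"
  using \<rho>_scale[of g v "-1"] by simp

lemma group_sd: "group sd"
proof (rule groupI)
  fix a b assume "a \<in> carrier sd" "b \<in> carrier sd"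
  then show "a \<otimes>\<^bsub>sd\<^esub> b \<in> carrier sd"
    by (cases a; cases b) (simp add: sd_simps \<rho>_V subspace_add[OF V])
next
  show "\<one>\<^bsub>sd\<^esub> \<in> carrier sd" by (simp add: sd_simps subspace_0[OF V])
next
  fix a b c assume "a \<in> carrier sd" "b \<in> carrier sd" "c \<in> carrier sd"
  then show "a \<otimes>\<^bsub>sd\<^esub> b \<otimes>\<^bsub>sd\<^esub> c = a \<otimes>\<^bsub>sd\<^esub> (b \<otimes>\<^bsub>sd\<^esub> c)"
    by (cases a; cases b; cases c) (simp add: sd_simps m_assoc \<rho>_mult \<rho>_add \<rho>_V)
next
  fix a assume "a \<in> carrier sd"
  then show "\<one>\<^bsub>sd\<^esub> \<otimes>\<^bsub>sd\<^esub> a = a" by (cases a) (simp add: sd_simps \<rho>_one)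
next
  fix a assume "a \<in> carrier sd"
  then obtain g v where a: "a = (g, v)" "g \<in> carrier G" "v \<in> V" by (cases a) (auto simp: sd_simps)
  then show "\<exists>b\<in>carrier sd. b \<otimes>\<^bsub>sd\<^esub> a = \<one>\<^bsub>sd\<^esub>"
    by (intro bexI[of _ "(inv g, - \<rho> (inv g) v)"]) (simp_all add: sd_simps \<rho>_V subspace_neg[OF V])
qed

lemma inv_sd:
  assumes "g \<in> carrier G" "v \<in> V" shows "inv\<^bsub>sd\<^esub> (g, v) = (inv g, - \<rho> (inv g) v)"
  by (rule group.inv_equality[OF group_sd])
    (use assms in \<open>simp_all add: sd_simps \<rho>_V subspace_neg[OF V]\<close>)

lemma chV: "charted (submanifold V)" by (rule charted_submanifold[OF hV])

lemma N_eq: "N = prod_manifold M (submanifold V)" unfolding semidirect_manifold_def ..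

lemma chN: "charted N" unfolding N_eq by (rule charted_prod_manifold[OF chM chV])

lemma top_N: "topspace (mtop N) = carrier G \<times> V" unfolding N_eq by (simp add: top_M)

lemma curve_Pair:
  assumes \<gamma>: "curve \<gamma> e \<one>" and c: "smooth_on {-e<..<e} c" "c ` {-e<..<e} \<subseteq> V"
  shows "smooth_map (submanifold {-e<..<e}) N (\<lambda>t. (\<gamma> t, c t))"
  unfolding N_eq
proof (rule smooth_map_Pair[OF charted_interval chM chV])
  show "smooth_map (submanifold {-e<..<e}) M \<gamma>" using \<gamma> unfolding curve_def by blast
  have "has_charts {-e<..<e}" by (rule has_charts_open) simp
  then show "smooth_map (submanifold {-e<..<e}) (submanifold V) c"
    using c smooth_map_submanifolds[OF _ hV] by blast
qed

text \<open>\<open>D\<close> is the derivative of \<open>f\<close> at the identity in a product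
  chart, and \<open>k\<close> is the chart of the group factor. Since \<open>D\<close> does not
  depend on the curve, derivatives along different curves can be compared through linearity.\<close>

lemma product_derivative:
  assumes f: "smooth_near N (\<one>, 0) f"
  obtains D :: "'e \<times> 'v \<Rightarrow> real" and W and k :: "'g \<Rightarrow> 'e" where "linear D" "smooth_fun M W k" "\<one> \<in> W"
    "\<And>\<gamma> e c u a. curve \<gamma> e \<one> \<Longrightarrow> smooth_on {-e<..<e} c \<Longrightarrow> c ` {-e<..<e} \<subseteq> V \<Longrightarrow> c 0 = 0 \<Longrightarrow>
      (c has_vector_derivative u) (at 0) \<Longrightarrow> ((\<lambda>t. k (\<gamma> t)) has_vector_derivative a) (at 0) \<Longrightarrow>
      ((\<lambda>t. f (\<gamma> t, c t)) has_field_derivative D (a, u)) (at 0)"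
proof -
  obtain W0 where W0: "(\<one>, 0) \<in> W0" "smooth_fun N W0 f" using f unfolding smooth_near_iff by blast
  have oW0: "openin (mtop N) W0" using W0(2) unfolding smooth_fun_def by blast
  have "\<one> \<in> topspace (mtop M)" using top_M by simp
  then obtain U \<phi> where c: "(U, \<phi>) \<in> atlas M" "\<one> \<in> U" using charted_cover[OF chM] by blast
  have v: "(V, \<lambda>x. x) \<in> atlas (submanifold V)" by (rule identity_chart[OF V]) simp
  let ?m = "map_prod \<phi> (\<lambda>x. x)"
  have cN: "(U \<times> V, ?m) \<in> atlas N" unfolding N_eq by (rule prod_manifold_atlasI[OF c(1) v])
  have oU: "openin (mtop N) (U \<times> V)" by (rule chart_openin[OF chN cN])
  let ?O = "(U \<times> V) \<inter> W0"
  have sm: "smooth_on (?m ` ?O) (f \<circ> inv_into (U \<times> V) ?m)"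
    using W0(2) cN unfolding smooth_fun_def by blast
  have pt: "(\<phi> \<one>, 0) \<in> ?m ` ?O"
    by (rule image_eqI[of _ _ "(\<one>, 0)"]) (use W0(1) c(2) subspace_0[OF V] in simp_all)
  obtain \<Omega> F where F: "open \<Omega>" "(\<phi> \<one>, 0) \<in> \<Omega>" "smooth_on \<Omega> F"
    "\<And>y. y \<in> \<Omega> \<Longrightarrow> y \<in> ?m ` ?O \<Longrightarrow> F y = (f \<circ> inv_into (U \<times> V) ?m) y"
    using smooth_on_extension[OF sm pt] by blast
  define D where "D = frechet_derivative F (at (\<phi> \<one>, 0))"
  have FD: "(F has_derivative D) (at (\<phi> \<one>, 0))" unfolding D_def by (rule smooth_on_has_derivative[OF F(1,3,2)])
  have lD: "linear D" using FD has_derivative_linear by blast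
  have sk: "smooth_fun M U \<phi>"
    unfolding smooth_fun_def using chart_openin[OF chM c(1)] charted_transition[OF chM _ c(1)] by blast
  show ?thesis
  proof (rule that[OF lD sk c(2)])
    fix \<gamma> e c' u a
    assume \<gamma>: "curve \<gamma> e \<one>" and c': "smooth_on {-e<..<e} c'" "c' ` {-e<..<e} \<subseteq> V" "c' 0 = 0"
      "(c' has_vector_derivative u) (at 0)" and a: "((\<lambda>t. \<phi> (\<gamma> t)) has_vector_derivative a) (at 0)"
    have e: "e > 0" "\<gamma> 0 = \<one>" using \<gamma> unfolding curve_def by auto
    let ?p = "\<lambda>t. (\<phi> (\<gamma> t), c' t)"
    have dp: "(?p has_derivative (\<lambda>h. (h *\<^sub>R a, h *\<^sub>R u))) (at 0)"
      using has_derivative_Pair[OF a[unfolded has_vector_derivative_def] c'(4)[unfolded has_vector_derivative_def]] .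
    have "((\<lambda>t. F (?p t)) has_derivative (\<lambda>h. D (h *\<^sub>R a, h *\<^sub>R u))) (at 0)"
      by (rule has_derivative_compose[where g = F, OF dp]) (simp add: e(2) c'(3) FD)
    moreover have "D (h *\<^sub>R a, h *\<^sub>R u) = D (a, u) * h" for h
      using linear_cmul[OF lD, of h "(a, u)"] by simp
    ultimately have DF: "((\<lambda>t. F (?p t)) has_field_derivative D (a, u)) (at 0)"
      by (simp add: has_field_derivative_def)
    have "isCont ?p 0" using has_derivative_continuous[OF dp] .
    then have "(?p \<longlongrightarrow> ?p 0) (nhds 0)"
      using tendsto_at_iff_tendsto_nhds[of ?p 0] by (simp add: isCont_def)
    then have ev1: "\<forall>\<^sub>F t in nhds 0. ?p t \<in> \<Omega>"
      by (rule topological_tendstoD) (use F(1,2) e(2) c'(3) in simp_all)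
    have cont: "continuous_map (mtop (submanifold {-e<..<e})) (mtop N) (\<lambda>t. (\<gamma> t, c' t))"
      by (rule smooth_map_continuous_map[OF curve_Pair[OF \<gamma> c'(1,2)]])
    have "openin (mtop N) ?O" using oU oW0 by blast
    from openin_continuous_map_preimage[OF cont this]
    have "openin (top_of_set {-e<..<e}) {t \<in> {-e<..<e}. (\<gamma> t, c' t) \<in> ?O}" by simp
    from openin_open_eq[OF open_greaterThanLessThan, THEN iffD1, OF this]
    have "open {t \<in> {-e<..<e}. (\<gamma> t, c' t) \<in> ?O}" by (rule conjunct1)
    moreover have "0 \<in> {t \<in> {-e<..<e}. (\<gamma> t, c' t) \<in> ?O}"
      using e c'(3) W0(1) c(2) subspace_0[OF V] by simp
    ultimately have ev2: "\<forall>\<^sub>F t in nhds 0. t \<in> {t \<in> {-e<..<e}. (\<gamma> t, c' t) \<in> ?O}"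
      by (rule eventually_nhds_in_open)
    have ev: "\<forall>\<^sub>F t in nhds 0. F (?p t) = f (\<gamma> t, c' t)"
      using ev1 ev2
    proof eventually_elim
      case (elim t)
      have t: "(\<gamma> t, c' t) \<in> ?O" using elim(2) by blast
      have "?m (\<gamma> t, c' t) \<in> ?m ` ?O" using t by (rule imageI)
      then have "F (?p t) = (f \<circ> inv_into (U \<times> V) ?m) (?m (\<gamma> t, c' t))" using F(4) elim(1) by simp
      also have "\<dots> = f (\<gamma> t, c' t)" using chart_inv[OF chN cN, of "(\<gamma> t, c' t)"] t by simp
      finally show ?case .
    qed
    show "((\<lambda>t. f (\<gamma> t, c' t)) has_field_derivative D (a, u)) (at 0)"
      using DERIV_cong_ev[OF refl ev refl] DF by simp
  qed
qed

lemma smooth_map_base: "smooth_map M N (\<lambda>g. (g, 0))"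
  unfolding N_eq
  by (rule smooth_map_Pair[OF chM chM chV smooth_map_ident[OF chM] smooth_map_const[OF chM chV]])
    (simp add: subspace_0[OF V])

text \<open>Additivity \<open>D (a, u) = D (a, 0) + D (0, u)\<close> splits the derivative along
  \<open>(\<gamma> t, c t)\<close> into the two summands of \<open>semidirect_iso\<close>. The curve
  \<open>c\<close> may be any with derivative \<open>u\<close>, which a conjugated curve calls
  for.\<close>

lemma sdi_velocity:
  assumes \<gamma>: "curve \<gamma> e \<one>" and X: "\<iota> X = velocity M \<gamma>"
    and c: "smooth_on {-e<..<e} c" "c ` {-e<..<e} \<subseteq> V" "c 0 = 0" "(c has_vector_derivative u) (at 0)" and u: "u \<in> V"
  shows "sdi (X, u) = velocity N (\<lambda>t. (\<gamma> t, c t))"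
proof
  fix f
  have e: "e > 0" "\<gamma> 0 = \<one>" using \<gamma> unfolding curve_def by auto
  show "sdi (X, u) f = velocity N (\<lambda>t. (\<gamma> t, c t)) f"
  proof (cases "smooth_near N (\<one>, 0) f")
    case True
    then show ?thesis
    proof (rule product_derivative)
      fix D :: "'e \<times> 'v \<Rightarrow> real" and W and k :: "'g \<Rightarrow> 'e"
      assume D: "linear D" "smooth_fun M W k" "\<one> \<in> W"
        "\<And>\<gamma> e c u a. curve \<gamma> e \<one> \<Longrightarrow> smooth_on {-e<..<e} c \<Longrightarrow> c ` {-e<..<e} \<subseteq> V \<Longrightarrow> c 0 = 0 \<Longrightarrow>
        (c has_vector_derivative u) (at 0) \<Longrightarrow> ((\<lambda>t. k (\<gamma> t)) has_vector_derivative a) (at 0) \<Longrightarrow>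
        ((\<lambda>t. f (\<gamma> t, c t)) has_field_derivative D (a, u)) (at 0)"
      obtain a where a: "((\<lambda>t. k (\<gamma> t)) has_vector_derivative a) (at 0)"
        using curve_smooth_fun[OF \<gamma> D(2,3)] by metis
      have 1: "((\<lambda>t. f (\<gamma> t, c t)) has_field_derivative D (a, u)) (at 0)"
        by (rule D(4)[OF \<gamma> c a])
      have 2: "((\<lambda>t. f (\<gamma> t, 0)) has_field_derivative D (a, 0)) (at 0)"
        by (rule D(4)[OF \<gamma> smooth_on_const _ _ _ a]) (use subspace_0[OF V] in auto)
      have cc: "curve (\<lambda>t. \<one>) e \<one>"
        unfolding curve_def using e(1) smooth_map_const[OF charted_interval chM, of \<one> e] top_M by simp
      have 3: "((\<lambda>t. f (\<one>, t *\<^sub>R u)) has_field_derivative D (0, u)) (at 0)"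
      proof (rule D(4)[OF cc])
        show "smooth_on {-e<..<e} (\<lambda>t. t *\<^sub>R u)" by (intro smooth_on_scaleR smooth_on_ident smooth_on_const)
        show "(\<lambda>t. t *\<^sub>R u) ` {-e<..<e} \<subseteq> V" using u V by (auto simp: subspace_scale)
        show "((\<lambda>t. t *\<^sub>R u) has_vector_derivative u) (at 0)" by (auto intro!: derivative_eq_intros)
      qed simp_all
      have "smooth_near M \<one> (f \<circ> (\<lambda>g. (g, 0)))"
        by (rule smooth_near_pullback[OF chM chN smooth_map_base True]) (simp add: top_M)
      then have "smooth_near M (\<gamma> 0) (\<lambda>g. f (g, 0))" using e(2) by (simp add: comp_def)
      then have "\<iota> X (\<lambda>g. f (g, 0)) = D (a, 0)" unfolding X velocity_def using DERIV_imp_deriv[OF 2] by simp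
      moreover have "D (a, u) = D (a, 0) + D (0, u)" using linear_add[OF D(1), of "(a, 0)" "(0, u)"] by simp
      ultimately show ?thesis
        using True DERIV_imp_deriv[OF 1] DERIV_imp_deriv[OF 3] e(2) c(3)
        by (simp add: semidirect_iso_def velocity_def)
    qed
  qed (simp add: semidirect_iso_def velocity_def e(2) c(3))
qed

lemma \<iota>_not_smooth: assumes "X \<in> L" "\<not> smooth_near M \<one> f" shows "\<iota> X f = 0"
proof -
  obtain \<gamma> e where \<gamma>: "curve \<gamma> e \<one>" "\<iota> X = velocity M \<gamma>" by (rule curve_exists[OF assms(1)])
  then show ?thesis using assms(2) unfolding velocity_def curve_def by simp
qed

lemma \<iota>_const: assumes "X \<in> L" shows "\<iota> X (\<lambda>g. r) = 0"
proof -
  obtain \<gamma> e where \<gamma>: "curve \<gamma> e \<one>" "\<iota> X = velocity M \<gamma>" by (rule curve_exists[OF assms])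
  then show ?thesis unfolding velocity_def by simp
qed

text \<open>Functions pulled back from the group factor recover \<open>\<iota> X\<close>, and linear
  functions of the \<open>V\<close> component recover \<open>u\<close>.\<close>

lemma inj_on_sdi: "inj_on sdi (L \<times> V)"
proof (rule inj_onI, clarify)
  fix X u X' u' assume X: "X \<in> L" "X' \<in> L" and u: "u \<in> V" "u' \<in> V" and eq: "sdi (X, u) = sdi (X', u')"
  have fstmap: "smooth_map N M fst" unfolding N_eq by (rule smooth_map_fst[OF chM chV])
  have sndmap: "smooth_map N (submanifold V) snd" unfolding N_eq by (rule smooth_map_snd[OF chM chV])
  have pt: "(\<one>, 0) \<in> topspace (mtop N)" by (simp add: top_N subspace_0[OF V])
  have "\<iota> X f = \<iota> X' f" for f
  proof (cases "smooth_near M \<one> f")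
    case True
    then have "smooth_near N (\<one>, 0) (f \<circ> fst)"
      by (intro smooth_near_pullback[OF chN chM fstmap _ pt]) simp
    then show ?thesis using fun_cong[OF eq, of "f \<circ> fst"] by (simp add: semidirect_iso_def)
  qed (simp add: \<iota>_not_smooth X)
  then have "\<iota> X = \<iota> X'" by blast
  then have XX: "X = X'" using inj_onD[OF bij_betw_imp_inj_on[OF \<iota>_bij]] X by blast
  have val: "sdi (Y, y) (\<lambda>z. snd z \<bullet> b) = y \<bullet> b" if "Y \<in> L" for Y y b
  proof -
    have "smooth_near (submanifold V) 0 (\<lambda>y. y \<bullet> b)"
      unfolding smooth_near_submanifold[OF hV] using subspace_0[OF V]
      by (intro exI[of _ V]) (simp add: smooth_on_inner smooth_on_ident smooth_on_const)
    then have "smooth_near N (\<one>, 0) ((\<lambda>y. y \<bullet> b) \<circ> snd)"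
      by (intro smooth_near_pullback[OF chN chV sndmap _ pt]) simp
    moreover have "((\<lambda>t. t *\<^sub>R y \<bullet> b) has_field_derivative y \<bullet> b) (at 0)"
      by (auto intro!: derivative_eq_intros)
    ultimately show ?thesis
      using DERIV_imp_deriv \<iota>_const[OF that, of 0] by (simp add: semidirect_iso_def comp_def)
  qed
  have "u \<bullet> b = u' \<bullet> b" for b
    using val[OF X(1), of u b] val[OF X(2), of u' b] eq by simp
  then have "u = u'" using vector_eq_rdot by blast
  then show "X = X' \<and> u = u'" using XX by blast
qed

lemma smooth_conj_sd:
  assumes g: "g \<in> carrier G" "k \<in> carrier G" and v: "v \<in> V" "w \<in> V"
  shows "smooth_map N N (\<lambda>z. (g, v) \<otimes>\<^bsub>sd\<^esub> z \<otimes>\<^bsub>sd\<^esub> (k, w))"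
proof -
  have fstmap: "smooth_map N M fst" unfolding N_eq by (rule smooth_map_fst[OF chM chV])
  have sndmap: "smooth_map N (submanifold V) snd" unfolding N_eq by (rule smooth_map_snd[OF chM chV])
  have eq: "(g, v) \<otimes>\<^bsub>sd\<^esub> z \<otimes>\<^bsub>sd\<^esub> (k, w) = (g \<otimes> fst z \<otimes> k, v + \<rho> g (snd z) + \<rho> (g \<otimes> fst z) w)" for z
    by (cases z) (simp add: sd_simps)
  have 1: "smooth_map N M (\<lambda>z. g \<otimes> fst z \<otimes> k)"
    using smooth_map_compose[OF chN chM chM fstmap smooth_conj[OF g]] by (simp add: comp_def)
  have "smooth_map N (submanifold V) (\<lambda>z. \<rho> (g \<otimes> fst z) w)"
    using smooth_map_compose[OF chN chM chV fstmap
        smooth_map_compose[OF chM chM chV smooth_left[OF g(1)] \<rho>_smooth_map[OF v(2)]]] by (simp add: comp_def)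
  then have a: "smooth_fun N (topspace (mtop N)) (\<lambda>z. \<rho> (g \<otimes> fst z) w)"
    using smooth_map_into_submanifold[OF chN hV] by blast
  have "smooth_fun N (topspace (mtop N)) snd"
    using sndmap smooth_map_into_submanifold[OF chN hV] by blast
  moreover have lin: "linear (\<lambda>y. \<rho> g (PV y))"
    by (rule linearI) (simp_all add: linear_add[OF PV(1)] linear_cmul[OF PV(1)] \<rho>_add \<rho>_scale g PV(2))
  ultimately have "smooth_fun N (topspace (mtop N)) (\<lambda>z. \<rho> g (PV (snd z)))"
    using smooth_fun_compose[OF chN _ smooth_on_linear[OF lin, of UNIV], of _ snd] by blast
  from smooth_fun_compose[OF chN smooth_fun_Pair[OF this a], of UNIV "\<lambda>p. v + fst p + snd p"]
  have "smooth_fun N (topspace (mtop N)) (\<lambda>z. v + \<rho> g (PV (snd z)) + \<rho> (g \<otimes> fst z) w)"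
    by (simp add: smooth_on_add smooth_on_const smooth_on_fst smooth_on_snd smooth_on_ident)
  then have b: "smooth_fun N (topspace (mtop N)) (\<lambda>z. v + \<rho> g (snd z) + \<rho> (g \<otimes> fst z) w)"
    by (rule smooth_fun_cong[OF chN]) (auto simp: top_N PV(3))
  have "smooth_map N (submanifold V) (\<lambda>z. v + \<rho> g (snd z) + \<rho> (g \<otimes> fst z) w)"
    unfolding smooth_map_into_submanifold[OF chN hV]
    using b g v by (auto simp: top_N \<rho>_V subspace_add[OF V])
  from smooth_map_Pair[OF chN chM chV 1 this]
  show ?thesis unfolding eq N_eq .
qed

text \<open>Only this component enters the coadjoint action on \<open>(0, x)\<close>.\<close>

lemma Ad_sd:
  assumes g: "g \<in> carrier G" and v: "v \<in> V" and X: "X \<in> L" and u: "u \<in> V"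
  shows "snd (Ad sd N (L \<times> V) sdi (inv\<^bsub>sd\<^esub> (g, v)) (X, u)) = \<rho> (inv g) (u + Rm X v)"
proof -
  let ?g = "inv g" and ?v = "- \<rho> (inv g) v"
  have g': "?g \<in> carrier G" using g by simp
  have v': "?v \<in> V" using \<rho>_V[OF g' v] subspace_neg[OF V] by blast
  obtain \<gamma> e where \<gamma>: "curve \<gamma> e \<one>" "\<iota> X = velocity M \<gamma>" by (rule curve_exists[OF X])
  have e: "e > 0" "\<gamma> 0 = \<one>" using \<gamma>(1) unfolding curve_def by auto
  \<comment> \<open>The interval is shrunk until \<open>\<rho> (\<gamma> t) v\<close>, which enters
    the second component of the conjugated curve, is smooth on all of it.\<close>
  obtain d0 where d0: "d0 > 0" "d0 \<le> e" "smooth_on {-d0<..<d0} (\<lambda>t. \<rho> (\<gamma> t) v)"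
    using curve_smooth_fun[OF \<gamma>(1) \<rho>_smooth_fun[OF v] one_closed] by metis
  have sub: "{-d0<..<d0} \<subseteq> {-e<..<e}" using d0(2) by auto
  have \<gamma>': "curve \<gamma> d0 \<one>"
  proof -
    have "has_charts {-e<..<e}" "has_charts {-d0<..<d0}" by (rule has_charts_open; simp)+
    then have "smooth_map (submanifold {-d0<..<d0}) (submanifold {-e<..<e}) (\<lambda>t. t)"
      using smooth_map_submanifolds smooth_on_ident sub by (metis image_ident)
    from smooth_map_compose[OF charted_interval charted_interval chM this, of \<gamma>]
    have "smooth_map (submanifold {-d0<..<d0}) M \<gamma>" using \<gamma>(1) unfolding curve_def by (simp add: comp_def)
    then show ?thesis unfolding curve_def using d0(1) e(2) by blast
  qed
  let ?F = "\<lambda>z. inv\<^bsub>sd\<^esub> (g, v) \<otimes>\<^bsub>sd\<^esub> z \<otimes>\<^bsub>sd\<^esub> inv\<^bsub>sd\<^esub> (inv\<^bsub>sd\<^esub> (g, v))"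
  have Feq: "?F = (\<lambda>z. (?g, ?v) \<otimes>\<^bsub>sd\<^esub> z \<otimes>\<^bsub>sd\<^esub> (g, v))"
    using group.inv_inv[OF group_sd, of "(g, v)"] g v inv_sd[OF g v] by (simp add: sd_simps)
  have sF: "smooth_map N N ?F" unfolding Feq by (rule smooth_conj_sd[OF g' g v' v])
  have F1: "?F (\<one>, 0) = (\<one>, 0)" using fun_cong[OF Feq, of "(\<one>, 0)"] g v by (simp add: sd_simps \<rho>_zero)
  let ?\<gamma>2 = "\<lambda>t. ?g \<otimes> \<gamma> t \<otimes> g"
  have \<gamma>2: "curve ?\<gamma>2 d0 \<one>" using curve_map[OF \<gamma>' smooth_conj[OF g' g]] g by simp
  obtain X' where X': "X' \<in> L" "\<iota> X' = velocity M ?\<gamma>2" using curve_velocity[OF \<gamma>2] by metis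
  \<comment> \<open>The second component of the conjugate of
    \<open>(\<gamma> t, t *\<^sub>R u)\<close>; the summand \<open>- v\<close> comes from the
    inverse of \<open>(g, v)\<close>. The projection makes the outer map linear on the ambient space
    and changes nothing on \<open>V\<close>.\<close>
  define c where "c t = \<rho> ?g (PV (t *\<^sub>R u + \<rho> (\<gamma> t) v - v))" for t
  have lin: "linear (\<lambda>y. \<rho> ?g (PV y))"
    by (rule linearI) (simp_all add: linear_add[OF PV(1)] linear_cmul[OF PV(1)] \<rho>_add \<rho>_scale g PV(2))
  have c: "smooth_on {-d0<..<d0} c" "c ` {-d0<..<d0} \<subseteq> V" "c 0 = 0"
  proof -
    show "smooth_on {-d0<..<d0} c" unfolding c_def
      by (intro smooth_on_linear_compose[OF lin] smooth_on_diff smooth_on_add smooth_on_scaleR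
          smooth_on_ident smooth_on_const d0(3))
    show "c ` {-d0<..<d0} \<subseteq> V" unfolding c_def using \<rho>_V[OF g' PV(2)] by blast
    show "c 0 = 0" unfolding c_def using e(2) \<rho>_one[OF v] \<rho>_zero[OF g'] linear_0[OF PV(1)] by simp
  qed
  have bl: "bounded_linear (\<lambda>y. \<rho> ?g (PV y))" using lin by (simp add: linear_conv_bounded_linear)
  have "((\<lambda>t. t *\<^sub>R u + \<rho> (\<gamma> t) v - v) has_vector_derivative 1 *\<^sub>R u + Rm X v - 0) (at 0)"
    by (intro has_vector_derivative_diff has_vector_derivative_add has_vector_derivative_const
        velocity_rep[OF \<gamma>(1,2) v]) (auto intro!: derivative_eq_intros)
  from bounded_linear.has_vector_derivative[OF bl this]
  have c': "(c has_vector_derivative \<rho> ?g (u + Rm X v)) (at 0)"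
    unfolding c_def using PV(3)[OF subspace_add[OF V u Rm_in_V[OF X v]]] by simp
  have c'V: "\<rho> ?g (u + Rm X v) \<in> V" by (rule \<rho>_V[OF g' subspace_add[OF V u Rm_in_V[OF X v]]])
  have curveF: "?F (\<gamma> t, t *\<^sub>R u) = (?\<gamma>2 t, c t)" if t: "t \<in> {-d0<..<d0}" for t
  proof -
    have \<gamma>t: "\<gamma> t \<in> carrier G" by (rule curve_in[OF \<gamma>' t])
    have "t *\<^sub>R u \<in> V" "\<rho> (\<gamma> t) v \<in> V" using u v \<gamma>t \<rho>_V V by (auto simp: subspace_scale)
    moreover from this have "t *\<^sub>R u + \<rho> (\<gamma> t) v \<in> V" "- v \<in> V" using v V by (auto simp: subspace_add subspace_neg)
    ultimately have "c t = \<rho> ?g (t *\<^sub>R u) + \<rho> ?g (\<rho> (\<gamma> t) v) - \<rho> ?g v"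
      unfolding c_def using v V g' \<rho>_add[of ?g "t *\<^sub>R u + \<rho> (\<gamma> t) v" "- v"]
      by (simp add: PV(3) subspace_diff \<rho>_add \<rho>_minus)
    then show ?thesis using fun_cong[OF Feq, of "(\<gamma> t, t *\<^sub>R u)"] g \<gamma>t v by (simp add: sd_simps \<rho>_mult)
  qed
  have tu: "smooth_on {-d0<..<d0} (\<lambda>t. t *\<^sub>R u)" "(\<lambda>t. t *\<^sub>R u) ` {-d0<..<d0} \<subseteq> V"
    "((\<lambda>t. t *\<^sub>R u) has_vector_derivative u) (at 0)"
    using u V by (auto intro!: smooth_on_scaleR smooth_on_ident smooth_on_const derivative_eq_intros simp: subspace_scale)
  have iso1: "sdi (X, u) = velocity N (\<lambda>t. (\<gamma> t, t *\<^sub>R u))"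
    by (rule sdi_velocity[OF \<gamma>' \<gamma>(2) tu(1,2) _ tu(3) u]) simp
  have "pushforward N N (\<one>, 0) ?F (sdi (X, u)) = velocity N (\<lambda>t. ?F (\<gamma> t, t *\<^sub>R u))"
  proof
    fix f
    show "pushforward N N (\<one>, 0) ?F (sdi (X, u)) f = velocity N (\<lambda>t. ?F (\<gamma> t, t *\<^sub>R u)) f"
    proof (cases "smooth_near N (\<one>, 0) f")
      case True
      have "smooth_near N (\<one>, 0) (f \<circ> ?F)"
        by (rule smooth_near_pullback[OF chN chN sF]) (use True F1 in \<open>simp_all add: top_N subspace_0[OF V]\<close>)
      then show ?thesis using True F1 e(2) unfolding pushforward_def iso1 velocity_def by (simp add: comp_def)
    qed (use F1 e(2) in \<open>simp add: pushforward_def velocity_def\<close>)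
  qed
  also have "\<dots> = velocity N (\<lambda>t. (?\<gamma>2 t, c t))" by (rule velocity_cong[OF d0(1) curveF])
  also have "\<dots> = sdi (X', \<rho> ?g (u + Rm X v))"
    by (rule sdi_velocity[OF \<gamma>2 X'(2) c c' c'V, symmetric])
  finally have "pushforward N N \<one>\<^bsub>sd\<^esub> ?F (sdi (X, u)) = sdi (X', \<rho> ?g (u + Rm X v))"
    by (simp add: sd_simps(3))
  then have "Ad sd N (L \<times> V) sdi (inv\<^bsub>sd\<^esub> (g, v)) (X, u) = (X', \<rho> ?g (u + Rm X v))"
    unfolding Ad_def using inv_into_f_f[OF inj_on_sdi, of "(X', \<rho> ?g (u + Rm X v))"] X'(1) c'V by simp
  then show ?thesis by simp
qed

section \<open>The moment map and the shape of the orbit\<close>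

lemma moment_map:
  assumes v: "v \<in> V" shows "moment_map L \<iota> \<rho> v w \<in> L" "X \<in> L \<Longrightarrow> moment_map L \<iota> \<rho> v w \<bullet> X = Rm X v \<bullet> w"
    "Z \<in> L \<Longrightarrow> (\<And>X. X \<in> L \<Longrightarrow> Z \<bullet> X = Rm X v \<bullet> w) \<Longrightarrow> moment_map L \<iota> \<rho> v w = Z"
proof -
  have uniq: "Z = Z'" if "Z \<in> L" "Z' \<in> L" "\<And>X. X \<in> L \<Longrightarrow> Z \<bullet> X = Z' \<bullet> X" for Z Z'
  proof -
    have "Z - Z' \<in> L" using that L by (simp add: subspace_diff)
    then have "(Z - Z') \<bullet> (Z - Z') = 0" using that(3) by (simp add: inner_diff_left)
    then show ?thesis by simp
  qed
  obtain Z0 where Z0: "Z0 \<in> L" "\<And>X. X \<in> L \<Longrightarrow> Z0 \<bullet> X = Rm X v \<bullet> w"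
    by (rule riesz_subspace[OF L, of "\<lambda>X. Rm X v \<bullet> w"])
      (simp_all add: Rm_add_left Rm_scale_left inner_add_left)
  have m: "moment_map L \<iota> \<rho> v w = Z" if "Z \<in> L" "\<And>X. X \<in> L \<Longrightarrow> Z \<bullet> X = Rm X v \<bullet> w" for Z
    unfolding moment_map_def
  proof (rule the_equality)
    show "Z \<in> L \<and> (\<forall>X\<in>L. Z \<bullet> X = Rm X v \<bullet> w)" using that by blast
    fix Z' assume "Z' \<in> L \<and> (\<forall>X\<in>L. Z' \<bullet> X = Rm X v \<bullet> w)"
    then show "Z' = Z" using uniq that by metis
  qed
  show "moment_map L \<iota> \<rho> v w \<in> L" using m[OF Z0] Z0(1) by simp
  show "moment_map L \<iota> \<rho> v w \<bullet> X = Rm X v \<bullet> w" if "X \<in> L" using m[OF Z0] Z0(2)[OF that] by simp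
  show "moment_map L \<iota> \<rho> v w = Z" if "Z \<in> L" "\<And>X. X \<in> L \<Longrightarrow> Z \<bullet> X = Rm X v \<bullet> w" by (rule m[OF that])
qed

text \<open>The first component of \<open>(0, x)\<close> vanishes, so only the \<open>V\<close>
  component of the adjoint action is paired. Moving \<open>\<rho> (inv g)\<close> to the other side
  by invariance leaves \<open>\<rho> g x \<bullet> (u + Rm X v)\<close>, whose second part is the
  moment map by definition.\<close>

lemma coAd_sd:
  assumes g: "g \<in> carrier G" and v: "v \<in> V"
  shows "coAd sd N (L \<times> V) sdi (g, v) (0, x) = (moment_map L \<iota> \<rho> v (\<rho> g x), \<rho> g x)"
proof -
  have gx: "\<rho> g x \<in> V" by (rule \<rho>_V[OF g x])
  let ?\<zeta> = "(moment_map L \<iota> \<rho> v (\<rho> g x), \<rho> g x)"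
  have val: "?\<zeta> \<bullet> (X, u) = (0, x) \<bullet> Ad sd N (L \<times> V) sdi (inv\<^bsub>sd\<^esub> (g, v)) (X, u)" if X: "X \<in> L" and u: "u \<in> V" for X u
  proof -
    have uV: "u + Rm X v \<in> V" by (rule subspace_add[OF V u Rm_in_V[OF X v]])
    have "(0, x) \<bullet> Ad sd N (L \<times> V) sdi (inv\<^bsub>sd\<^esub> (g, v)) (X, u) = x \<bullet> \<rho> (inv g) (u + Rm X v)"
      using Ad_sd[OF g v X u] by (simp add: inner_prod_def)
    also have "\<dots> = \<rho> g x \<bullet> \<rho> g (\<rho> (inv g) (u + Rm X v))"
      using orth[OF g x \<rho>_V[OF inv_closed[OF g] uV]] by simp
    also have "\<dots> = \<rho> g x \<bullet> (u + Rm X v)" using \<rho>_inv(2)[OF g uV] by simp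
    also have "\<dots> = ?\<zeta> \<bullet> (X, u)"
      using moment_map(2)[OF v X] by (simp add: inner_add_right inner_commute)
    finally show ?thesis by simp
  qed
  show ?thesis unfolding coAd_def
  proof (rule the_equality)
    show "?\<zeta> \<in> L \<times> V \<and> (\<forall>\<eta>\<in>L \<times> V. ?\<zeta> \<bullet> \<eta> = (0, x) \<bullet> Ad sd N (L \<times> V) sdi (inv\<^bsub>sd\<^esub> (g, v)) \<eta>)"
      using val moment_map(1)[OF v] gx by auto
    fix \<zeta> assume z: "\<zeta> \<in> L \<times> V \<and> (\<forall>\<eta>\<in>L \<times> V. \<zeta> \<bullet> \<eta> = (0, x) \<bullet> Ad sd N (L \<times> V) sdi (inv\<^bsub>sd\<^esub> (g, v)) \<eta>)"
    have orthogonal: "(\<zeta> - ?\<zeta>) \<bullet> \<eta> = 0" if "\<eta> \<in> L \<times> V" for \<eta>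
      using z val that by (cases \<eta>) (auto simp: inner_diff_left)
    have "\<zeta> - ?\<zeta> \<in> L \<times> V"
      using z moment_map(1)[OF v] gx subspace_diff[OF L] subspace_diff[OF V] by (cases \<zeta>) auto
    then have "(\<zeta> - ?\<zeta>) \<bullet> (\<zeta> - ?\<zeta>) = 0" by (rule orthogonal)
    then show "\<zeta> = ?\<zeta>" by (simp only: inner_eq_zero_iff eq_iff_diff_eq_0[symmetric])
  qed
qed

text \<open>Skew-symmetry turns \<open>Rm X v \<bullet> w\<close> into
  \<open>- (v \<bullet> Rm X w)\<close>, which is the pairing that defines the model; the sign is
  absorbed by \<open>v\<close>.\<close>

lemma moment_image_eq:
  assumes w: "w \<in> S" shows "moment_image L \<iota> V \<rho> w = {Z. (Z, w) \<in> cm.C}"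
proof (intro equalityI subsetI)
  have wV: "w \<in> V" using w S_subset by blast
  { fix Z assume "Z \<in> moment_image L \<iota> V \<rho> w"
    then obtain v where v: "v \<in> V" "Z = moment_map L \<iota> \<rho> v w" unfolding moment_image_def by blast
    have "Z \<bullet> X = (- v) \<bullet> R X w" for X
    proof -
      have "Z \<bullet> X = Z \<bullet> PL X"
        using PL(4)[OF moment_map(1)[OF v(1)]] v(2) by (simp add: inner_commute)
      also have "\<dots> = Rm (PL X) v \<bullet> w" using moment_map(2)[OF v(1) PL(2)] v(2) by simp
      also have "\<dots> = - (v \<bullet> Rm (PL X) w)" by (rule Rm_skew[OF PL(2) v(1) wV])
      finally show ?thesis by (simp add: R_def PV(3)[OF wV])
    qed
    then show "Z \<in> {Z. (Z, w) \<in> cm.C}" unfolding cm.C_def using w by blast }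
  { fix Z assume "Z \<in> {Z. (Z, w) \<in> cm.C}"
    then obtain v where v: "\<And>X. Z \<bullet> X = v \<bullet> R X w" unfolding cm.C_def by blast
    \<comment> \<open>As \<open>R\<close> sees only the projection of \<open>X\<close>, the vector
      \<open>Z\<close> pairs trivially with the complement of \<open>L\<close> and therefore lies in
      \<open>L\<close>.\<close>
    have "Z \<bullet> X = Z \<bullet> PL X" for X
      unfolding v R_def using PL(3)[OF PL(2)] by simp
    then have "Z \<bullet> X = PL Z \<bullet> X" for X using PL(4)[OF PL(2), of Z X] PL(4)[OF PL(2), of X Z]
      by (metis inner_commute)
    then have Z: "Z \<in> L" using PL(2) vector_eq_rdot by metis
    have "moment_map L \<iota> \<rho> (- PV v) w = Z"
    proof (rule moment_map(3)[OF _ Z])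
      show pv: "- PV v \<in> V" using PV(2) subspace_neg[OF V] by blast
      fix X assume X: "X \<in> L"
      have "Z \<bullet> X = v \<bullet> Rm X w" unfolding v R_def using PL(3)[OF X] PV(3)[OF wV] by simp
      also have "\<dots> = PV v \<bullet> Rm X w" using PV(4)[OF Rm_in_V[OF X wV]] by simp
      also have "\<dots> = Rm X (- PV v) \<bullet> w" using Rm_skew[OF X pv wV] by simp
      finally show "Z \<bullet> X = Rm X (- PV v) \<bullet> w" .
    qed
    moreover have "- PV v \<in> V" using PV(2) subspace_neg[OF V] by blast
    ultimately show "Z \<in> moment_image L \<iota> V \<rho> w" unfolding moment_image_def by blast }
qed

text \<open>For fixed \<open>g\<close> the vector \<open>v\<close> runs through all of
  \<open>V\<close>, so the first component fills the whole moment image at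
  \<open>\<rho> g x\<close>.\<close>

lemma coadjoint_orbit_eq: "semidirect_coadjoint_orbit G M L \<iota> V \<rho> (0, x) = cm.C"
proof -
  have "semidirect_coadjoint_orbit G M L \<iota> V \<rho> (0, x) =
      (\<lambda>(g, v). (moment_map L \<iota> \<rho> v (\<rho> g x), \<rho> g x)) ` (carrier G \<times> V)"
    unfolding semidirect_coadjoint_orbit_def coadjoint_orbit_def sd_simps(1)
    by (rule image_cong) (use coAd_sd in auto)
  also have "\<dots> = {(Z, w). w \<in> S \<and> Z \<in> moment_image L \<iota> V \<rho> w}"
    unfolding rep_orbit_def moment_image_def by auto
  also have "\<dots> = cm.C"
    using moment_image_eq by (auto simp: cm.C_def)
  finally show ?thesis .
qed

end

theorem proposition2:
  fixes G :: "'g monoid"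
    and M :: "('g, 'e::euclidean_space) manifold"
    and L :: "'l::euclidean_space set"
    and \<iota> :: "'l \<Rightarrow> ('g \<Rightarrow> real) \<Rightarrow> real"
    and V :: "'v::euclidean_space set"
    and \<rho> :: "'g \<Rightarrow> 'v \<Rightarrow> 'v"
    and x :: 'v
  assumes "lie_group G M"
    and "compact_space (mtop M)"
    and "connected_space (mtop M)"
    and "lie_algebra_of G M L \<iota>"
    and "\<forall>g\<in>carrier G. \<forall>X\<in>L. \<forall>Y\<in>L. Ad G M L \<iota> g X \<bullet> Ad G M L \<iota> g Y = X \<bullet> Y"
    and "smooth_representation G M V \<rho>"
    and "\<forall>g\<in>carrier G. \<forall>u\<in>V. \<forall>v\<in>V. \<rho> g u \<bullet> \<rho> g v = u \<bullet> v"
    and "x \<in> V"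
  defines "B \<equiv> submanifold (rep_orbit G \<rho> x)"
    and "C \<equiv> submanifold (semidirect_coadjoint_orbit G M L \<iota> V \<rho> (0, x))"
  shows "smooth_manifold B \<and> smooth_manifold C \<and> smooth_manifold (cotangent_bundle B) \<and>
    (\<exists>\<phi>. diffeomorphism C (cotangent_bundle B) \<phi> \<and>
      (\<forall>w\<in>rep_orbit G \<rho> x.
         \<phi> ` (moment_image L \<iota> V \<rho> w \<times> {w}) = {w} \<times> cotangent_space B w \<and>
         (\<exists>\<Lambda>. pointwise_linear_on (moment_image L \<iota> V \<rho> w) \<Lambda> \<and>
              bij_betw \<Lambda> (moment_image L \<iota> V \<rho> w) (cotangent_space B w) \<and>
              (\<forall>Z\<in>moment_image L \<iota> V \<rho> w. \<phi> (Z, w) = (w, \<Lambda> Z)))))"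
proof -
  interpret o: lie_rep_orbit G M L \<iota> V \<rho> x
    by unfold_locales (use assms(1,2,4,6,7,8) in auto)
  show ?thesis
    unfolding B_def C_def o.coadjoint_orbit_eq
    using o.cm.smooth_manifold_S o.cm.smooth_manifold_C o.cm.smooth_manifold_CB o.cm.diffeomorphism_f
      o.cm.fiber_isomorphism[OF _ o.moment_image_eq]
    unfolding o.cm.CB_def by blast
qed

end
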